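(* Let $\mathcal{N}\subset\mathcal{M}$ be a unital, connected inclusion of finite-dimensional C*-algebras, $\mathcal{N}\cong\bigoplus_{j=1}^nM_{k_j}(\mathbb{C})$ and $\mathcal{M}\cong\bigoplus_{i=1}^mM_{h_i}(\mathbb{C})$. Let $\Lambda$ be its Bratteli inclusion matrix, $k=(k_1,\ldots,k_n)^t$, $h=(h_1,\ldots,h_m)^t$ (so $\Lambda k=h$), and $d:=\|\Lambda\|$. Then: (i) the matrix dimension $D$ equals the Jones index matrix $\Lambda^{\mathcal{M}}_{\mathcal{N}}$, and both equal $\Lambda$; (ii) the inclusion is extremal, i.e. the minimal conditional expectation $E^0$ equals the Markov-trace-preserving expectation $E^\tau$; (iii) the inclusion is super-extremal if and only if $\Lambda^th=d^2k$.
   Context: Connected means $\mathcal{Z}(\mathcal{N})\cap\mathcal{Z}(\mathcal{M})=\mathbb{C}\mathbb{1}$. The Bratteli inclusion matrix $\Lambda=(\Lambda_{ij})$ is $m\times n$, where $\Lambda_{ij}$ is the multiplicity with which the $j$-th summand of $\mathcal{N}$ embeds into the $i$-th summand of $\mathcal{M}$. $\|\cdot\|$ is the operator norm for Euclidean norms. Let $p_i$ and $q_j$ be the minimal central projections of $\mathcal{M}$ and $\mathcal{N}$. The matrix dimension $D$ has entries $d_{ij}=[q_j\mathcal{M}p_iq_j:\mathcal{N}p_iq_j]_0^{1/2}$ if $p_iq_j\neq0$ and $0$ otherwise. Here $[\cdot:\cdot]_0=\inf_E\|\mathrm{Ind}(E)\|$ is the minimal index over conditional expectations, with $\mathrm{Ind}$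 the Kosaki index. The Jones index matrix $\Lambda^{\mathcal{M}}_{\mathcal{N}}$ has entries $[q_j\mathcal{M}p_iq_j:\mathcal{N}p_iq_j]^{1/2}$ (square root of the Jones index defined via the trace) if $p_iq_j\neq0$ and $0$ otherwise. $E^0$ is the unique expectation $\mathcal{M}\to\mathcal{N}$ minimizing $\|\mathrm{Ind}(E)\|$. The Markov trace $\tau$ of the inclusion is the unique faithful tracial state on $\mathcal{M}$ whose trace vector $s$ ($s_i$ = value of $\tau$ on a minimal projection of the $i$-th summand) satisfies $\Lambda\Lambda^ts=\|\Lambda\|^2s$. $E^\tau$ is the unique $\tau$-preserving conditional expectation $\mathcal{M}\to\mathcal{N}$. Let $\nu_j$ be the squared entries of the $\ell^2$-normalized positive Perron–Frobenius eigenvector of $D^tD$, and set $\omega_l(q_j)=\nu_j$ (a state on $\mathcal{Z}(\mathcal{N})$). The inclusion is called extremal if $E^0=E^\tau$, and super-extremal if it is extremal and in addition $\omega_l=\tau|_{\mathcal{Z}(\mathcal{N})}$. (This is equivalent to the spherical state $\omega_l\circ E^0$ on $\mathcal{N}'\cap\mathcal{M}$ coinciding with $\tau|_{\mathcal{N}'\cap\mathcal{M}}$.) *)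

theory Defs
  imports "HOL-Analysis.Analysis"
begin

text \<open>Finite-dimensional C*-algebras are represented concretely as unital
 *-subalgebras of the full matrix algebra of complex matrices indexed by a
 finite type 'n (every finite-dimensional C*-algebra admits such a faithful
 unital representation; all notions below are representation independent).\<close>

type_synonym 'n cmat = "complex^'n^'n"

definition adj :: "('n::finite) cmat \<Rightarrow> 'n cmat" where
  "adj A = (\<chi> i j. cnj (A $ j $ i))"

definition smult :: "complex \<Rightarrow> ('n::finite) cmat \<Rightarrow> 'n cmat" where
  "smult c A = (\<chi> i j. c * A $ i $ j)"

definition mnorm :: "('n::finite) cmat \<Rightarrow> real" where
  "mnorm X = onorm (\<lambda>v::complex^'n. X *v v)"

definition mtrace :: "('n::finite) cmat \<Rightarrow> complex" where
  "mtrace X = (\<Sum>i\<in>UNIV. X $ i $ i)"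

definition psd :: "('n::finite) cmat \<Rightarrow> bool" where
  "psd X \<longleftrightarrow> (\<exists>Y. X = adj Y ** Y)"

text \<open>A *-algebra of matrices with unit u (u need not be the identity matrix,
 so that reduced (corner) algebras are covered).\<close>
definition star_alg :: "('n::finite) cmat set \<Rightarrow> 'n cmat \<Rightarrow> bool" where
  "star_alg A u \<longleftrightarrow> 0 \<in> A \<and> u \<in> A \<and>
     (\<forall>x\<in>A. \<forall>y\<in>A. x + y \<in> A \<and> x ** y \<in> A) \<and>
     (\<forall>c. \<forall>x\<in>A. smult c x \<in> A) \<and> (\<forall>x\<in>A. adj x \<in> A) \<and>
     (\<forall>x\<in>A. u ** x = x \<and> x ** u = x)"

definition center :: "('n::finite) cmat set \<Rightarrow> 'n cmat set" where
  "center A = {z \<in> A. \<forall>x\<in>A. z ** x = x ** z}"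

definition is_proj :: "('n::finite) cmat \<Rightarrow> bool" where
  "is_proj p \<longleftrightarrow> p ** p = p \<and> adj p = p"

text \<open>Minimal central projections (they index the simple summands).\<close>
definition mcp :: "('n::finite) cmat set \<Rightarrow> 'n cmat set" where
  "mcp A = {p. p \<in> center A \<and> is_proj p \<and> p \<noteq> 0 \<and>
     (\<forall>q. q \<in> center A \<and> is_proj q \<and> q ** p = q \<longrightarrow> q = 0 \<or> q = p)}"

definition minproj :: "('n::finite) cmat set \<Rightarrow> 'n cmat \<Rightarrow> bool" where
  "minproj A e \<longleftrightarrow> e \<in> A \<and> is_proj e \<and> e \<noteq> 0 \<and>
     (\<forall>f\<in>A. is_proj f \<and> f ** e = f \<longrightarrow> f = 0 \<or> f = e)"

definition minproj_under :: "('n::finite) cmat set \<Rightarrow> 'n cmat \<Rightarrow> 'n cmat" where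
  "minproj_under A p = (SOME e. minproj A e \<and> e ** p = e)"

definition cut :: "('n::finite) cmat set \<Rightarrow> 'n cmat \<Rightarrow> 'n cmat set" where
  "cut A p = {x ** p | x. x \<in> A}"

definition corner :: "('n::finite) cmat \<Rightarrow> 'n cmat set \<Rightarrow> 'n cmat set" where
  "corner p A = {p ** x ** p | x. x \<in> A}"

text \<open>If A is isomorphic to M_k(C) then k = sqrt(dim_C A); dim below is the real
 dimension, which is twice the complex one.\<close>
definition msize :: "('n::finite) cmat set \<Rightarrow> real" where
  "msize A = sqrt (real (dim A) / 2)"

definition ssize :: "('n::finite) cmat set \<Rightarrow> 'n cmat \<Rightarrow> real" where
  "ssize N q = msize (cut N q)"

text \<open>Bratteli inclusion matrix, indexed by (p_i, q_j): the multiplicity with which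
 the summand N q_j embeds into M p_i via x \<mapsto> x p_i, i.e. the number of minimal
 projections of M p_i into which e p_i splits (e a minimal projection of N q_j);
 computed as rank(e p_i)/rank(f) for f a minimal projection of M p_i.\<close>
definition Lam :: "('n::finite) cmat set \<Rightarrow> 'n cmat set \<Rightarrow> 'n cmat \<Rightarrow> 'n cmat \<Rightarrow> real" where
  "Lam N M p q = Re (mtrace (minproj_under N q ** p)) / Re (mtrace (minproj_under M p))"

definition rnorm :: "'a set \<Rightarrow> 'b set \<Rightarrow> ('a \<Rightarrow> 'b \<Rightarrow> real) \<Rightarrow> real" where
  "rnorm P Q L = Sup {sqrt (\<Sum>i\<in>P. (\<Sum>j\<in>Q. L i j * x j)^2) | x. (\<Sum>j\<in>Q. (x j)^2) \<le> 1}"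

definition connected_incl :: "('n::finite) cmat set \<Rightarrow> 'n cmat set \<Rightarrow> bool" where
  "connected_incl N M \<longleftrightarrow> center N \<inter> center M = range mat"

text \<open>(Faithful) conditional expectations E : A \<rightarrow> B; E is taken to vanish off A
 so that it is determined as a function.\<close>
definition cond_exp :: "('n::finite) cmat set \<Rightarrow> 'n cmat set \<Rightarrow> ('n cmat \<Rightarrow> 'n cmat) \<Rightarrow> bool" where
  "cond_exp A B E \<longleftrightarrow> (\<forall>x. x \<notin> A \<longrightarrow> E x = 0) \<and> (\<forall>x\<in>A. E x \<in> B) \<and> (\<forall>b\<in>B. E b = b) \<and>
     (\<forall>x\<in>A. \<forall>y\<in>A. E (x + y) = E x + E y) \<and> (\<forall>c. \<forall>x\<in>A. E (smult c x) = smult c (E x)) \<and>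
     (\<forall>x\<in>A. \<forall>b1\<in>B. \<forall>b2\<in>B. E (b1 ** x ** b2) = b1 ** E x ** b2) \<and>
     (\<forall>x\<in>A. psd (E (adj x ** x))) \<and> (\<forall>x\<in>A. E (adj x ** x) = 0 \<longrightarrow> x = 0)"

definition quasi_basis :: "('n::finite) cmat set \<Rightarrow> ('n cmat \<Rightarrow> 'n cmat) \<Rightarrow> 'n cmat list \<Rightarrow> bool" where
  "quasi_basis A E us \<longleftrightarrow> set us \<subseteq> A \<and>
     (\<forall>x\<in>A. x = sum_list (map (\<lambda>u. u ** E (adj u ** x)) us) \<and>
             x = sum_list (map (\<lambda>u. E (x ** u) ** adj u) us))"

definition Ind :: "('n::finite) cmat set \<Rightarrow> ('n cmat \<Rightarrow> 'n cmat) \<Rightarrow> 'n cmat" where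
  "Ind A E = (SOME z. \<exists>us. quasi_basis A E us \<and> z = sum_list (map (\<lambda>u. u ** adj u) us))"

definition min_index :: "('n::finite) cmat set \<Rightarrow> 'n cmat set \<Rightarrow> real" where
  "min_index A B = Inf {mnorm (Ind A E) | E. cond_exp A B E}"

definition E0 :: "('n::finite) cmat set \<Rightarrow> 'n cmat set \<Rightarrow> ('n cmat \<Rightarrow> 'n cmat)" where
  "E0 A B = (THE E. cond_exp A B E \<and> (\<forall>E'. cond_exp A B E' \<longrightarrow> mnorm (Ind A E) \<le> mnorm (Ind A E')))"

definition tracial_state :: "('n::finite) cmat set \<Rightarrow> 'n cmat \<Rightarrow> ('n cmat \<Rightarrow> complex) \<Rightarrow> bool" where
  "tracial_state A u \<phi> \<longleftrightarrow> (\<forall>x. x \<notin> A \<longrightarrow> \<phi> x = 0) \<and>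
     (\<forall>x\<in>A. \<forall>y\<in>A. \<phi> (x + y) = \<phi> x + \<phi> y \<and> \<phi> (x ** y) = \<phi> (y ** x)) \<and>
     (\<forall>c. \<forall>x\<in>A. \<phi> (smult c x) = c * \<phi> x) \<and>
     (\<forall>x\<in>A. \<phi> (adj x ** x) \<in> \<real> \<and> 0 \<le> Re (\<phi> (adj x ** x))) \<and>
     (\<forall>x\<in>A. \<phi> (adj x ** x) = 0 \<longrightarrow> x = 0) \<and> \<phi> u = 1"

text \<open>Jones index of an inclusion B \<subseteq> A of factors with unit u, defined via the
 (unique) trace: the index of the trace-preserving conditional expectation.\<close>
definition jones_index :: "('n::finite) cmat set \<Rightarrow> 'n cmat set \<Rightarrow> 'n cmat \<Rightarrow> real" where
  "jones_index A B u =
     (let tr = (THE \<phi>. tracial_state A u \<phi>);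
          Etr = (THE E. cond_exp A B E \<and> (\<forall>x\<in>A. tr (E x) = tr x))
      in mnorm (Ind A Etr))"

definition Dmat :: "('n::finite) cmat set \<Rightarrow> 'n cmat set \<Rightarrow> 'n cmat \<Rightarrow> 'n cmat \<Rightarrow> real" where
  "Dmat N M p q = (if p ** q \<noteq> 0
     then sqrt (min_index (corner (p ** q) M) (cut N (p ** q))) else 0)"

definition JonesMat :: "('n::finite) cmat set \<Rightarrow> 'n cmat set \<Rightarrow> 'n cmat \<Rightarrow> 'n cmat \<Rightarrow> real" where
  "JonesMat N M p q = (if p ** q \<noteq> 0
     then sqrt (jones_index (corner (p ** q) M) (cut N (p ** q)) (p ** q)) else 0)"

definition dnorm :: "('n::finite) cmat set \<Rightarrow> 'n cmat set \<Rightarrow> real" where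
  "dnorm N M = rnorm (mcp M) (mcp N) (Lam N M)"

definition markov_trace :: "('n::finite) cmat set \<Rightarrow> 'n cmat set \<Rightarrow> ('n cmat \<Rightarrow> complex)" where
  "markov_trace N M = (THE \<tau>. tracial_state M (mat 1) \<tau> \<and>
     (\<forall>p\<in>mcp M. (\<Sum>p'\<in>mcp M. (\<Sum>q\<in>mcp N. Lam N M p q * Lam N M p' q) *
          Re (\<tau> (minproj_under M p'))) = (dnorm N M)^2 * Re (\<tau> (minproj_under M p))))"

definition Etau :: "('n::finite) cmat set \<Rightarrow> 'n cmat set \<Rightarrow> ('n cmat \<Rightarrow> 'n cmat)" where
  "Etau N M = (THE E. cond_exp M N E \<and> (\<forall>x\<in>M. markov_trace N M (E x) = markov_trace N M x))"

definition extremal :: "('n::finite) cmat set \<Rightarrow> 'n cmat set \<Rightarrow> bool" where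
  "extremal N M \<longleftrightarrow> E0 M N = Etau N M"

definition nu :: "('n::finite) cmat set \<Rightarrow> 'n cmat set \<Rightarrow> ('n cmat \<Rightarrow> real)" where
  "nu N M = (THE \<nu>. \<exists>v. (\<forall>q\<in>mcp N. v q > 0) \<and> (\<forall>q. q \<notin> mcp N \<longrightarrow> v q = 0) \<and>
     (\<Sum>q\<in>mcp N. (v q)^2) = 1 \<and>
     (\<exists>r. \<forall>q\<in>mcp N. (\<Sum>q'\<in>mcp N. (\<Sum>p\<in>mcp M. Dmat N M p q * Dmat N M p q') * v q') = r * v q) \<and>
     \<nu> = (\<lambda>q. (v q)^2))"

definition super_extremal :: "('n::finite) cmat set \<Rightarrow> 'n cmat set \<Rightarrow> bool" where
  "super_extremal N M \<longleftrightarrow> extremal N M \<and>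
     (\<forall>q\<in>mcp N. complex_of_real (nu N M q) = markov_trace N M q)"

end

theory Submission
  imports Defs
begin

text \<open>
  Let \<open>\<tau>\<close> be the Markov trace, with trace vector \<open>s\<close> on \<open>M\<close> and \<open>t = \<Lambda>\<^sup>t s\<close> on \<open>N\<close>, and let
  \<open>E\<close> be any expectation. For a minimal projection \<open>f\<close> of \<open>N\<close> under \<open>q\<close>, the block \<open>p M f\<close> carries
  two inner products, \<open>x, y \<mapsto> E(x\<^sup>* y) \<in> \<complex> f\<close> and its analogue for \<open>\<tau>\<close>. Orthonormal frames of
  the spaces \<open>M f\<close> for the first one form a quasi-basis of \<open>E\<close>, so \<open>Ind E\<close> is a sum over frames.
  Comparing an \<open>E\<close>-frame with a \<open>\<tau>\<close>-frame costs only a Hilbert--Schmidt inequality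
  \<open>\<parallel>A\<parallel>\<^sup>2 + \<parallel>A\<^sup>-\<^sup>1\<parallel>\<^sup>2 \<ge> 2 Re tr (A A\<^sup>-\<^sup>1)\<close>, strict unless both inner products agree. Summed with weights
  \<open>s\<close> and \<open>t\<close>, it gives \<open>\<Sum>\<^sub>p s\<^sub>p\<^sup>2 (Ind E)\<^sub>p \<ge> d\<^sup>2 \<Sum>\<^sub>p s\<^sub>p\<^sup>2\<close>, with equality only for \<open>E = E\<^sup>\<tau>\<close>, whose
  index is \<open>d\<^sup>2\<close>: this is extremality. Part (i) is the same statement for the
  inclusion of factors \<open>N p q \<subseteq> p q M p q\<close>. Part (iii) compares \<open>\<tau>(q) = k\<^sub>q t\<^sub>q\<close> with \<open>t\<^sub>q\<^sup>2 / \<parallel>t\<parallel>\<^sup>2\<close>,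
  so it says that \<open>k\<close> is the Perron--Frobenius vector \<open>t\<close> up to a factor.
\<close>

section \<open>Matrices, adjoints and traces\<close>

text \<open>Most objects of the theorem are fixed by \<open>THE\<close>, \<open>SOME\<close> or
  \<open>Inf\<close>, so formulas are not enough: existence and uniqueness are needed as well. The
  strict case of the frame inequality is what makes the minimal expectation unique and lets it be
  compared with \<open>Etau\<close> as a function.

  The two frames play different roles. The \<open>E\<close>-frame enters through \<open>Ind\<close>
  and has to be cut by the central projections \<open>p\<close>, after which it need not be
  orthonormal; frames are therefore handled through their expansion property. The
  \<open>\<tau>\<close>-frame is an explicit, overcomplete one built from matrix units, because its
  sum of \<open>adj y ** y\<close> is a multiple of \<open>f q ** p\<close>. On that element every
  expectation is under control: \<open>E (f q ** p)\<close> is \<open>eps p q\<close> times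
  \<open>f q\<close>, and the \<open>eps p q\<close> add up to \<open>1\<close> over
  \<open>p\<close>. With the right weights this contribution becomes
  \<open>(t q)\<^sup>2 * eps p q\<close>, and the dependence on \<open>E\<close> outside
  \<open>Ind E\<close> disappears.

  Connectedness enters as irreducibility of the Bratteli matrix, hence as Perron--Frobenius
  uniqueness. The unit is an arbitrary projection \<open>u\<close>, so that corners are instances of
  the same results.\<close>

lemma matrix_add_rdistrib: "(A + B) ** (C::('n::finite) cmat) = A ** C + B ** C"
  by (vector matrix_matrix_mult_def sum.distrib[symmetric] field_simps)

lemma matrix_diff_ldistrib: "(A::('n::finite) cmat) ** (B - C) = A ** B - A ** C"
  using matrix_add_ldistrib[of A "B - C" C] by (simp add: algebra_simps)

lemma matrix_diff_rdistrib: "(A - B) ** (C::('n::finite) cmat) = A ** C - B ** C"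
  using matrix_add_rdistrib[of "A - B" B C] by (simp add: algebra_simps)

lemma matrix_mult_zero [simp]: "(0::('n::finite) cmat) ** A = 0" "A ** (0::('n::finite) cmat) = 0"
  by (vector matrix_matrix_mult_def)+

lemma matrix_mult_sum_left: "(\<Sum>i\<in>I. f i) ** (C::('n::finite) cmat) = (\<Sum>i\<in>I. f i ** C)"
  by (induction I rule: infinite_finite_induct) (auto simp: matrix_add_rdistrib)

lemma matrix_mult_sum_right: "(C::('n::finite) cmat) ** (\<Sum>i\<in>I. f i) = (\<Sum>i\<in>I. C ** f i)"
  by (induction I rule: infinite_finite_induct) (auto simp: matrix_add_ldistrib)

lemma adj_add: "adj (A + B) = adj A + adj B"
  and adj_diff: "adj (A - B) = adj A - adj B"
  and adj_smult: "adj (smult c A) = smult (cnj c) (adj A)"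
  and adj_adj [simp]: "adj (adj A) = A"
  and adj_zero [simp]: "adj 0 = 0"
  by (simp_all add: adj_def smult_def vec_eq_iff)

lemma adj_mult: "adj (A ** B) = adj B ** adj A"
  by (simp add: adj_def matrix_matrix_mult_def vec_eq_iff mult.commute)

lemma adj_sum: "adj (\<Sum>i\<in>I. f i) = (\<Sum>i\<in>I. adj (f i))"
  by (induction I rule: infinite_finite_induct) (auto simp: adj_add)

lemma adj_eq_zero_iff [simp]: "adj A = 0 \<longleftrightarrow> A = 0"
  by (metis adj_adj adj_zero)

lemma smult_mult_left [simp]: "smult c A ** B = smult c (A ** B)"
  and smult_mult_right [simp]: "A ** smult c B = smult c (A ** B)"
  by (simp_all add: smult_def matrix_matrix_mult_def vec_eq_iff sum_distrib_left mult_ac)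

lemma smult_smult [simp]: "smult c (smult d A) = smult (c * d) A"
  and smult_one [simp]: "smult 1 A = A"
  and smult_zero_left [simp]: "smult 0 A = 0"
  and smult_zero_right [simp]: "smult c 0 = 0"
  and smult_add_right: "smult c (A + B) = smult c A + smult c B"
  and smult_add_left: "smult (c + d) A = smult c A + smult d A"
  and smult_diff_left: "smult (c - d) A = smult c A - smult d A"
  and uminus_smult: "- A = smult (- 1) A"
  by (simp_all add: smult_def vec_eq_iff algebra_simps)

lemma scaleR_smult: "r *\<^sub>R A = smult (of_real r) A"
  by (simp add: smult_def vec_eq_iff scaleR_conv_of_real[where 'a=complex])

lemma smult_sum: "smult c (\<Sum>i\<in>I. f i) = (\<Sum>i\<in>I. smult c (f i))"
  by (induction I rule: infinite_finite_induct) (auto simp: smult_add_right)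

lemma smult_eq_zero_iff [simp]: "smult c A = 0 \<longleftrightarrow> c = 0 \<or> A = 0"
  by (auto simp: smult_def vec_eq_iff)

lemma smult_cancel: "smult c A = smult d A \<Longrightarrow> A \<noteq> 0 \<Longrightarrow> c = d"
  by (metis eq_iff_diff_eq_0 smult_diff_left smult_eq_zero_iff)

lemma mtrace_add: "mtrace (A + B) = mtrace A + mtrace B"
  and mtrace_smult [simp]: "mtrace (smult c A) = c * mtrace A"
  and mtrace_zero [simp]: "mtrace 0 = 0"
  by (simp_all add: mtrace_def smult_def sum.distrib sum_distrib_left)

lemma mtrace_sum: "mtrace (\<Sum>i\<in>I. f i) = (\<Sum>i\<in>I. mtrace (f i))"
  by (induction I rule: infinite_finite_induct) (auto simp: mtrace_add)

lemma mtrace_commute: "mtrace (A ** B) = mtrace (B ** A)"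
  unfolding mtrace_def matrix_matrix_mult_def
  by simp (subst sum.swap, simp add: mult.commute)

lemma mtrace_adj: "mtrace (adj A) = cnj (mtrace A)"
  by (simp add: mtrace_def adj_def)

lemma mtrace_adj_mult_self: "mtrace (adj A ** A) = of_real ((norm A)\<^sup>2)"
proof -
  have "mtrace (adj A ** A) = (\<Sum>i\<in>UNIV. \<Sum>j\<in>UNIV. of_real ((cmod (A $ j $ i))\<^sup>2))"
    unfolding mtrace_def matrix_matrix_mult_def adj_def
    by (simp add: mult.commute[of "cnj _"] complex_norm_square del: of_real_power)
  also have "\<dots> = of_real (\<Sum>j\<in>UNIV. \<Sum>i\<in>UNIV. (cmod (A $ j $ i))\<^sup>2)"
    by (subst sum.swap) simp
  also have "(\<Sum>j\<in>UNIV. \<Sum>i\<in>UNIV. (cmod (A $ j $ i))\<^sup>2) = (norm A)\<^sup>2"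
    by (simp add: norm_vec_def L2_set_def sum_nonneg)
  finally show ?thesis .
qed

text \<open>Polarisation of \<open>mtrace_adj_mult_self\<close>. It ties the real inner product of
  the vector type to the Hilbert--Schmidt product, so that general facts on orthogonality, dimension
  and compact spheres apply to matrices.\<close>

lemma inner_eq_mtrace: "inner A B = Re (mtrace (adj A ** B))"
proof -
  have "(norm (A + B))\<^sup>2 = (norm A)\<^sup>2 + (norm B)\<^sup>2 + 2 * inner A B"
    by (simp add: power2_norm_eq_inner inner_add inner_commute)
  moreover have "of_real ((norm (A + B))\<^sup>2) = of_real ((norm A)\<^sup>2) + of_real ((norm B)\<^sup>2)
      + (mtrace (adj A ** B) + cnj (mtrace (adj A ** B)))"
    by (simp only: mtrace_adj_mult_self[symmetric] mtrace_adj[symmetric] adj_mult adj_adj adj_add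
        matrix_add_ldistrib matrix_add_rdistrib mtrace_add)
       (simp add: algebra_simps)
  then have "Re (of_real ((norm (A + B))\<^sup>2)) = Re (of_real ((norm A)\<^sup>2) + of_real ((norm B)\<^sup>2)
      + (mtrace (adj A ** B) + cnj (mtrace (adj A ** B))))" by (rule arg_cong)
  then have "(norm (A + B))\<^sup>2 = (norm A)\<^sup>2 + (norm B)\<^sup>2 + 2 * Re (mtrace (adj A ** B))"
    by simp
  ultimately show ?thesis by simp
qed

lemma adj_mult_self_eq_zero [simp]: "adj A ** A = 0 \<longleftrightarrow> A = 0"
  using mtrace_adj_mult_self[of A] by auto

lemma is_projD: "is_proj p \<Longrightarrow> p ** p = p" "is_proj p \<Longrightarrow> adj p = p"
  by (simp_all add: is_proj_def)

lemma is_proj_absorb: "is_proj p \<Longrightarrow> is_proj q \<Longrightarrow> p ** q = p \<longleftrightarrow> q ** p = p"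
  by (metis adj_mult is_projD(2))

lemma is_proj_diff:
  assumes "is_proj p" "is_proj q" "q ** p = q"
  shows "is_proj (p - q)"
  using assms is_proj_absorb[OF assms(2,1)]
  by (simp add: is_proj_def matrix_diff_ldistrib matrix_diff_rdistrib adj_diff)

lemma is_proj_mult:
  assumes "is_proj p" "is_proj q" "q ** p = p ** q"
  shows "is_proj (p ** q)"
  using assms by (simp add: is_proj_def adj_mult) (metis matrix_mul_assoc)

lemma is_proj_norm: "is_proj p \<Longrightarrow> mtrace p = of_real ((norm p)\<^sup>2)"
  by (metis is_projD mtrace_adj_mult_self)

lemma is_proj_mtrace_pos: "is_proj p \<Longrightarrow> p \<noteq> 0 \<Longrightarrow> 0 < Re (mtrace p)"
  by (simp add: is_proj_norm)

lemma is_proj_mtrace_real: "is_proj p \<Longrightarrow> mtrace p = of_real (Re (mtrace p))"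
  by (simp add: is_proj_norm)

text \<open>The \<open>c\<close> in \<open>x = smult c e\<close>, when \<open>x\<close> has this
  form. As a normalised trace it is linear in \<open>x\<close> on all matrices.\<close>

definition rscalar :: "('n::finite) cmat \<Rightarrow> 'n cmat \<Rightarrow> complex" where
  "rscalar e x = mtrace x / mtrace e"

section \<open>Orthonormal frames for sesquilinear forms\<close>

text \<open>A complex inner product, linear in the second argument, on a subspace kept as a set: the
  same \<open>W\<close> has to carry the competing forms of \<open>E\<close> and of
  \<open>\<tau>\<close>.\<close>

locale cform =
  fixes W :: "('n::finite) cmat set" and a :: "'n cmat \<Rightarrow> 'n cmat \<Rightarrow> complex"
  assumes W_zero: "0 \<in> W"
    and W_add: "x \<in> W \<Longrightarrow> y \<in> W \<Longrightarrow> x + y \<in> W"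
    and W_smult: "x \<in> W \<Longrightarrow> smult c x \<in> W"
    and a_add: "x \<in> W \<Longrightarrow> y \<in> W \<Longrightarrow> z \<in> W \<Longrightarrow> a x (y + z) = a x y + a x z"
    and a_smult: "x \<in> W \<Longrightarrow> y \<in> W \<Longrightarrow> a x (smult c y) = c * a x y"
    and a_cnj: "x \<in> W \<Longrightarrow> y \<in> W \<Longrightarrow> a y x = cnj (a x y)"
    and a_pos: "x \<in> W \<Longrightarrow> x \<noteq> 0 \<Longrightarrow> 0 < Re (a x x)"
begin

lemma W_sum: "(\<And>i. i \<in> I \<Longrightarrow> f i \<in> W) \<Longrightarrow> (\<Sum>i\<in>I. f i) \<in> W"
  by (induction I rule: infinite_finite_induct) (auto intro: W_zero W_add)

lemma W_diff: "x \<in> W \<Longrightarrow> y \<in> W \<Longrightarrow> x - y \<in> W"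
  using W_add[of x "smult (-1) y"] W_smult[of y "-1"] by (simp add: uminus_smult[symmetric])

lemma a_zero: "x \<in> W \<Longrightarrow> a x 0 = 0"
  using a_smult[of x 0 0] W_zero by simp

lemma a_sum: "x \<in> W \<Longrightarrow> (\<And>i. i \<in> I \<Longrightarrow> f i \<in> W) \<Longrightarrow> a x (\<Sum>i\<in>I. f i) = (\<Sum>i\<in>I. a x (f i))"
  by (induction I rule: infinite_finite_induct) (auto simp: a_zero a_add W_sum)

lemma a_self_real: "x \<in> W \<Longrightarrow> a x x = of_real (Re (a x x))"
  using a_cnj[of x x] by (simp add: complex_eq_iff)

lemma a_sum_smult:
  assumes "x \<in> W" "\<And>i. i \<in> I \<Longrightarrow> f i \<in> W"
  shows "a x (\<Sum>i\<in>I. smult (c i) (f i)) = (\<Sum>i\<in>I. c i * a x (f i))"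
  using assms by (simp add: a_sum a_smult W_smult)

text \<open>The frame is given by its expansion property alone, since frames cut down by a central
  projection keep this property while they may lose orthonormality.\<close>

lemma parseval:
  assumes x: "\<And>i. i \<in> I \<Longrightarrow> x i \<in> W"
    and fx: "\<And>w. w \<in> W \<Longrightarrow> w = (\<Sum>i\<in>I. smult (a (x i) w) (x i))" and w: "w \<in> W"
  shows "(\<Sum>i\<in>I. (cmod (a (x i) w))\<^sup>2) = Re (a w w)"
proof -
  have "a w w = a w (\<Sum>i\<in>I. smult (a (x i) w) (x i))" by (rule arg_cong[OF fx[OF w]])
  also have "\<dots> = (\<Sum>i\<in>I. a (x i) w * a w (x i))"
    by (rule a_sum_smult[OF w x])
  also have "\<dots> = (\<Sum>i\<in>I. of_real ((cmod (a (x i) w))\<^sup>2))"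
    by (intro sum.cong refl) (simp add: a_cnj[OF x w] complex_norm_square del: of_real_power)
  finally show ?thesis by simp
qed

definition orthonormal :: "'n cmat set \<Rightarrow> bool" where
  "orthonormal U \<longleftrightarrow> finite U \<and> U \<subseteq> W \<and> (\<forall>u\<in>U. \<forall>v\<in>U. a u v = (if u = v then 1 else 0))"

lemma orthonormal_card: "orthonormal U \<Longrightarrow> card U \<le> DIM('n cmat)"
proof -
  assume U: "orthonormal U"
  have "independent U"
  proof (rule independent_if_scalars_zero)
    show "finite U" using U by (simp add: orthonormal_def)
    fix f x assume 0: "(\<Sum>x\<in>U. f x *\<^sub>R x) = 0" and x: "x \<in> U"
    have "0 = a x (\<Sum>y\<in>U. smult (of_real (f y)) y)"
      using 0 x U a_zero by (auto simp: scaleR_smult orthonormal_def)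
    also have "\<dots> = (\<Sum>y\<in>U. of_real (f y) * a x y)"
      using x U by (subst a_sum_smult) (auto simp: orthonormal_def)
    also have "\<dots> = (\<Sum>y\<in>U. if y = x then of_real (f y) else 0)"
      using x U by (intro sum.cong) (auto simp: orthonormal_def)
    also have "\<dots> = of_real (f x)" using U x by (simp add: orthonormal_def)
    finally show "f x = 0" by simp
  qed
  then show ?thesis using independent_bound by blast
qed

text \<open>An orthonormal set of greatest cardinality works: a vector that it does not expand
  leaves a residual \<open>r\<close> orthogonal to the set, and \<open>r\<close> normalised would
  enlarge it.\<close>

lemma frame_exists:
  obtains U where "orthonormal U" "\<And>x. x \<in> W \<Longrightarrow> x = (\<Sum>u\<in>U. smult (a u x) u)"
proof -
  have "orthonormal {}" by (simp add: orthonormal_def)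
  then have "\<exists>U. orthonormal U \<and> (\<forall>V. orthonormal V \<longrightarrow> card V \<le> card U)"
    by (rule ex_has_greatest_nat[where b = "Suc DIM('n cmat)"])
       (metis orthonormal_card le_imp_less_Suc less_imp_le)
  then obtain U where U: "orthonormal U" and max: "\<And>V. orthonormal V \<Longrightarrow> card V \<le> card U"
    by metis
  have fin: "finite U" and UW: "U \<subseteq> W" using U by (auto simp: orthonormal_def)
  have "x = (\<Sum>u\<in>U. smult (a u x) u)" if x: "x \<in> W" for x
  proof (rule ccontr)
    assume ne: "x \<noteq> (\<Sum>u\<in>U. smult (a u x) u)"
    define r where "r = x - (\<Sum>u\<in>U. smult (a u x) u)"
    have S: "(\<Sum>u\<in>U. smult (a u x) u) \<in> W"
      using UW by (intro W_sum W_smult) auto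
    have rW: "r \<in> W" unfolding r_def using x S by (rule W_diff)
    have r0: "r \<noteq> 0" using ne by (simp add: r_def)
    have orth: "a u r = 0" if u: "u \<in> U" for u
    proof -
      have uW: "u \<in> W" using u UW by auto
      have "a u x = a u (r + (\<Sum>v\<in>U. smult (a v x) v))" by (simp add: r_def)
      also have "\<dots> = a u r + a u (\<Sum>v\<in>U. smult (a v x) v)" by (rule a_add[OF uW rW S])
      also have "a u (\<Sum>v\<in>U. smult (a v x) v) = (\<Sum>v\<in>U. a v x * a u v)"
        using uW UW by (intro a_sum_smult) auto
      also have "\<dots> = (\<Sum>v\<in>U. if v = u then a v x else 0)"
        using U u by (intro sum.cong) (auto simp: orthonormal_def)
      also have "\<dots> = a u x" using u fin by simp
      finally show ?thesis by simp
    qed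
    define c where "c = 1 / sqrt (Re (a r r))"
    have pos: "0 < Re (a r r)" using a_pos[OF rW r0] .
    define v where "v = smult (of_real c) r"
    have vW: "v \<in> W" unfolding v_def by (rule W_smult[OF rW])
    have av: "a w v = of_real c * a w r" if "w \<in> W" for w
      unfolding v_def by (rule a_smult[OF that rW])
    have "a r v = of_real c * a r r" by (rule av[OF rW])
    then have "a v r = of_real c * of_real (Re (a r r))"
      using a_cnj[OF rW vW] a_self_real[OF rW] by (metis complex_cnj_complex_of_real of_real_mult)
    then have "a v v = of_real (c * (c * Re (a r r)))"
      using av[OF vW] by simp
    moreover have "c * (c * Re (a r r)) = 1"
      using pos by (simp add: c_def field_simps)
    ultimately have vv: "a v v = 1" by simp
    have uv: "a u v = 0" "a v u = 0" if "u \<in> U" for u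
    proof -
      show "a u v = 0" using av[of u] orth[OF that] that UW by auto
      then show "a v u = 0" using a_cnj[of u v] that UW vW by auto
    qed
    have vU: "v \<notin> U" using uv vv by force
    have "orthonormal (insert v U)"
      using U vW vv uv vU by (auto simp: orthonormal_def)
    from max[OF this] show False using vU fin by simp
  qed
  with U show thesis using that by blast
qed

end

lemma cform_mtrace:
  assumes "0 \<in> W" "\<And>x y. x \<in> W \<Longrightarrow> y \<in> W \<Longrightarrow> x + y \<in> W" "\<And>x c. x \<in> W \<Longrightarrow> smult c x \<in> W"
    and "0 < r"
  shows "cform W (\<lambda>x y. mtrace (adj x ** y) / of_real r)"
proof
  fix x y assume "x \<in> W" "y \<in> W"
  have "mtrace (adj y ** x) = cnj (mtrace (adj x ** y))"
    by (simp add: mtrace_adj[symmetric] adj_mult)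
  then show "mtrace (adj y ** x) / of_real r = cnj (mtrace (adj x ** y) / of_real r)" by simp
next
  fix x :: "'a cmat" assume "x \<noteq> 0"
  then show "0 < Re (mtrace (adj x ** x) / of_real r)"
    using assms(4) by (simp add: mtrace_adj_mult_self flip: of_real_power)
qed (use assms in \<open>auto simp: matrix_add_ldistrib mtrace_add add_divide_distrib\<close>)

text \<open>Coefficients of two frames against each other form mutually inverse matrices \<open>A\<close> and \<open>B\<close>;
  the inequality is \<open>0 \<le> \<parallel>A - B\<^sup>*\<parallel>\<^sup>2\<close> in the Hilbert--Schmidt norm.\<close>
lemma two_frames:
  fixes x :: "'i \<Rightarrow> ('n::finite) cmat" and y :: "'j \<Rightarrow> 'n cmat"
  assumes "cform W a" "cform W b" "finite I" "finite J"
    and xW: "\<And>i. i \<in> I \<Longrightarrow> x i \<in> W" and yW: "\<And>j. j \<in> J \<Longrightarrow> y j \<in> W"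
    and fx: "\<And>w. w \<in> W \<Longrightarrow> w = (\<Sum>i\<in>I. smult (a (x i) w) (x i))"
    and fy: "\<And>w. w \<in> W \<Longrightarrow> w = (\<Sum>j\<in>J. smult (b (y j) w) (y j))"
  shows two_frames_le: "2 * (\<Sum>j\<in>J. Re (b (y j) (y j)))
           \<le> (\<Sum>i\<in>I. Re (b (x i) (x i))) + (\<Sum>j\<in>J. Re (a (y j) (y j)))"
    and two_frames_eq: "2 * (\<Sum>j\<in>J. Re (b (y j) (y j)))
           = (\<Sum>i\<in>I. Re (b (x i) (x i))) + (\<Sum>j\<in>J. Re (a (y j) (y j)))
        \<Longrightarrow> v \<in> W \<Longrightarrow> w \<in> W \<Longrightarrow> a v w = b v w"
proof -
  interpret a: cform W a by fact
  interpret b: cform W b by fact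
  define D where "D = (\<Sum>j\<in>J. \<Sum>i\<in>I. (cmod (a (x i) (y j) - cnj (b (y j) (x i))))\<^sup>2)"
  have sq: "(cmod (z - cnj w))\<^sup>2 = (cmod z)\<^sup>2 + (cmod w)\<^sup>2 - 2 * Re (z * w)" for z w
    by (simp only: cmod_power2) (simp add: power2_eq_square algebra_simps)
  note e1 = a.parseval[OF xW fx] and e2 = b.parseval[OF yW fy]
  have e3: "(\<Sum>i\<in>I. a (x i) (y j) * b (y j) (x i)) = b (y j) (y j)" if j: "j \<in> J" for j
  proof -
    have "b (y j) (y j) = b (y j) (\<Sum>i\<in>I. smult (a (x i) (y j)) (x i))"
      by (rule arg_cong[OF fx[OF yW[OF j]]])
    also have "\<dots> = (\<Sum>i\<in>I. a (x i) (y j) * b (y j) (x i))"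
      by (rule b.a_sum_smult[OF yW[OF j] xW])
    finally show ?thesis by simp
  qed
  have "D = (\<Sum>j\<in>J. \<Sum>i\<in>I. (cmod (a (x i) (y j)))\<^sup>2) + (\<Sum>j\<in>J. \<Sum>i\<in>I. (cmod (b (y j) (x i)))\<^sup>2)
      - 2 * (\<Sum>j\<in>J. Re (\<Sum>i\<in>I. a (x i) (y j) * b (y j) (x i)))"
    by (simp add: D_def sq sum.distrib sum_subtractf sum_distrib_left del: times_complex.simps)
  also have "(\<Sum>j\<in>J. \<Sum>i\<in>I. (cmod (a (x i) (y j)))\<^sup>2) = (\<Sum>j\<in>J. Re (a (y j) (y j)))"
    using yW by (intro sum.cong refl e1) auto
  also have "(\<Sum>j\<in>J. \<Sum>i\<in>I. (cmod (b (y j) (x i)))\<^sup>2) = (\<Sum>i\<in>I. Re (b (x i) (x i)))"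
    using xW by (subst sum.swap) (intro sum.cong refl e2; auto)
  also have "(\<Sum>j\<in>J. Re (\<Sum>i\<in>I. a (x i) (y j) * b (y j) (x i))) = (\<Sum>j\<in>J. Re (b (y j) (y j)))"
    by (intro sum.cong refl arg_cong[of _ _ Re] e3)
  finally have D: "D = (\<Sum>j\<in>J. Re (a (y j) (y j))) + (\<Sum>i\<in>I. Re (b (x i) (x i)))
      - 2 * (\<Sum>j\<in>J. Re (b (y j) (y j)))" .
  have "0 \<le> D" unfolding D_def by (intro sum_nonneg) auto
  with D show "2 * (\<Sum>j\<in>J. Re (b (y j) (y j)))
           \<le> (\<Sum>i\<in>I. Re (b (x i) (x i))) + (\<Sum>j\<in>J. Re (a (y j) (y j)))" by simp
  assume "2 * (\<Sum>j\<in>J. Re (b (y j) (y j)))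
           = (\<Sum>i\<in>I. Re (b (x i) (x i))) + (\<Sum>j\<in>J. Re (a (y j) (y j)))"
    and v: "v \<in> W" and w: "w \<in> W"
  then have "D = 0" using D by simp
  then have "\<forall>j\<in>J. \<forall>i\<in>I. (cmod (a (x i) (y j) - cnj (b (y j) (x i))))\<^sup>2 = 0"
    unfolding D_def using \<open>finite I\<close> \<open>finite J\<close>
    by (simp add: sum_nonneg_eq_0_iff sum_nonneg)
  then have eq: "a (x i) (y j) = b (x i) (y j)" if "i \<in> I" "j \<in> J" for i j
    using that b.a_cnj[OF yW xW] by auto
  \<comment> \<open>Expanding the left argument in the \<open>x i\<close> and the right one in the
    \<open>y j\<close> shows that a form is determined by its values on these mixed pairs, where
    \<open>a\<close> and \<open>b\<close> agree.\<close>
  have *: "c v w = cnj (\<Sum>i\<in>I. a (x i) v * cnj (\<Sum>j\<in>J. b (y j) w * c (x i) (y j)))"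
    if "cform W c" for c
  proof -
    interpret c: cform W c by fact
    have "c v w = cnj (c w v)" by (rule c.a_cnj[OF w v])
    also have "c w v = c w (\<Sum>i\<in>I. smult (a (x i) v) (x i))" by (rule arg_cong[OF fx[OF v]])
    also have "\<dots> = (\<Sum>i\<in>I. a (x i) v * c w (x i))"
      by (rule c.a_sum_smult[OF w xW])
    also have "\<dots> = (\<Sum>i\<in>I. a (x i) v * cnj (c (x i) w))"
      by (intro sum.cong refl arg_cong2[of _ _ _ _ "(*)"] c.a_cnj xW w)
    also have "\<dots> = (\<Sum>i\<in>I. a (x i) v * cnj (\<Sum>j\<in>J. b (y j) w * c (x i) (y j)))"
    proof (intro sum.cong refl arg_cong2[of _ _ _ _ "(*)"] arg_cong[of _ _ cnj])
      fix i assume i: "i \<in> I"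
      have "c (x i) w = c (x i) (\<Sum>j\<in>J. smult (b (y j) w) (y j))" by (rule arg_cong[OF fy[OF w]])
      also have "\<dots> = (\<Sum>j\<in>J. b (y j) w * c (x i) (y j))"
        by (rule c.a_sum_smult[OF xW[OF i] yW])
      finally show "c (x i) w = (\<Sum>j\<in>J. b (y j) w * c (x i) (y j))" .
    qed
    finally show ?thesis .
  qed
  have "(\<Sum>j\<in>J. b (y j) w * a (x i) (y j)) = (\<Sum>j\<in>J. b (y j) w * b (x i) (y j))" if "i \<in> I" for i
    by (rule sum.cong) (simp_all add: eq that)
  then have "(\<Sum>i\<in>I. a (x i) v * cnj (\<Sum>j\<in>J. b (y j) w * a (x i) (y j)))
    = (\<Sum>i\<in>I. a (x i) v * cnj (\<Sum>j\<in>J. b (y j) w * b (x i) (y j)))"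
    by (intro sum.cong refl) simp
  then show "a v w = b v w"
    using *[OF a.cform_axioms] *[OF b.cform_axioms] by metis
qed

text \<open>With both forms equal, \<open>two_frames_le\<close> compares one frame sum with the
  other, and the roles can be exchanged. The common value is the complex dimension of
  \<open>W\<close>.\<close>

lemma frame_sum_unique:
  fixes x :: "'i \<Rightarrow> ('n::finite) cmat" and y :: "'j \<Rightarrow> 'n cmat"
  assumes "cform W a" "finite I" "finite J"
    and "\<And>i. i \<in> I \<Longrightarrow> x i \<in> W" "\<And>j. j \<in> J \<Longrightarrow> y j \<in> W"
    and "\<And>w. w \<in> W \<Longrightarrow> w = (\<Sum>i\<in>I. smult (a (x i) w) (x i))"
    and "\<And>w. w \<in> W \<Longrightarrow> w = (\<Sum>j\<in>J. smult (a (y j) w) (y j))"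
  shows "(\<Sum>i\<in>I. Re (a (x i) (x i))) = (\<Sum>j\<in>J. Re (a (y j) (y j)))"
  using two_frames_le[where a=a and b=a and x=x and y=y, OF assms(1,1-7)]
    two_frames_le[where a=a and b=a and x=y and y=x, OF assms(1,1,3,2,5,4,7,6)] by simp

section \<open>Structure of star algebras of matrices\<close>

text \<open>The stationarity condition behind both Rayleigh quotient arguments, for self-adjoint
  elements and for nonnegative matrices: a maximum at \<open>t = 0\<close> kills the linear
  term.\<close>

lemma quadratic_nonpos_imp_zero:
  fixes a c :: real
  assumes "\<And>t. 2 * t * a + t\<^sup>2 * c \<le> 0"
  shows "a = 0"
proof (rule ccontr)
  assume "a \<noteq> 0"
  define K where "K = \<bar>c\<bar> + 1"
  have K: "0 < K" "- c \<le> K" by (simp_all add: K_def)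
  \<comment> \<open>With \<open>K\<close> above \<open>|c|\<close>, the test point
    \<open>a / K\<close> is small enough for the linear term to beat the quadratic one.\<close>
  have "2 * (a / K) * a \<le> (a / K)\<^sup>2 * (- c)"
    using assms[of "a / K"] by (simp add: algebra_simps)
  also have "\<dots> \<le> (a / K)\<^sup>2 * K" using K by (intro mult_left_mono) auto
  also have "\<dots> = a\<^sup>2 / K" using K by (simp add: power2_eq_square)
  finally have "2 * (a\<^sup>2 / K) \<le> a\<^sup>2 / K" by (simp add: power2_eq_square)
  moreover have "0 < a\<^sup>2 / K" using K \<open>a \<noteq> 0\<close> by simp
  ultimately show False by linarith
qed

lemma least_witness:
  fixes f :: "'a \<Rightarrow> nat"
  assumes "P k"
  obtains x where "P x" "\<forall>y. P y \<longrightarrow> f x \<le> f y"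
  using ex_has_least_nat[of P k f] assms by blast

section \<open>Spectral theory inside a star algebra\<close>

locale matalg =
  fixes A :: "('n::finite) cmat set" and u :: "'n cmat"
  assumes star: "star_alg A u"
begin

lemma zero_mem: "0 \<in> A" and unit_mem: "u \<in> A"
  and add_mem: "x \<in> A \<Longrightarrow> y \<in> A \<Longrightarrow> x + y \<in> A"
  and mult_mem: "x \<in> A \<Longrightarrow> y \<in> A \<Longrightarrow> x ** y \<in> A"
  and smult_mem: "x \<in> A \<Longrightarrow> smult c x \<in> A"
  and adj_mem: "x \<in> A \<Longrightarrow> adj x \<in> A"
  and unit_left: "x \<in> A \<Longrightarrow> u ** x = x"
  and unit_right: "x \<in> A \<Longrightarrow> x ** u = x"
  using star by (auto simp: star_alg_def)

lemma diff_mem: "x \<in> A \<Longrightarrow> y \<in> A \<Longrightarrow> x - y \<in> A"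
  using add_mem[of x "smult (-1) y"] smult_mem[of y "-1"] by (simp add: uminus_smult[symmetric])

lemma sum_mem: "(\<And>i. i \<in> I \<Longrightarrow> f i \<in> A) \<Longrightarrow> (\<Sum>i\<in>I. f i) \<in> A"
  by (induction I rule: infinite_finite_induct) (auto intro: zero_mem add_mem)

lemma unit_proj: "is_proj u"
proof -
  have "u ** adj u = adj u" by (intro unit_left adj_mem unit_mem)
  then have "u ** adj u = u" by (metis adj_adj adj_mult)
  with \<open>u ** adj u = adj u\<close> show ?thesis by (simp add: is_proj_def unit_left[OF unit_mem])
qed

text \<open>Real subspaces, so that the real \<open>dim\<close> can measure minimality; complex
  scalars come from right multiplication by \<open>smult c u\<close>.\<close>

definition right_ideal :: "'n cmat set \<Rightarrow> bool" where
  "right_ideal W \<longleftrightarrow> W \<subseteq> A \<and> subspace W \<and> (\<forall>w\<in>W. \<forall>x\<in>A. w ** x \<in> W)"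

lemma right_idealD:
  assumes "right_ideal W"
  shows "w \<in> W \<Longrightarrow> w \<in> A" "subspace W" "w \<in> W \<Longrightarrow> x \<in> A \<Longrightarrow> w ** x \<in> W"
    "w \<in> W \<Longrightarrow> smult c w \<in> W" "0 \<in> W"
    "w \<in> W \<Longrightarrow> v \<in> W \<Longrightarrow> v + w \<in> W" "w \<in> W \<Longrightarrow> v \<in> W \<Longrightarrow> v - w \<in> W"
proof -
  show "w \<in> W \<Longrightarrow> w \<in> A" "subspace W" "w \<in> W \<Longrightarrow> x \<in> A \<Longrightarrow> w ** x \<in> W"
    using assms by (auto simp: right_ideal_def)
  then show "0 \<in> W" "w \<in> W \<Longrightarrow> v \<in> W \<Longrightarrow> v + w \<in> W" "w \<in> W \<Longrightarrow> v \<in> W \<Longrightarrow> v - w \<in> W"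
    by (auto intro: subspace_0 subspace_add subspace_diff)
  assume w: "w \<in> W"
  then have "w ** smult c u \<in> W"
    using assms smult_mem[OF unit_mem, of c] by (simp only: right_ideal_def)
  then show "smult c w \<in> W" using w assms by (auto simp: right_ideal_def unit_right)
qed

lemma right_ideal_principal: "x \<in> A \<Longrightarrow> right_ideal {x ** y |y. y \<in> A}"
  unfolding right_ideal_def subspace_def scaleR_smult
  by (auto simp: mult_mem matrix_mul_assoc[symmetric] intro: zero_mem exI[of _ 0])
     (metis add_mem matrix_add_ldistrib, metis smult_mem smult_mult_right)

lemma right_ideal_eigenspace:
  assumes W: "right_ideal W"
  shows "right_ideal {v \<in> W. x ** v = smult c v}"
  unfolding right_ideal_def subspace_def scaleR_smult
proof (intro conjI ballI allI subsetI)
  note WD = right_idealD[OF W]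
  show "0 \<in> {v \<in> W. x ** v = smult c v}" using WD by simp
  fix v w assume "v \<in> {v \<in> W. x ** v = smult c v}" "w \<in> {v \<in> W. x ** v = smult c v}"
  then show "v + w \<in> {v \<in> W. x ** v = smult c v}"
    using WD by (simp add: matrix_add_ldistrib smult_add_right)
next
  fix v and k :: real assume "v \<in> {v \<in> W. x ** v = smult c v}"
  then show "smult (of_real k) v \<in> {v \<in> W. x ** v = smult c v}"
    using right_idealD(4)[OF W] by (simp add: mult.commute)
next
  fix v w assume "v \<in> {v \<in> W. x ** v = smult c v}" "w \<in> A"
  then show "v ** w \<in> {v \<in> W. x ** v = smult c v}"
    using right_idealD(3)[OF W] by (simp add: matrix_mul_assoc)
qed (use right_idealD(1)[OF W] in auto)

text \<open>In a right ideal \<open>V\<close> of least dimension, \<open>z = y ** adj y\<close>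
  satisfies \<open>z V = V\<close>, because \<open>z ** z \<noteq> 0\<close>. Hence
  \<open>z = z ** e\<close> and \<open>e = z ** w\<close> with \<open>e\<close> and \<open>w\<close>
  in \<open>V\<close>. The first equation gives \<open>adj e ** z = z\<close>, the second then
  \<open>adj e ** e = e\<close>, and such an \<open>e\<close> is a projection.\<close>

lemma right_ideal_proj:
  assumes W: "right_ideal W" "W \<noteq> {0}"
  obtains e where "e \<in> W" "is_proj e" "e \<noteq> 0"
proof -
  let ?P = "\<lambda>V. right_ideal V \<and> V \<noteq> {0} \<and> V \<subseteq> W"
  have "?P W" using W by simp
  then obtain V where V: "?P V" and "\<forall>V'. ?P V' \<longrightarrow> dim V \<le> dim V'"
    by (rule least_witness[of ?P W dim]) (rule that)
  then have min: "\<And>V'. ?P V' \<Longrightarrow> dim V \<le> dim V'" by blast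
  have VI: "right_ideal V" using V by simp
  have min': "V' = V" if "right_ideal V'" "V' \<noteq> {0}" "V' \<subseteq> V" for V'
    using that V min[of V'] by (intro subspace_dim_equal) (auto dest: right_idealD)
  obtain y where y: "y \<in> V" "y \<noteq> 0" using V right_idealD(5)[OF VI] by auto
  have yA: "y \<in> A" using y VI by (auto dest: right_idealD)
  define z where "z = y ** adj y"
  have zV: "z \<in> V" unfolding z_def by (intro right_idealD(3)[OF VI] y adj_mem yA)
  have zA: "z \<in> A" by (rule right_idealD(1)[OF VI zV])
  have zs: "adj z = z" by (simp add: z_def adj_mult)
  have z0: "z \<noteq> 0" using y adj_mult_self_eq_zero[of "adj y"] by (simp add: z_def)
  have zz0: "z ** z \<noteq> 0" using z0 adj_mult_self_eq_zero[of z] zs by simp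
  let ?zV = "{z ** w |w. w \<in> V}"
  have "?zV = V"
  proof (rule min')
    show "right_ideal ?zV"
      unfolding right_ideal_def subspace_def scaleR_smult
    proof (intro conjI ballI allI subsetI)
      show "0 \<in> ?zV" using right_idealD(5)[OF VI] by force
      fix a b assume "a \<in> ?zV" "b \<in> ?zV"
      then show "a + b \<in> ?zV"
        using right_idealD(6)[OF VI] by (auto simp flip: matrix_add_ldistrib)
    next
      fix a and c :: real assume "a \<in> ?zV"
      then show "smult (of_real c) a \<in> ?zV"
        using right_idealD(4)[OF VI] by (auto simp flip: smult_mult_right)
    next
      fix a b assume "a \<in> ?zV" "b \<in> A"
      then show "a ** b \<in> ?zV"
        using right_idealD(3)[OF VI] by (auto simp flip: matrix_mul_assoc)
    qed (use zA right_idealD(1)[OF VI] in \<open>auto intro: mult_mem\<close>)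
    show "?zV \<noteq> {0}" using zz0 zV by auto
    show "?zV \<subseteq> V" using right_idealD(1)[OF VI] right_idealD(3)[OF VI zV] by auto
  qed
  then obtain e where e: "e \<in> V" "z = z ** e" using zV by blast
  then obtain w where w: "w \<in> V" "e = z ** w" using \<open>?zV = V\<close> by blast
  have "adj e ** z = z" using e zs by (metis adj_mult)
  then have ee: "adj e ** e = e" using w by (metis matrix_mul_assoc)
  then have es: "adj e = e" by (metis adj_adj adj_mult)
  have "e \<noteq> 0" using e z0 by auto
  then show ?thesis using that[of e] e V ee es by (auto simp: is_proj_def)
qed

text \<open>Maximise the Rayleigh quotient \<open>inner (x ** y) y\<close> over the unit sphere of
  \<open>W\<close>. Varying the maximiser in the direction of the defect \<open>w\<close> of the
  eigenvalue equation, which stays in \<open>W\<close>, shows that the defect is zero.\<close>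

lemma right_ideal_eigen:
  assumes W: "right_ideal W" "W \<noteq> {0}" and x: "adj x = x" "\<And>w. w \<in> W \<Longrightarrow> x ** w \<in> W"
  obtains l :: real and y where "y \<in> W" "y \<noteq> 0" "x ** y = smult (of_real l) y"
proof -
  note WD = right_idealD[OF W(1)]
  let ?f = "\<lambda>y::'n cmat. inner (x ** y) y"
  have lin: "linear (\<lambda>y::'n cmat. x ** y)"
    by (rule linearI) (simp_all add: matrix_add_ldistrib scaleR_smult)
  have symm: "inner (x ** v) w = inner v (x ** w)" for v w :: "'n cmat"
    by (simp add: inner_eq_mtrace adj_mult x(1) matrix_mul_assoc)
  obtain y0 where y0: "y0 \<in> W" "y0 \<noteq> 0" using W WD(5) by auto
  have "compact (W \<inter> sphere 0 1)"
    by (intro closed_Int_compact closed_subspace WD compact_sphere)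
  moreover have "y0 /\<^sub>R norm y0 \<in> W \<inter> sphere 0 1"
    using y0 subspace_scale[OF WD(2)] by simp
  then have "W \<inter> sphere 0 1 \<noteq> {}" by blast
  moreover have "continuous_on (W \<inter> sphere 0 1) ?f"
    by (intro continuous_intros linear_continuous_on_compose[OF _ lin])
  ultimately obtain y where ys: "y \<in> W \<inter> sphere 0 1" "\<forall>w\<in>W \<inter> sphere 0 1. ?f w \<le> ?f y"
    using continuous_attains_sup[of "W \<inter> sphere 0 1" ?f] by blast
  then have y: "y \<in> W" "norm y = 1" and max: "\<And>w. w \<in> W \<Longrightarrow> norm w = 1 \<Longrightarrow> ?f w \<le> ?f y"
    by auto
  define l where "l = ?f y"
  have le: "?f w \<le> l * inner w w" if w: "w \<in> W" for w
  proof (cases "w = 0")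
    case False
    have "?f (w /\<^sub>R norm w) \<le> l"
      unfolding l_def using w False subspace_scale[OF WD(2)] by (intro max) auto
    moreover have "x ** (w /\<^sub>R norm w) = (x ** w) /\<^sub>R norm w" by (rule linear_cmul[OF lin])
    ultimately have "?f w / (norm w)\<^sup>2 \<le> l"
      by (simp add: power2_eq_square divide_inverse mult_ac)
    then show ?thesis
      using False by (simp add: power2_norm_eq_inner divide_le_eq)
  qed (use l_def in simp)
  define w where "w = x ** y - smult (of_real l) y"
  have wW: "w \<in> W" unfolding w_def by (intro WD x y)
  have ineq: "2 * t * inner w w + t\<^sup>2 * (?f w - l * inner w w) \<le> 0" for t
  proof -
    have "y + t *\<^sub>R w \<in> W" using y wW WD(2) by (intro subspace_add subspace_scale)
    moreover have "inner y (x ** w) = inner w (x ** y)"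
      using symm[of y w] by (simp add: inner_commute)
    ultimately have "?f y + 2 * t * inner (x ** y) w + t\<^sup>2 * ?f w
        \<le> l * (inner y y + 2 * t * inner y w + t\<^sup>2 * inner w w)"
      using le[of "y + t *\<^sub>R w"]
      by (simp add: linear_add[OF lin] linear_cmul[OF lin] inner_add symm[of w y] inner_commute
          power2_eq_square algebra_simps)
    moreover have "inner y y = 1" "?f y = l" using y by (simp_all add: norm_eq_1 l_def)
    ultimately have "2 * t * (inner (x ** y) w - l * inner y w) + t\<^sup>2 * (?f w - l * inner w w) \<le> 0"
      by (simp add: algebra_simps)
    moreover have "inner w w = inner (x ** y) w - l * inner y w"
      by (subst (1) w_def) (simp add: scaleR_smult[symmetric] inner_diff_left)
    ultimately show ?thesis by simp
  qed
  have "inner w w = 0" by (rule quadratic_nonpos_imp_zero[OF ineq])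
  then have "x ** y = smult (of_real l) y" by (simp add: w_def)
  moreover have "y \<noteq> 0" using y by auto
  ultimately show ?thesis using y that by blast
qed

text \<open>The eigenvectors of \<open>x\<close> inside \<open>g A\<close> for one eigenvalue form a
  right ideal, and any projection in that ideal is an eigenprojection that belongs to the
  algebra.\<close>

lemma eigenprojection:
  assumes g: "g \<in> A" "is_proj g" "g \<noteq> 0" and x: "x \<in> A" "adj x = x" "g ** x = x"
  obtains l :: real and f where "f \<in> A" "is_proj f" "f \<noteq> 0" "g ** f = f" "x ** f = smult (of_real l) f"
proof -
  let ?W = "{g ** y |y. y \<in> A}"
  have W: "right_ideal ?W" by (rule right_ideal_principal[OF g(1)])
  have "g \<in> ?W" using g by (metis (mono_tags, lifting) CollectI is_projD(1))
  then have W0: "?W \<noteq> {0}" using g by auto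
  have xW: "x ** w \<in> ?W" if "w \<in> ?W" for w
  proof -
    have "x ** w \<in> A" using that g x by (auto intro: mult_mem)
    moreover have "x ** w = g ** (x ** w)" using x by (simp add: matrix_mul_assoc)
    ultimately show ?thesis by blast
  qed
  obtain l y where y: "y \<in> ?W" "y \<noteq> 0" "x ** y = smult (of_real l) y"
    by (rule right_ideal_eigen[OF W W0 x(2) xW])
  let ?V = "{v \<in> ?W. x ** v = smult (of_real l) v}"
  have V0: "?V \<noteq> {0}" using y by auto
  obtain f where f: "f \<in> ?V" "is_proj f" "f \<noteq> 0"
    by (rule right_ideal_proj[OF right_ideal_eigenspace[OF W] V0])
  have fW: "f \<in> ?W" and xf: "x ** f = smult (of_real l) f" using f(1) by blast+
  have "f \<in> A" by (rule right_idealD(1)[OF W fW])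
  moreover have "g ** f = f" using fW g by (auto simp: matrix_mul_assoc is_projD)
  ultimately show thesis using that f(2,3) xf by blast
qed

text \<open>Provides the measure that decreases along proper subprojections. If \<open>f A\<close>
  were as large as \<open>g A\<close>, then \<open>g = f ** y\<close> for some \<open>y\<close>, so
  \<open>f ** g = g\<close>.\<close>

lemma dim_principal_less:
  assumes f: "f \<in> A" "is_proj f" "f ** g = f" and g: "g \<in> A" "is_proj g" and ne: "f \<noteq> g"
  shows "dim {f ** y |y. y \<in> A} < dim {g ** y |y. y \<in> A}"
proof (rule ccontr)
  assume "\<not> ?thesis"
  then have le: "dim {g ** y |y. y \<in> A} \<le> dim {f ** y |y. y \<in> A}" by simp
  have gf: "g ** f = f" using is_proj_absorb[OF f(2) g(2)] f by simp
  have "{f ** y |y. y \<in> A} = {g ** y |y. y \<in> A}"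
  proof (rule subspace_dim_equal[OF _ _ _ le])
    show "{f ** y |y. y \<in> A} \<subseteq> {g ** y |y. y \<in> A}"
    proof
      fix v assume "v \<in> {f ** y |y. y \<in> A}"
      then obtain y where "v = f ** y" "y \<in> A" by auto
      then have "v = g ** (f ** y)" "f ** y \<in> A" using gf f by (simp_all add: matrix_mul_assoc mult_mem)
      then show "v \<in> {g ** y |y. y \<in> A}" by auto
    qed
  qed (use f g right_ideal_principal right_idealD in blast)+
  moreover have "g \<in> {g ** y |y. y \<in> A}" using g by (metis (mono_tags, lifting) CollectI is_projD(1))
  ultimately obtain y where "g = f ** y" by auto
  then have "f ** g = g" using f by (metis is_projD(1) matrix_mul_assoc)
  with f ne show False by simp
qed

lemma selfadj_decomp:
  assumes "x \<in> A"
  obtains h k where "h \<in> A" "adj h = h" "k \<in> A" "adj k = k" "x = smult (1/2) h - smult (\<i>/2) k"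
proof (rule that)
  show "x + adj x \<in> A" "smult \<i> (x - adj x) \<in> A"
    using assms by (auto intro!: add_mem adj_mem smult_mem diff_mem)
  show "adj (x + adj x) = x + adj x" by (simp add: adj_add)
  show "adj (smult \<i> (x - adj x)) = smult \<i> (x - adj x)"
    by (simp only: adj_diff adj_smult adj_adj) (simp add: smult_def vec_eq_iff algebra_simps)
  show "x = smult (1/2) (x + adj x) - smult (\<i>/2) (smult \<i> (x - adj x))"
    by (simp add: smult_def vec_eq_iff field_simps)
qed

text \<open>For self-adjoint \<open>h\<close>, an eigenprojection of \<open>e ** h ** e\<close>
  below \<open>e\<close> is \<open>e\<close> itself by minimality, and its eigenvalue equation is
  the claim. The general case follows by real and imaginary parts.\<close>

lemma minproj_scalar:
  assumes e: "minproj A e" and x: "x \<in> A"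
  shows "\<exists>c. e ** x ** e = smult c e"
proof -
  have eA: "e \<in> A" and ep: "is_proj e" "e \<noteq> 0" using e by (auto simp: minproj_def)
  have sa: "\<exists>l::real. e ** h ** e = smult (of_real l) e" if h: "h \<in> A" "adj h = h" for h
  proof -
    have "e ** h ** e \<in> A" "adj (e ** h ** e) = e ** h ** e" "e ** (e ** h ** e) = e ** h ** e"
      using h eA ep by (auto intro!: mult_mem simp: adj_mult is_projD matrix_mul_assoc)
    from eigenprojection[OF eA ep this]
    obtain l f where f: "f \<in> A" "is_proj f" "f \<noteq> 0" "e ** f = f"
      "e ** h ** e ** f = smult (of_real l) f" by blast
    have "f ** e = f" using is_proj_absorb[OF f(2) ep(1)] f by simp
    then have "f = e" using e f by (auto simp: minproj_def)
    then show ?thesis using f(5) ep by (auto simp: matrix_mul_assoc[symmetric] is_projD)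
  qed
  obtain h k where hk: "h \<in> A" "adj h = h" "k \<in> A" "adj k = k" "x = smult (1/2) h - smult (\<i>/2) k"
    by (rule selfadj_decomp[OF x])
  obtain l m where lm: "e ** h ** e = smult (of_real l) e" "e ** k ** e = smult (of_real m) e"
    using sa hk by metis
  have "e ** x ** e = smult (1/2) (e ** h ** e) - smult (\<i>/2) (e ** k ** e)"
    by (simp add: hk(5) matrix_diff_ldistrib matrix_diff_rdistrib)
  also have "\<dots> = smult (1/2 * of_real l - \<i>/2 * of_real m) e"
    by (simp add: lm smult_diff_left)
  finally show ?thesis by blast
qed

lemma minprojI:
  assumes "e \<in> A" "is_proj e" "e \<noteq> 0" "\<And>x. x \<in> A \<Longrightarrow> \<exists>c. e ** x ** e = smult c e"
  shows "minproj A e"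
  unfolding minproj_def
proof (intro conjI ballI impI assms)
  fix f assume f: "f \<in> A" "is_proj f \<and> f ** e = f"
  then have "e ** f = f" using is_proj_absorb[of f e] assms by simp
  moreover obtain c where "e ** f ** e = smult c e" using assms(4)[OF f(1)] by blast
  ultimately have c: "f = smult c e" using f by simp
  then have "f ** f = smult (c * c) e" using assms(2) by (simp add: is_projD)
  then have "smult (c * c) e = smult c e" using f c is_projD(1)[of f] by simp
  then have "c * c = c" using assms(3) smult_cancel by blast
  then show "f = 0 \<or> f = e" using c by auto
qed

lemma minproj_exists:
  assumes "g \<in> A" "is_proj g" "g \<noteq> 0"
  shows "\<exists>e. minproj A e \<and> e ** g = e"
proof -
  let ?P = "\<lambda>e. e \<in> A \<and> is_proj e \<and> e \<noteq> 0 \<and> e ** g = e"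
  let ?d = "\<lambda>e. dim {e ** y |y. y \<in> A}"
  have "?P g" using assms by (simp add: is_projD)
  then obtain e where e: "?P e" and "\<forall>f. ?P f \<longrightarrow> ?d e \<le> ?d f"
    by (rule least_witness[of ?P g ?d]) (rule that)
  then have min: "\<And>f. ?P f \<Longrightarrow> ?d e \<le> ?d f" by blast
  have "f = e" if f: "f \<in> A" "is_proj f" "f ** e = f" "f \<noteq> 0" for f
  proof (rule ccontr)
    assume "f \<noteq> e"
    then have "?d f < ?d e" using f e by (intro dim_principal_less) auto
    moreover have "f ** g = f" using f e by (metis matrix_mul_assoc)
    then have "?d e \<le> ?d f" using f by (intro min) auto
    ultimately show False by simp
  qed
  then have "minproj A e" using e by (auto simp: minproj_def)
  then show ?thesis using e by auto
qed

text \<open>Split off an eigenprojection \<open>f\<close> with eigenvalue \<open>l\<close>, take the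
  root of the rest under \<open>g - f\<close> by induction, and add \<open>sqrt l\<close> times
  \<open>f\<close>. Positivity is assumed in the form of nonnegative eigenvalues on eigenprojections
  because a trace can test exactly this.\<close>

lemma positive_sqrt:
  assumes "g \<in> A" "is_proj g" "x \<in> A" "adj x = x" "g ** x = x" "x ** g = x"
    and "\<And>f l. f \<in> A \<Longrightarrow> is_proj f \<Longrightarrow> f \<noteq> 0 \<Longrightarrow> g ** f = f \<Longrightarrow> x ** f = smult (of_real l) f \<Longrightarrow> 0 \<le> l"
  shows "\<exists>y\<in>A. adj y = y \<and> x = y ** y \<and> g ** y = y \<and> y ** g = y"
  using assms
proof (induction "dim {g ** y |y. y \<in> A}" arbitrary: g x rule: less_induct)
  case less
  show ?case
  proof (cases "g = 0")
    case True
    then show ?thesis using less.prems zero_mem by (intro bexI[of _ 0]) auto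
  next
    case False
    obtain l f where f: "f \<in> A" "is_proj f" "f \<noteq> 0" and gf: "g ** f = f"
      and xf: "x ** f = smult (of_real l) f"
      by (rule eigenprojection[OF less.prems(1,2) False less.prems(3-5)])
    note fA = f(1)
    have fg: "f ** g = f" using is_proj_absorb[OF f(2) less.prems(2)] gf by simp
    have fx: "f ** x = smult (of_real l) f"
      using arg_cong[OF xf, of adj] f(2) less.prems(4) by (simp add: adj_mult adj_smult is_projD)
    have l0: "0 \<le> l" using less.prems(7)[OF f gf xf] .
    have ff: "f ** f = f" using f by (simp add: is_projD)
    have gg: "g ** g = g" using less.prems by (simp add: is_projD)
    let ?g = "g - f" and ?x = "x - smult (of_real l) f"
    have g': "?g \<in> A" "is_proj ?g"
      using fA less.prems f fg by (auto intro: diff_mem is_proj_diff)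
    have g'g: "?g ** g = ?g" "g ** ?g = ?g" "?g ** f = 0"
      by (simp_all add: matrix_diff_ldistrib matrix_diff_rdistrib fg gf gg ff)
    have smaller: "dim {?g ** y |y. y \<in> A} < dim {g ** y |y. y \<in> A}"
      using f by (intro dim_principal_less g' g'g less.prems) simp
    have x': "?x \<in> A" "adj ?x = ?x" "?g ** ?x = ?x" "?x ** ?g = ?x"
      using less.prems fA f
      by (simp_all add: diff_mem smult_mem adj_diff adj_smult is_projD matrix_diff_ldistrib
          matrix_diff_rdistrib gf fg fx xf ff)
    have pos: "0 \<le> k" if h: "h \<in> A" "is_proj h" "h \<noteq> 0" "?g ** h = h" "?x ** h = smult (of_real k) h" for h k
    proof (rule less.prems(7)[OF h(1-3)])
      show "g ** h = h" using h g'g by (metis matrix_mul_assoc)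
      then have "f ** h = 0" using h by (simp add: matrix_diff_rdistrib)
      then show "x ** h = smult (of_real k) h" using h by (simp add: matrix_diff_rdistrib)
    qed
    have "\<exists>y\<in>A. adj y = y \<and> ?x = y ** y \<and> ?g ** y = y \<and> y ** ?g = y"
      by (rule less.hyps[OF smaller g' x']) (rule pos)
    then obtain y' where y': "y' \<in> A" "adj y' = y'" "?x = y' ** y'" "?g ** y' = y'" "y' ** ?g = y'"
      by (elim bexE conjE) (rule that)
    have "f ** ?g = 0" by (simp add: matrix_diff_ldistrib fg ff)
    then have fy: "f ** y' = 0" "y' ** f = 0"
      using y' g'g by (metis matrix_mul_assoc matrix_mult_zero(1),
          metis matrix_mul_assoc matrix_mult_zero(2))
    define s where "s = complex_of_real (sqrt l)"
    have s: "s * s = of_real l" "cnj s = s" using l0 by (simp_all add: s_def flip: of_real_mult)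
    have "g ** y' = y'" "y' ** g = y'" using y' g'g by (metis matrix_mul_assoc)+
    then show ?thesis
      using y' fA fy s f gf fg
      by (intro bexI[of _ "y' + smult s f"])
         (auto simp: adj_add adj_smult is_projD matrix_add_ldistrib matrix_add_rdistrib
           y'(3)[symmetric] intro: add_mem smult_mem)
  qed
qed

section \<open>The centre and its minimal projections\<close>

lemma center_alg: "matalg (center A) u"
proof
  have 1: "(z ** w) ** x = x ** (z ** w)"
    if "\<And>x. x \<in> A \<Longrightarrow> z ** x = x ** z" "\<And>x. x \<in> A \<Longrightarrow> w ** x = x ** w" "x \<in> A" for z w x
    by (simp add: matrix_mul_assoc[symmetric] that(2)[OF that(3)])
       (simp add: matrix_mul_assoc that(1)[OF that(3)])
  have 2: "adj z ** x = x ** adj z" if "\<And>x. x \<in> A \<Longrightarrow> z ** x = x ** z" "x \<in> A" for z x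
    using arg_cong[OF that(1)[OF adj_mem[OF that(2)]], of adj] by (simp add: adj_mult)
  show "star_alg (center A) u"
    unfolding star_alg_def
  proof (intro conjI ballI allI)
    fix z w assume zw: "z \<in> center A" "w \<in> center A"
    have zc: "\<And>x. x \<in> A \<Longrightarrow> z ** x = x ** z" and wc: "\<And>x. x \<in> A \<Longrightarrow> w ** x = x ** w"
      and "z ** w \<in> A"
      using zw mult_mem unfolding center_def by blast+
    then show "z ** w \<in> center A" unfolding center_def using 1[OF zc wc] by blast
    show "z + w \<in> center A"
      using zw by (simp add: center_def add_mem matrix_add_ldistrib matrix_add_rdistrib)
  next
    fix z assume z: "z \<in> center A"
    have zc: "\<And>x. x \<in> A \<Longrightarrow> z ** x = x ** z" and "adj z \<in> A"
      using z adj_mem unfolding center_def by blast+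
    then show "adj z \<in> center A" unfolding center_def using 2[OF zc] by blast
  qed (auto simp: center_def zero_mem unit_mem smult_mem unit_left unit_right)
qed

text \<open>The reason for treating the centre as a \<open>matalg\<close>: existence and scalar
  compression of minimal projections carry over to minimal central ones.\<close>

lemma mcp_iff: "p \<in> mcp A \<longleftrightarrow> minproj (center A) p"
  by (auto simp: mcp_def minproj_def)

lemma mcpD:
  assumes "p \<in> mcp A"
  shows "p \<in> A" "is_proj p" "p \<noteq> 0" "p \<in> center A"
  using assms by (auto simp: mcp_def center_def)

lemma mcp_comm: "p \<in> mcp A \<Longrightarrow> x \<in> A \<Longrightarrow> p ** x = x ** p"
  by (auto simp: mcp_def center_def)

lemma mcp_orth:
  assumes p: "p \<in> mcp A" and q: "q \<in> mcp A" and "p \<noteq> q"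
  shows "p ** q = 0"
proof -
  interpret Z: matalg "center A" u by (rule center_alg)
  have c: "p ** q = q ** p" using mcp_comm[OF p mcpD(1)[OF q]] .
  have pr: "is_proj (p ** q)" "p ** q \<in> center A"
    using mcpD[OF p] mcpD[OF q] c[symmetric] by (simp_all add: is_proj_mult Z.mult_mem)
  have "(p ** q) ** q = p ** q" using mcpD[OF q] by (simp add: matrix_mul_assoc[symmetric] is_projD)
  then have 1: "p ** q = 0 \<or> p ** q = q" using q pr by (auto simp: mcp_def)
  have "(p ** q) ** p = p ** q" using mcpD[OF p] c by (metis is_projD(1) matrix_mul_assoc)
  then have "p ** q = 0 \<or> p ** q = p" using p pr by (auto simp: mcp_def)
  with 1 show ?thesis using assms by metis
qed

lemma mcp_finite: "finite (mcp A)"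
proof -
  have "pairwise orthogonal (mcp A)"
    by (auto simp: pairwise_def orthogonal_def inner_eq_mtrace mcp_orth mcpD is_projD)
  then have "independent (mcp A)"
    by (rule pairwise_orthogonal_independent) (auto dest: mcpD)
  then show ?thesis by (rule independent_imp_finite)
qed

text \<open>Otherwise the projection \<open>u - ?s\<close> of the centre dominates a minimal central
  projection, which would be both below \<open>?s\<close> and orthogonal to it.\<close>

lemma mcp_sum: "(\<Sum>p\<in>mcp A. p) = u"
proof (rule ccontr)
  interpret Z: matalg "center A" u by (rule center_alg)
  let ?s = "\<Sum>p\<in>mcp A. p"
  have sZ: "?s \<in> center A" by (rule Z.sum_mem) (rule mcpD)
  have sp: "?s ** p = p" if p: "p \<in> mcp A" for p
  proof -
    have "?s ** p = (\<Sum>q\<in>mcp A. if q = p then p else 0)"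
      unfolding matrix_mult_sum_left using p by (intro sum.cong) (auto simp: mcp_orth mcpD is_projD)
    then show ?thesis using p mcp_finite by simp
  qed
  have "?s ** ?s = ?s" by (simp add: matrix_mult_sum_right sp)
  moreover have "adj ?s = ?s"
    unfolding adj_sum by (intro sum.cong refl is_projD(2)) (rule mcpD)
  ultimately have "is_proj ?s" by (simp add: is_proj_def)
  then have pr: "is_proj (u - ?s)" "u - ?s \<in> center A"
    using sZ Z.unit_mem by (auto intro!: is_proj_diff unit_proj Z.diff_mem simp: Z.unit_right)
  assume "?s \<noteq> u"
  then obtain p where p: "minproj (center A) p" "p ** (u - ?s) = p"
    using Z.minproj_exists[OF pr(2,1)] by auto
  then have pm: "p \<in> mcp A" by (simp add: mcp_iff)
  have "p ** u = p" using mcpD[OF pm] by (simp add: unit_right)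
  then have "p ** ?s = 0" using p by (simp add: matrix_diff_ldistrib)
  moreover have "p ** ?s = p" using sp[OF pm] mcp_comm[OF pm] sZ by (simp add: center_def)
  ultimately show False using mcpD(3)[OF pm] by simp
qed

lemma mcp_decomp: "x \<in> A \<Longrightarrow> x = (\<Sum>p\<in>mcp A. x ** p)"
  by (simp add: matrix_mult_sum_right[symmetric] mcp_sum unit_right)

lemma center_scalar:
  assumes "z \<in> center A" "p \<in> mcp A"
  shows "\<exists>c. z ** p = smult c p"
proof -
  interpret Z: matalg "center A" u by (rule center_alg)
  obtain c where "p ** z ** p = smult c p" using Z.minproj_scalar assms by (auto simp: mcp_iff)
  moreover have "p ** z = z ** p" using mcp_comm[OF assms(2)] assms(1) by (simp add: center_def)
  ultimately show ?thesis using mcpD(2)[OF assms(2)] by (metis is_projD(1) matrix_mul_assoc)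
qed

lemma center_decomp:
  assumes "z \<in> center A" "\<And>p. p \<in> mcp A \<Longrightarrow> z ** p = smult (c p) p"
  shows "z = (\<Sum>p\<in>mcp A. smult (c p) p)"
  using mcp_decomp[of z] assms by (simp add: center_def cong: sum.cong)

section \<open>Minimal projections and matrix units of a simple summand\<close>

lemma minprojD:
  assumes "minproj A e"
  shows "e \<in> A" "is_proj e" "e \<noteq> 0" "e ** e = e" "adj e = e" "0 < Re (mtrace e)"
    "mtrace e \<noteq> 0"
proof -
  show *: "e \<in> A" "is_proj e" "e \<noteq> 0" using assms by (auto simp: minproj_def)
  then show "e ** e = e" "adj e = e" "0 < Re (mtrace e)"
    by (auto simp: is_projD is_proj_mtrace_pos)
  then show "mtrace e \<noteq> 0" by force
qed

lemma minproj_mtrace_real: "minproj A e \<Longrightarrow> mtrace e = of_real (Re (mtrace e))"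
  by (rule is_proj_mtrace_real) (rule minprojD)

lemma minproj_compress:
  assumes "minproj A e" "x \<in> A" "e ** x = x" "x ** e = x"
  shows "x = smult (rscalar e x) e"
proof -
  obtain c where "e ** x ** e = smult c e" using minproj_scalar assms by blast
  then have "x = smult c e" using assms by simp
  then show ?thesis using minprojD(7)[OF assms(1)] by (simp add: rscalar_def)
qed

lemma minproj_under:
  assumes "p \<in> mcp A"
  shows "minproj A (minproj_under A p)" "minproj_under A p ** p = minproj_under A p"
proof -
  have "\<exists>e. minproj A e \<and> e ** p = e" using minproj_exists mcpD assms by blast
  then have "minproj A (minproj_under A p) \<and> minproj_under A p ** p = minproj_under A p"
    unfolding minproj_under_def by (rule someI_ex)
  then show "minproj A (minproj_under A p)" "minproj_under A p ** p = minproj_under A p" by auto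
qed

text \<open>Partial isometries with common initial projection \<open>e\<close> whose orthogonal
  ranges add up to \<open>p\<close>: the first column of a system of matrix units, the units being
  \<open>v ** adj w\<close>. It stands in for an isomorphism of the summand with a full matrix
  algebra.\<close>

definition column_frame :: "'n cmat \<Rightarrow> 'n cmat \<Rightarrow> 'n cmat set \<Rightarrow> bool" where
  "column_frame p e F \<longleftrightarrow> finite F \<and> F \<subseteq> A \<and> (\<forall>w\<in>F. w ** e = w) \<and>
     (\<forall>v\<in>F. \<forall>w\<in>F. adj v ** w = (if v = w then e else 0)) \<and> (\<Sum>w\<in>F. w ** adj w) = p"

text \<open>Take an orthonormal frame of the left ideal \<open>A e\<close> for the trace form,
  scaled so that \<open>adj x ** y\<close> is the value of the form times \<open>e\<close>. Its
  \<open>P\<close> acts as the identity on \<open>A e\<close>, so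
  \<open>P ** a ** P = a ** P\<close> for all \<open>a\<close>; taking adjoints, \<open>P\<close> is
  central. It is a nonzero projection below \<open>p\<close>, hence \<open>p\<close>.\<close>

lemma column_frame_exists:
  assumes p: "p \<in> mcp A" and e: "minproj A e" and ep: "e ** p = e"
  obtains F where "column_frame p e F"
proof -
  note eD = minprojD[OF e]
  let ?W = "{x \<in> A. x ** e = x}"
  let ?a = "\<lambda>x y. mtrace (adj x ** y) / of_real (Re (mtrace e))"
  have "cform ?W ?a"
    by (rule cform_mtrace) (auto simp: zero_mem add_mem smult_mem matrix_add_rdistrib eD)
  then interpret cform ?W ?a .
  obtain F where F: "orthonormal F" and exp: "\<And>x. x \<in> ?W \<Longrightarrow> x = (\<Sum>w\<in>F. smult (?a w x) w)"
    using frame_exists by blast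
  have FW: "finite F" "F \<subseteq> ?W" using F by (auto simp: orthonormal_def)
  have sc: "adj x ** y = smult (?a x y) e" if "x \<in> ?W" "y \<in> ?W" for x y
  proof -
    have "e ** adj x = adj x" 
    proof -
      have "adj (x ** e) = adj x" using that by simp
      then show ?thesis by (simp only: adj_mult eD)
    qed
    then have "adj x ** y = smult (rscalar e (adj x ** y)) e"
      using that by (intro minproj_compress[OF e] mult_mem adj_mem)
        (auto simp: matrix_mul_assoc, auto simp: matrix_mul_assoc[symmetric])
    then show ?thesis by (simp add: rscalar_def flip: minproj_mtrace_real[OF e])
  qed
  define P where "P = (\<Sum>w\<in>F. w ** adj w)"
  have Px: "P ** x = x" if x: "x \<in> ?W" for x
  proof -
    have "P ** x = (\<Sum>w\<in>F. w ** (adj w ** x))"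
      by (simp add: P_def matrix_mult_sum_left matrix_mul_assoc)
    also have "\<dots> = (\<Sum>w\<in>F. w ** (smult (?a w x) e))"
      using FW x by (intro sum.cong refl arg_cong2[of _ _ _ _ "(**)"] sc) auto
    also have "\<dots> = (\<Sum>w\<in>F. smult (?a w x) w)"
      using FW by (intro sum.cong refl) auto
    finally show ?thesis using exp[OF x] by simp
  qed
  have Ps: "adj P = P" by (simp add: P_def adj_sum adj_mult)
  have PA: "P \<in> A" using FW by (auto simp: P_def intro!: sum_mem mult_mem adj_mem)
  have PaP: "P ** (a ** P) = a ** P" if a: "a \<in> A" for a
  proof -
    have "P ** (a ** P) = (\<Sum>w\<in>F. (P ** (a ** w)) ** adj w)"
      by (subst (2) P_def) (simp add: matrix_mult_sum_right matrix_mul_assoc)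
    also have "\<dots> = (\<Sum>w\<in>F. (a ** w) ** adj w)"
    proof (rule sum.cong[OF refl])
      fix w assume "w \<in> F"
      then have "w \<in> ?W" using FW by auto
      then have "a ** w \<in> ?W" using a by (auto simp: mult_mem matrix_mul_assoc[symmetric])
      then show "P ** (a ** w) ** adj w = a ** w ** adj w" by (simp only: Px)
    qed
    also have "\<dots> = a ** P" by (simp add: P_def matrix_mult_sum_right matrix_mul_assoc)
    finally show ?thesis .
  qed
  have comm: "P ** a = a ** P" if a: "a \<in> A" for a
  proof -
    have "adj (P ** (adj a ** P)) = adj (adj a ** P)" by (simp only: PaP[OF adj_mem[OF a]])
    then have "P ** (a ** P) = P ** a" by (simp add: adj_mult Ps matrix_mul_assoc)
    then show ?thesis using PaP[OF a] by simp
  qed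
  have PP: "P ** P = P" using PaP[OF unit_mem] by (simp add: unit_left PA)
  have "P ** p = (\<Sum>w\<in>F. w ** adj (p ** w))"
    by (simp add: P_def matrix_mult_sum_left adj_mult mcpD[OF p] is_projD matrix_mul_assoc)
  also have "\<dots> = P"
    unfolding P_def
  proof (intro sum.cong refl arg_cong2[of _ _ _ _ "(**)"] arg_cong[of _ _ adj])
    fix w assume "w \<in> F"
    then have "w \<in> A" "w ** e = w" using FW by auto
    then show "p ** w = w" using mcp_comm[OF p] ep by (metis matrix_mul_assoc)
  qed
  finally have Pp: "P ** p = P" .
  have "P ** e = e" by (rule Px) (simp add: eD)
  then have "P \<noteq> 0" using eD by auto
  moreover have "P \<in> center A" unfolding center_def using PA comm by blast
  moreover have "is_proj P" using PP Ps by (simp add: is_proj_def)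
  ultimately have "P = p" using p Pp unfolding mcp_def by blast
  moreover have "adj v ** w = (if v = w then e else 0)" if "v \<in> F" "w \<in> F" for v w
  proof -
    have "v \<in> ?W" "w \<in> ?W" using FW that by blast+
    from sc[OF this] show ?thesis using F that by (auto simp: orthonormal_def)
  qed
  ultimately have "column_frame p e F"
    using FW by (auto simp: column_frame_def P_def)
  then show thesis by (rule that)
qed

lemma column_frameD:
  assumes "column_frame p e F"
  shows "finite F" "w \<in> F \<Longrightarrow> w \<in> A" "w \<in> F \<Longrightarrow> w ** e = w"
    "v \<in> F \<Longrightarrow> w \<in> F \<Longrightarrow> adj v ** w = (if v = w then e else 0)" "(\<Sum>w\<in>F. w ** adj w) = p"
  using assms by (auto simp: column_frame_def)

lemma column_frame_mtrace:
  assumes "column_frame p e F"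
  shows "mtrace p = of_nat (card F) * mtrace e"
proof -
  note D = column_frameD[OF assms]
  have "mtrace p = (\<Sum>w\<in>F. mtrace (w ** adj w))"
    by (simp add: D(5)[symmetric] mtrace_sum)
  also have "\<dots> = (\<Sum>w\<in>F. mtrace (adj w ** w))"
    by (intro sum.cong refl mtrace_commute)
  finally show ?thesis using D(4) by simp
qed

lemma column_frame_expand:
  assumes F: "column_frame p e F" and p: "p \<in> mcp A" and e: "minproj A e" and x: "x \<in> A"
  shows "x ** p = (\<Sum>v\<in>F. \<Sum>w\<in>F. smult (rscalar e (adj v ** x ** w)) (v ** adj w))"
proof -
  note D = column_frameD[OF F] and eD = minprojD[OF e]
  have ev: "e ** adj v = adj v" if "v \<in> F" for v
    using arg_cong[OF D(3)[OF that], of adj] by (simp add: adj_mult eD)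
  have sc: "adj v ** x ** w = smult (rscalar e (adj v ** x ** w)) e" if "v \<in> F" "w \<in> F" for v w
    using that D x
    by (intro minproj_compress[OF e])
       (auto simp: ev matrix_mul_assoc intro!: mult_mem adj_mem, simp add: matrix_mul_assoc[symmetric])
  have "x ** p = p ** x ** p"
    unfolding mcp_comm[OF p x] by (simp add: matrix_mul_assoc[symmetric] is_projD mcpD(2)[OF p])
  also have "\<dots> = (\<Sum>v\<in>F. v ** adj v) ** x ** (\<Sum>w\<in>F. w ** adj w)"
    by (simp only: D(5))
  also have "\<dots> = (\<Sum>v\<in>F. \<Sum>w\<in>F. v ** (adj v ** x ** w) ** adj w)"
    by (simp add: matrix_mult_sum_left matrix_mult_sum_right matrix_mul_assoc) (rule sum.swap)
  also have "\<dots> = (\<Sum>v\<in>F. \<Sum>w\<in>F. v ** smult (rscalar e (adj v ** x ** w)) e ** adj w)"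
    by (intro sum.cong refl arg_cong2[of _ _ _ _ "(**)"] sc)
  also have "\<dots> = (\<Sum>v\<in>F. \<Sum>w\<in>F. smult (rscalar e (adj v ** x ** w)) (v ** adj w))"
    by (intro sum.cong refl) (simp add: D(3))
  finally show ?thesis .
qed

text \<open>The matrix units \<open>v ** adj w\<close>, each with the factors \<open>1\<close> and
  \<open>\<i>\<close>, form a real orthogonal basis of \<open>cut A p\<close>. The two factors
  account for the division by \<open>2\<close> in \<open>msize\<close>.\<close>

lemma ssize_card:
  assumes F: "column_frame p e F" and p: "p \<in> mcp A" and e: "minproj A e"
  shows "ssize A p = real (card F)"
proof -
  note D = column_frameD[OF F] and eD = minprojD[OF e]
  define T where "T = F \<times> F \<times> {1, \<i>}"
  define g where "g = (\<lambda>(v, w, c). smult c (v ** adj w) :: 'n cmat)"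
  have inner: "inner (g (v, w, c)) (g (v', w', c'))
      = (if v = v' \<and> w = w' then Re (cnj c * c') * Re (mtrace e) else 0)"
    if "v \<in> F" "w \<in> F" "v' \<in> F" "w' \<in> F" for v w c v' w' c'
  proof -
    have "mtrace (adj (v ** adj w) ** (v' ** adj w')) = mtrace (w ** (adj v ** v') ** adj w')"
      by (simp add: adj_mult matrix_mul_assoc)
    also have "\<dots> = (if v = v' then mtrace (w ** e ** adj w') else 0)"
      using D(4)[of v v'] that by simp
    also have "mtrace (w ** e ** adj w') = mtrace (adj w' ** w)"
      using that D(3)[of w] by (simp add: mtrace_commute[of w])
    also have "\<dots> = (if w = w' then mtrace e else 0)" using D(4)[of w' w] that by auto
    finally have *: "mtrace (adj (v ** adj w) ** (v' ** adj w'))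
        = (if v = v' \<and> w = w' then mtrace e else 0)" by simp
    have "Im (mtrace e) = 0" using minproj_mtrace_real[OF e] by (metis Im_complex_of_real)
    then show ?thesis
      by (simp add: inner_eq_mtrace g_def adj_smult *)
  qed
  have orth: "inner (g s) (g t) = (if s = t then Re (mtrace e) else 0)" if "s \<in> T" "t \<in> T" for s t
    using that inner unfolding T_def by (auto split: if_splits)
  have inj: "inj_on g T"
    using orth eD(6) by (intro inj_onI) (metis less_irrefl)
  have "0 \<notin> g ` T" using orth eD(6) by force
  moreover have "pairwise orthogonal (g ` T)"
    using orth by (auto simp: pairwise_def orthogonal_def)
  ultimately have ind: "independent (g ` T)" by (intro pairwise_orthogonal_independent)
  have "g ` T \<subseteq> cut A p"
  proof
    fix x assume "x \<in> g ` T"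
    then obtain v w c where x: "x = smult c (v ** adj w)" "v \<in> F" "w \<in> F" by (auto simp: T_def g_def)
    have pw: "p ** w = w"
    proof -
      have "p ** w = (\<Sum>v\<in>F. v ** (adj v ** w))"
        by (simp add: D(5)[symmetric] matrix_mult_sum_left matrix_mul_assoc)
      also have "\<dots> = (\<Sum>v\<in>F. if v = w then v else 0)"
        using x D by (intro sum.cong) (auto simp: D(4))
      finally show ?thesis using x D by simp
    qed
    then have "adj w ** p = adj w" using mcpD[OF p] by (metis adj_mult is_projD(2))
    then have "x = x ** p" using x by (simp add: matrix_mul_assoc[symmetric])
    moreover have "x \<in> A" using x D by (auto intro: smult_mem mult_mem adj_mem)
    ultimately show "x \<in> cut A p" by (auto simp: cut_def)
  qed
  moreover have "cut A p \<subseteq> span (g ` T)"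
  proof
    fix y assume "y \<in> cut A p"
    then obtain x where x: "x \<in> A" "y = x ** p" by (auto simp: cut_def)
    have "smult c (v ** adj w) \<in> span (g ` T)" if "v \<in> F" "w \<in> F" for c v w
    proof -
      have "g (v, w, 1) \<in> span (g ` T)" "g (v, w, \<i>) \<in> span (g ` T)"
        using that by (auto intro!: span_base imageI simp: T_def)
      then have "Re c *\<^sub>R g (v, w, 1) + Im c *\<^sub>R g (v, w, \<i>) \<in> span (g ` T)"
        by (intro span_add span_scale)
      moreover have "Re c *\<^sub>R g (v, w, 1) + Im c *\<^sub>R g (v, w, \<i>) = smult c (v ** adj w)"
        by (simp add: g_def scaleR_smult smult_add_left[symmetric]) (metis complex_eq mult.commute)
      ultimately show ?thesis by simp
    qed
    then show "y \<in> span (g ` T)"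
      unfolding x(2) column_frame_expand[OF F p e x(1)] by (intro span_sum)
  qed
  ultimately have "card (g ` T) = dim (cut A p)" using ind by (intro basis_card_eq_dim)
  moreover have "card (g ` T) = 2 * (card F * card F)"
    using card_image[OF inj] by (simp add: T_def card_cartesian_product)
  ultimately have "dim (cut A p) = 2 * (card F * card F)" by simp
  then have "real (dim (cut A p)) / 2 = (real (card F))\<^sup>2" by (simp add: power2_eq_square)
  then show ?thesis by (simp add: ssize_def msize_def)
qed

lemma mtrace_ssize:
  assumes "p \<in> mcp A" "minproj A e" "e ** p = e"
  shows "mtrace p = of_real (ssize A p) * mtrace e"
proof -
  obtain F where F: "column_frame p e F" by (rule column_frame_exists[OF assms])
  show ?thesis using column_frame_mtrace[OF F] ssize_card[OF F assms(1,2)] by simp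
qed

lemma ssize_pos: "p \<in> mcp A \<Longrightarrow> 0 < ssize A p"
proof -
  assume p: "p \<in> mcp A"
  note e = minproj_under[OF p]
  have "mtrace p = of_real (ssize A p) * of_real (Re (mtrace (minproj_under A p)))"
    using mtrace_ssize[OF p e] minproj_mtrace_real[OF e(1)] by simp
  then have "Re (mtrace p) = ssize A p * Re (mtrace (minproj_under A p))"
    by (metis Re_complex_of_real of_real_mult)
  then show ?thesis
    using is_proj_mtrace_pos[OF mcpD(2,3)[OF p]] minprojD(6)[OF e(1)]
    by (metis zero_less_mult_pos2)
qed

end

section \<open>Perron--Frobenius theory for bipartite matrices\<close>

text \<open>The assumption \<open>irreducible\<close> says that the bipartite graph of the nonzero
  entries is connected: vertex sets \<open>S\<close> and \<open>T\<close> without edges to their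
  complements, \<open>S\<close> nonempty, exhaust the graph.\<close>

locale bipartite =
  fixes P :: "'a set" and Q :: "'b set" and L :: "'a \<Rightarrow> 'b \<Rightarrow> real"
  assumes finP: "finite P" and finQ: "finite Q" and neP: "P \<noteq> {}" and neQ: "Q \<noteq> {}"
    and L_nonneg: "\<And>p q. p \<in> P \<Longrightarrow> q \<in> Q \<Longrightarrow> 0 \<le> L p q"
    and irreducible: "\<And>S T. S \<subseteq> Q \<Longrightarrow> T \<subseteq> P \<Longrightarrow> S \<noteq> {} \<Longrightarrow>
      (\<And>p q. p \<in> T \<Longrightarrow> q \<in> Q - S \<Longrightarrow> L p q = 0) \<Longrightarrow>
      (\<And>p q. p \<in> P - T \<Longrightarrow> q \<in> S \<Longrightarrow> L p q = 0) \<Longrightarrow> S = Q \<and> T = P"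
begin

definition ap :: "('b \<Rightarrow> real) \<Rightarrow> 'a \<Rightarrow> real" where
  "ap x p = (\<Sum>q\<in>Q. L p q * x q)"

definition tr :: "('a \<Rightarrow> real) \<Rightarrow> 'b \<Rightarrow> real" where
  "tr y q = (\<Sum>p\<in>P. L p q * y p)"

lemma ap_tr: "(\<Sum>p\<in>P. y p * ap x p) = (\<Sum>q\<in>Q. tr y q * x q)"
  unfolding ap_def tr_def
  by (simp add: sum_distrib_left sum_distrib_right mult_ac) (rule sum.swap)

lemma ap_nonneg: "(\<And>q. q \<in> Q \<Longrightarrow> 0 \<le> x q) \<Longrightarrow> p \<in> P \<Longrightarrow> 0 \<le> ap x p"
  unfolding ap_def by (intro sum_nonneg mult_nonneg_nonneg L_nonneg)

text \<open>The supports of \<open>x\<close> and of \<open>ap x\<close> have no edges to their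
  complements, since a vanishing sum of nonnegative terms vanishes termwise; irreducibility makes
  them full.\<close>

lemma eigenvector_pos:
  assumes x: "\<And>q. q \<in> Q \<Longrightarrow> 0 \<le> x q" and q0: "q0 \<in> Q" "0 < x q0"
    and eig: "\<And>q. q \<in> Q \<Longrightarrow> tr (ap x) q = r * x q"
  shows "\<And>q. q \<in> Q \<Longrightarrow> 0 < x q" "\<And>p. p \<in> P \<Longrightarrow> 0 < ap x p"
proof -
  define S where "S = {q \<in> Q. 0 < x q}"
  define T where "T = {p \<in> P. 0 < ap x p}"
  have "S = Q \<and> T = P"
  proof (rule irreducible)
    show "S \<noteq> {}" using q0 by (auto simp: S_def)
    fix p q
    show "L p q = 0" if p: "p \<in> T" and q: "q \<in> Q - S"
    proof -
      have "x q = 0" using x[of q] q by (auto simp: S_def)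
      then have "(\<Sum>p\<in>P. L p q * ap x p) = 0" using eig[of q] q by (simp add: tr_def)
      then have "\<forall>p\<in>P. L p q * ap x p = 0"
        using q by (subst (asm) sum_nonneg_eq_0_iff)
          (auto intro!: mult_nonneg_nonneg L_nonneg ap_nonneg x finP)
      then show ?thesis using p by (auto simp: T_def)
    qed
    show "L p q = 0" if p: "p \<in> P - T" and q: "q \<in> S"
    proof -
      have "ap x p = 0" using ap_nonneg[of x p] x p by (auto simp: T_def)
      then have "\<forall>q\<in>Q. L p q * x q = 0"
        unfolding ap_def using p
        by (subst (asm) sum_nonneg_eq_0_iff) (auto intro!: mult_nonneg_nonneg L_nonneg x finQ)
      then show ?thesis using q by (auto simp: S_def)
    qed
  qed (auto simp: S_def T_def)
  then show "\<And>q. q \<in> Q \<Longrightarrow> 0 < x q" "\<And>p. p \<in> P \<Longrightarrow> 0 < ap x p"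
    by (auto simp: S_def T_def)
qed

text \<open>A nonnegative maximiser of \<open>F\<close> on the unit sphere of \<open>n\<close>.
  Varying it in one coordinate \<open>j\<close> at a time gives the eigenvector equation in that
  coordinate.\<close>

lemma eigenvector_exists:
  obtains v r where "\<And>q. q \<in> Q \<Longrightarrow> 0 < v q" "\<And>q. q \<in> Q \<Longrightarrow> tr (ap v) q = r * v q"
proof -
  define F where "F x = (\<Sum>p\<in>P. (ap x p)\<^sup>2)" for x
  define n where "n x = (\<Sum>q\<in>Q. (x q)\<^sup>2)" for x :: "'b \<Rightarrow> real"
  \<comment> \<open>The index type may be infinite and the entries outside \<open>Q\<close> enter
    neither \<open>n\<close> nor \<open>F\<close>; confining all entries to \<open>[-1, 1]\<close>
    makes \<open>K\<close> compact in the product topology.\<close>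
  define K where "K = (\<Pi>\<^sub>E q\<in>UNIV. {-1..1::real}) \<inter> {x. n x = 1}"
  have cont: "continuous_on UNIV n" "continuous_on UNIV F"
    unfolding n_def F_def ap_def by (intro continuous_intros continuous_on_product_coordinates)+
  have "compact (\<Pi>\<^sub>E q\<in>(UNIV::'b set). {-1..1::real})"
    by (subst compactin_euclidean_iff[symmetric], subst euclidean_product_topology[symmetric],
        subst compactin_PiE) simp
  moreover have "closed {x. n x = 1}"
    by (rule closed_Collect_eq[OF cont(1)]) (rule continuous_on_const)
  ultimately have "compact K" unfolding K_def by (rule compact_Int_closed)
  obtain q0 where q0: "q0 \<in> Q" using neQ by auto
  have "n (\<lambda>q. if q = q0 then 1 else 0) = 1"
    using q0 finQ by (simp add: n_def if_distrib[of "\<lambda>z. z\<^sup>2"] cong: if_cong)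
  then have "(\<lambda>q. if q = q0 then 1 else 0) \<in> K" by (auto simp: K_def)
  then have "K \<noteq> {}" by blast
  then obtain x where x: "x \<in> K" "\<forall>y\<in>K. F y \<le> F x"
    using continuous_attains_sup[OF \<open>compact K\<close> _ continuous_on_subset[OF cont(2)]] by blast
  have F_scale: "F (\<lambda>q. c * y q) = c\<^sup>2 * F y" for c y
  proof -
    have "ap (\<lambda>q. c * y q) p = c * ap y p" for p
      by (simp add: ap_def sum_distrib_left mult_ac)
    then show ?thesis by (simp add: F_def power_mult_distrib sum_distrib_left)
  qed
  have n_scale: "n (\<lambda>q. c * y q) = c\<^sup>2 * n y" for c y
    by (simp add: n_def power_mult_distrib sum_distrib_left)
  have n_nonneg: "0 \<le> n y" for y by (simp add: n_def sum_nonneg)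
  have bound: "F y \<le> F x * n y" for y
  proof -
    \<comment> \<open>The entries of \<open>y\<close> outside \<open>Q\<close> are arbitrary and
      could leave the cube, so they are set to zero before rescaling.\<close>
    define y' where "y' q = (if q \<in> Q then y q else 0)" for q
    have y': "F y' = F y" "n y' = n y"
      unfolding F_def n_def ap_def y'_def by (intro sum.cong refl arg_cong[of _ _ "\<lambda>z. z\<^sup>2"]; simp)+
    show ?thesis
    proof (cases "n y = 0")
      case True
      then have "y q = 0" if "q \<in> Q" for q
        using that finQ by (auto simp: n_def sum_nonneg_eq_0_iff)
      then show ?thesis using True by (simp add: F_def ap_def)
    next
      case False
      then have pos: "0 < n y" using n_nonneg[of y] by simp
      define c where "c = 1 / sqrt (n y)"
      have c2: "c\<^sup>2 * n y = 1" using pos by (simp add: c_def power_divide)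
      let ?z = "\<lambda>q. c * y' q"
      have nz: "n ?z = 1" using c2 by (simp add: n_scale y')
      have "\<bar>?z q\<bar> \<le> 1" for q
      proof (cases "q \<in> Q")
        case True
        have "(?z q)\<^sup>2 \<le> n ?z"
          unfolding n_def using True finQ by (intro member_le_sum) auto
        then show ?thesis using nz by (simp add: abs_square_le_1)
      qed (simp add: y'_def)
      then have "?z \<in> K" using nz by (auto simp: K_def PiE_iff abs_le_iff minus_le_iff)
      then have "c\<^sup>2 * F y \<le> F x" using x by (metis F_scale y'(1))
      then have "c\<^sup>2 * n y * F y \<le> F x * n y"
        using pos by (metis mult.commute mult.left_commute mult_right_mono less_imp_le)
      then show ?thesis using c2 by simp
    qed
  qed
  \<comment> \<open>Absolute values keep \<open>n\<close> and, as \<open>L\<close> is nonnegative,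
    do not decrease \<open>F\<close>; so \<open>w\<close> is again a maximiser.\<close>
  define w where "w q = \<bar>x q\<bar>" for q
  have nw: "n w = 1" using x by (simp add: n_def w_def K_def)
  have "F x \<le> F w"
    unfolding F_def
  proof (intro sum_mono)
    fix p assume p: "p \<in> P"
    have "\<bar>ap x p\<bar> \<le> (\<Sum>q\<in>Q. \<bar>L p q * x q\<bar>)" unfolding ap_def by (rule sum_abs)
    also have "\<dots> = ap w p"
      unfolding ap_def w_def using p by (intro sum.cong) (auto simp: abs_mult L_nonneg)
    finally show "(ap x p)\<^sup>2 \<le> (ap w p)\<^sup>2" by (metis abs_ge_zero power2_abs power_mono)
  qed
  then have Fw: "F w = F x" using bound[of w] nw by simp
  have eig: "tr (ap w) j = F x * w j" if j: "j \<in> Q" for j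
  proof -
    have "2 * t * (tr (ap w) j - F x * w j) + t\<^sup>2 * ((\<Sum>p\<in>P. (L p j)\<^sup>2) - F x) \<le> 0" for t
    proof -
      let ?y = "\<lambda>q. w q + (if q = j then t else 0)"
      have "ap ?y p = ap w p + t * L p j" for p
        using j finQ by (simp add: ap_def distrib_left sum.distrib if_distrib[of "(*) _"] cong: if_cong)
      then have 1: "F ?y = F w + 2 * t * tr (ap w) j + t\<^sup>2 * (\<Sum>p\<in>P. (L p j)\<^sup>2)"
        by (simp add: F_def tr_def power2_sum sum.distrib sum_distrib_left power_mult_distrib mult_ac)
      have "(?y q)\<^sup>2 = (w q)\<^sup>2 + (if q = j then 2 * t * w q + t\<^sup>2 else 0)" for q
        by (simp add: power2_sum)
      then have 2: "n ?y = 1 + 2 * t * w j + t\<^sup>2"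
        using j finQ nw by (simp add: n_def sum.distrib)
      from bound[of ?y] show ?thesis
        unfolding 1 2 Fw by (simp add: algebra_simps)
    qed
    from quadratic_nonpos_imp_zero[OF this] show ?thesis by simp
  qed
  have "\<exists>q\<in>Q. 0 < w q"
  proof (rule ccontr)
    assume "\<not> ?thesis"
    then have "n w = 0" by (auto simp: n_def w_def intro!: sum.neutral)
    with nw show False by simp
  qed
  then obtain q1 where "q1 \<in> Q" "0 < w q1" by blast
  with eigenvector_pos(1)[of w q1 "F x"] eig have "\<And>q. q \<in> Q \<Longrightarrow> 0 < w q"
    by (auto simp: w_def)
  with eig that show thesis by blast
qed

text \<open>Schur's test with weights \<open>v\<close>: Cauchy--Schwarz after splitting
  \<open>L p q * x q\<close> as \<open>sqrt (L p q * v q)\<close> times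
  \<open>sqrt (L p q * v q) * (x q / v q)\<close> bounds the norm by \<open>sqrt r\<close>, and
  \<open>v\<close> itself attains it. So every positive eigenvector has the same eigenvalue.\<close>

lemma eigenvalue_rnorm:
  assumes v: "\<And>q. q \<in> Q \<Longrightarrow> 0 < v q" and eig: "\<And>q. q \<in> Q \<Longrightarrow> tr (ap v) q = r * v q"
  shows "(rnorm P Q L)\<^sup>2 = r" "0 < r"
proof -
  obtain q0 where q0: "q0 \<in> Q" using neQ by auto
  have apv: "0 < ap v p" if "p \<in> P" for p
    using eigenvector_pos(2)[of v q0 r p] v eig q0 that less_imp_le by blast
  have sum_pos: "0 < (\<Sum>q\<in>Q. (v q)\<^sup>2)"
    by (intro sum_pos zero_less_power v finQ neQ)
  have sq: "(\<Sum>p\<in>P. (ap v p)\<^sup>2) = r * (\<Sum>q\<in>Q. (v q)\<^sup>2)"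
  proof -
    have "(\<Sum>p\<in>P. (ap v p)\<^sup>2) = (\<Sum>p\<in>P. ap v p * ap v p)" by (simp add: power2_eq_square)
    also have "\<dots> = (\<Sum>q\<in>Q. tr (ap v) q * v q)" by (rule ap_tr)
    also have "\<dots> = r * (\<Sum>q\<in>Q. (v q)\<^sup>2)"
      by (simp add: eig sum_distrib_left power2_eq_square mult_ac)
    finally show ?thesis .
  qed
  have "0 < (\<Sum>p\<in>P. (ap v p)\<^sup>2)"
    by (intro Groups_Big.ordered_comm_monoid_add_class.sum_pos zero_less_power apv finP neP)
  then show r: "0 < r" using sq sum_pos by (simp add: zero_less_mult_iff)
  have bound: "(\<Sum>p\<in>P. (ap x p)\<^sup>2) \<le> r * (\<Sum>q\<in>Q. (x q)\<^sup>2)" for x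
  proof -
    have "(ap x p)\<^sup>2 \<le> ap v p * (\<Sum>q\<in>Q. L p q * v q * (x q / v q)\<^sup>2)" if p: "p \<in> P" for p
    proof -
      have "ap x p = (\<Sum>q\<in>Q. sqrt (L p q * v q) * (sqrt (L p q * v q) * (x q / v q)))"
        unfolding ap_def
      proof (intro sum.cong refl)
        fix q assume q: "q \<in> Q"
        have "0 \<le> L p q * v q" using L_nonneg[OF p q] v[OF q] by simp
        then have "sqrt (L p q * v q) * (sqrt (L p q * v q) * (x q / v q)) = L p q * v q * (x q / v q)"
          by (simp only: mult.assoc[symmetric] real_sqrt_mult_self abs_of_nonneg)
        then show "L p q * x q = sqrt (L p q * v q) * (sqrt (L p q * v q) * (x q / v q))"
          using v[OF q] by simp
      qed
      also have "\<dots>\<^sup>2 \<le> (\<Sum>q\<in>Q. (sqrt (L p q * v q))\<^sup>2) * (\<Sum>q\<in>Q. (sqrt (L p q * v q) * (x q / v q))\<^sup>2)"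
        by (rule Cauchy_Schwarz_ineq_sum)
      also have "(\<Sum>q\<in>Q. (sqrt (L p q * v q))\<^sup>2) = ap v p"
        unfolding ap_def using L_nonneg[OF p] v by (intro sum.cong) (auto simp: less_imp_le)
      also have "(\<Sum>q\<in>Q. (sqrt (L p q * v q) * (x q / v q))\<^sup>2) = (\<Sum>q\<in>Q. L p q * v q * (x q / v q)\<^sup>2)"
        using L_nonneg[OF p] v
        by (intro sum.cong refl, subst power_mult_distrib) (auto simp: less_imp_le)
      finally show ?thesis .
    qed
    then have "(\<Sum>p\<in>P. (ap x p)\<^sup>2) \<le> (\<Sum>p\<in>P. ap v p * (\<Sum>q\<in>Q. L p q * v q * (x q / v q)\<^sup>2))"
      by (rule sum_mono)
    also have "\<dots> = (\<Sum>p\<in>P. ap v p * ap (\<lambda>q. v q * (x q / v q)\<^sup>2) p)"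
      by (simp add: ap_def mult.assoc)
    also have "\<dots> = (\<Sum>q\<in>Q. tr (ap v) q * (v q * (x q / v q)\<^sup>2))" by (rule ap_tr)
    also have "\<dots> = (\<Sum>q\<in>Q. r * (x q)\<^sup>2)"
    proof (intro sum.cong refl)
      fix q assume q: "q \<in> Q"
      show "tr (ap v) q * (v q * (x q / v q)\<^sup>2) = r * (x q)\<^sup>2"
        using v[OF q] by (simp add: eig[OF q] power2_eq_square)
    qed
    finally show ?thesis by (simp add: sum_distrib_left)
  qed
  have "rnorm P Q L = sqrt r"
    unfolding rnorm_def
  proof (rule cSup_eq_maximum)
    define c where "c = 1 / sqrt (\<Sum>q\<in>Q. (v q)\<^sup>2)"
    have c: "c\<^sup>2 * (\<Sum>q\<in>Q. (v q)\<^sup>2) = 1" using sum_pos by (simp add: c_def power_divide)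
    let ?x = "\<lambda>q. c * v q"
    have "(\<Sum>q\<in>Q. (?x q)\<^sup>2) \<le> 1" using c by (simp add: power_mult_distrib sum_distrib_left)
    moreover have "(\<Sum>p\<in>P. (\<Sum>q\<in>Q. L p q * ?x q)\<^sup>2) = r"
    proof -
      have "(\<Sum>q\<in>Q. L p q * ?x q) = c * ap v p" for p
        by (simp add: ap_def sum_distrib_left mult_ac)
      then have "(\<Sum>p\<in>P. (\<Sum>q\<in>Q. L p q * ?x q)\<^sup>2) = c\<^sup>2 * (\<Sum>p\<in>P. (ap v p)\<^sup>2)"
        by (simp add: power_mult_distrib sum_distrib_left)
      also have "\<dots> = r" unfolding sq using c by (simp add: mult_ac)
      finally show ?thesis .
    qed
    ultimately show "sqrt r \<in> {sqrt (\<Sum>i\<in>P. (\<Sum>j\<in>Q. L i j * x j)\<^sup>2) |x. (\<Sum>j\<in>Q. (x j)\<^sup>2) \<le> 1}"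
      by (intro CollectI exI[of _ ?x] conjI) simp_all
  next
    fix y assume "y \<in> {sqrt (\<Sum>i\<in>P. (\<Sum>j\<in>Q. L i j * x j)\<^sup>2) |x. (\<Sum>j\<in>Q. (x j)\<^sup>2) \<le> 1}"
    then obtain x where x: "y = sqrt (\<Sum>p\<in>P. (ap x p)\<^sup>2)" "(\<Sum>q\<in>Q. (x q)\<^sup>2) \<le> 1"
      by (auto simp: ap_def)
    have "(\<Sum>p\<in>P. (ap x p)\<^sup>2) \<le> r * 1"
      using bound[of x] mult_left_mono[OF x(2), of r] r by linarith
    then show "y \<le> sqrt r" using x by simp
  qed
  then show "(rnorm P Q L)\<^sup>2 = r" using r by simp
qed

lemma perron_vector:
  obtains v where "\<And>q. q \<in> Q \<Longrightarrow> 0 < v q" "\<And>p. p \<in> P \<Longrightarrow> 0 < ap v p"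
    "\<And>q. q \<in> Q \<Longrightarrow> tr (ap v) q = (rnorm P Q L)\<^sup>2 * v q"
proof -
  obtain v r where v: "\<And>q. q \<in> Q \<Longrightarrow> 0 < v q" "\<And>q. q \<in> Q \<Longrightarrow> tr (ap v) q = r * v q"
    using eigenvector_exists by blast
  obtain q0 where "q0 \<in> Q" using neQ by auto
  then have "\<And>p. p \<in> P \<Longrightarrow> 0 < ap v p"
    using eigenvector_pos(2)[of v q0 r] v less_imp_le by blast
  then show thesis using that[of v] v eigenvalue_rnorm[of v r] by simp
qed

lemma rnorm_sq_pos: "0 < (rnorm P Q L)\<^sup>2"
  by (rule perron_vector) (use eigenvalue_rnorm in blast)

text \<open>Subtract from \<open>x\<close> the largest multiple of \<open>v\<close> that leaves it
  nonnegative. The difference is a nonnegative eigenvector with a zero entry, so by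
  \<open>eigenvector_pos\<close> it vanishes.\<close>

lemma eigenvector_unique:
  assumes v: "\<And>q. q \<in> Q \<Longrightarrow> 0 < v q" "\<And>q. q \<in> Q \<Longrightarrow> tr (ap v) q = r * v q"
    and x: "\<And>q. q \<in> Q \<Longrightarrow> 0 < x q" "\<And>q. q \<in> Q \<Longrightarrow> tr (ap x) q = k * x q"
  obtains c where "0 < c" "\<And>q. q \<in> Q \<Longrightarrow> x q = c * v q"
proof -
  have kr: "k = r" using eigenvalue_rnorm(1)[of v r] eigenvalue_rnorm(1)[of x k] v x by simp
  define c where "c = Min ((\<lambda>q. x q / v q) ` Q)"
  have "c \<in> (\<lambda>q. x q / v q) ` Q" unfolding c_def using finQ neQ by (intro Min_in) auto
  then obtain q0 where q0: "q0 \<in> Q" "c = x q0 / v q0" by auto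
  have c: "0 < c" using q0 v x by simp
  define y where "y q = x q - c * v q" for q
  have cle: "c \<le> x q / v q" if "q \<in> Q" for q
    unfolding c_def using finQ that by (intro Min_le) auto
  have y: "0 \<le> y q" if "q \<in> Q" for q
    using cle[OF that] v(1)[OF that] by (simp add: y_def pos_le_divide_eq)
  have ap_y: "ap y p = ap x p - c * ap v p" for p
    by (simp add: ap_def y_def right_diff_distrib sum_subtractf sum_distrib_left mult_ac)
  have tr_y: "tr (ap y) q = tr (ap x) q - c * tr (ap v) q" for q
    by (simp add: tr_def ap_y right_diff_distrib sum_subtractf sum_distrib_left mult_ac)
  have eig: "tr (ap y) q = r * y q" if "q \<in> Q" for q
    unfolding tr_y v(2)[OF that] x(2)[OF that] kr y_def by (simp add: algebra_simps)
  have y0: "y q0 = 0" using q0 v(1)[OF q0(1)] by (simp add: y_def)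
  have "y q = 0" if "q \<in> Q" for q
  proof (rule ccontr)
    assume "y q \<noteq> 0"
    then have "0 < y q" using y[OF that] by simp
    from eigenvector_pos(1)[of y, OF y that this eig q0(1)] y0 show False by simp
  qed
  then show thesis using that[of c] c by (simp add: y_def)
qed

end

section \<open>Tracial states\<close>

context matalg
begin

lemma tracial_stateD:
  assumes "tracial_state A u \<phi>"
  shows "x \<notin> A \<Longrightarrow> \<phi> x = 0" "x \<in> A \<Longrightarrow> y \<in> A \<Longrightarrow> \<phi> (x + y) = \<phi> x + \<phi> y"
    "x \<in> A \<Longrightarrow> y \<in> A \<Longrightarrow> \<phi> (x ** y) = \<phi> (y ** x)"
    "x \<in> A \<Longrightarrow> \<phi> (smult c x) = c * \<phi> x"
    "x \<in> A \<Longrightarrow> \<phi> (adj x ** x) \<in> \<real>" "x \<in> A \<Longrightarrow> 0 \<le> Re (\<phi> (adj x ** x))"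
    "x \<in> A \<Longrightarrow> \<phi> (adj x ** x) = 0 \<Longrightarrow> x = 0" "\<phi> u = 1"
  using assms unfolding tracial_state_def by blast+

lemma tracial_state_sum:
  assumes "tracial_state A u \<phi>" "\<And>i. i \<in> I \<Longrightarrow> f i \<in> A"
  shows "\<phi> (\<Sum>i\<in>I. f i) = (\<Sum>i\<in>I. \<phi> (f i))"
proof -
  have "\<phi> 0 = 0" using tracial_stateD(4)[OF assms(1) zero_mem, of 0] by simp
  then show ?thesis using assms(2)
    by (induction I rule: infinite_finite_induct)
       (auto simp: tracial_stateD(2)[OF assms(1)] sum_mem)
qed

text \<open>A trace kills the off-diagonal matrix units \<open>v ** adj w\<close> and takes one
  value on all diagonal ones, exactly as \<open>mtrace\<close> does.\<close>

lemma tracial_state_block: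
  assumes \<phi>: "tracial_state A u \<phi>" and p: "p \<in> mcp A" and e: "minproj A e" "e ** p = e"
    and x: "x \<in> A"
  shows "\<phi> (x ** p) = \<phi> e / mtrace e * mtrace (x ** p)"
proof -
  obtain F where F: "column_frame p e F" by (rule column_frame_exists[OF p e])
  note D = column_frameD[OF F]
  let ?c = "\<lambda>v w. rscalar e (adj v ** x ** w)"
  have vw: "v ** adj w \<in> A" if "v \<in> F" "w \<in> F" for v w
    using that D by (simp add: mult_mem adj_mem)
  have "\<phi> (v ** adj w) = (if v = w then \<phi> e else 0)" if "v \<in> F" "w \<in> F" for v w
  proof -
    have "\<phi> 0 = 0" using tracial_stateD(4)[OF \<phi> zero_mem, of 0] by simp
    moreover have "\<phi> (v ** adj w) = \<phi> (adj w ** v)"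
      using that D by (intro tracial_stateD(3)[OF \<phi>] adj_mem) auto
    ultimately show ?thesis using D(4)[of w v] that by auto
  qed
  then have "\<phi> (x ** p) = (\<Sum>v\<in>F. \<Sum>w\<in>F. ?c v w * (if v = w then \<phi> e else 0))"
    unfolding column_frame_expand[OF F p e(1) x]
    by (simp add: tracial_state_sum[OF \<phi>] sum_mem smult_mem vw tracial_stateD(4)[OF \<phi>])
  then have 1: "\<phi> (x ** p) = (\<Sum>v\<in>F. ?c v v) * \<phi> e"
    using D(1) by (simp add: if_distrib[of "(*) _"] sum_distrib_right cong: if_cong)
  have "mtrace (v ** adj w) = (if v = w then mtrace e else 0)" if "v \<in> F" "w \<in> F" for v w
    using D(4)[of w v] that by (auto simp: mtrace_commute[of v])
  then have "mtrace (x ** p) = (\<Sum>v\<in>F. \<Sum>w\<in>F. ?c v w * (if v = w then mtrace e else 0))"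
    unfolding column_frame_expand[OF F p e(1) x] by (simp add: mtrace_sum)
  then have "mtrace (x ** p) = (\<Sum>v\<in>F. ?c v v) * mtrace e"
    using D(1) by (simp add: if_distrib[of "(*) _"] sum_distrib_right cong: if_cong)
  with 1 show ?thesis using minprojD(7)[OF e(1)] by simp
qed

text \<open>The trace with trace vector \<open>s\<close>. The value \<open>0\<close> off
  \<open>A\<close> matches the convention of \<open>tracial_state\<close>, which determines its
  states as functions.\<close>

definition wtrace :: "('n cmat \<Rightarrow> real) \<Rightarrow> 'n cmat \<Rightarrow> complex" where
  "wtrace s x = (if x \<in> A
     then \<Sum>p\<in>mcp A. of_real (s p) / mtrace (minproj_under A p) * mtrace (x ** p) else 0)"

lemma tracial_state_minproj:
  assumes \<phi>: "tracial_state A u \<phi>" and e: "minproj A e"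
  shows "\<phi> e = of_real (Re (\<phi> e))" "0 < Re (\<phi> e)"
proof -
  note eD = minprojD[OF e]
  have ee: "adj e ** e = e" by (simp add: eD)
  have "\<phi> e \<in> \<real>" "0 \<le> Re (\<phi> e)" "\<phi> e \<noteq> 0"
    using tracial_stateD(5-7)[OF \<phi> eD(1)] eD(3) unfolding ee by blast+
  then show r: "\<phi> e = of_real (Re (\<phi> e))" by simp
  have "Re (\<phi> e) \<noteq> 0" using r \<open>\<phi> e \<noteq> 0\<close> by (metis of_real_0)
  then show "0 < Re (\<phi> e)" using \<open>0 \<le> Re (\<phi> e)\<close> by simp
qed

text \<open>Tracial states are determined by their trace vectors, so uniqueness of the Markov trace
  becomes uniqueness of a positive eigenvector.\<close>

lemma tracial_state_eq_wtrace:
  assumes \<phi>: "tracial_state A u \<phi>"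
  shows "\<phi> = wtrace (\<lambda>p. Re (\<phi> (minproj_under A p)))"
proof
  fix x
  show "\<phi> x = wtrace (\<lambda>p. Re (\<phi> (minproj_under A p))) x"
  proof (cases "x \<in> A")
    case True
    have "\<phi> x = \<phi> (\<Sum>p\<in>mcp A. x ** p)" using mcp_decomp[OF True] by simp
    also have "\<dots> = (\<Sum>p\<in>mcp A. \<phi> (x ** p))"
      by (intro tracial_state_sum[OF \<phi>] mult_mem[OF True] mcpD)
    also have "\<dots> = (\<Sum>p\<in>mcp A. \<phi> (minproj_under A p) / mtrace (minproj_under A p) * mtrace (x ** p))"
      by (intro sum.cong refl tracial_state_block[OF \<phi>] minproj_under True)
    finally show ?thesis
      using True tracial_state_minproj(1)[OF \<phi> minproj_under(1)] by (simp add: wtrace_def)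
  qed (simp add: wtrace_def tracial_stateD(1)[OF \<phi>])
qed

lemma tracial_state_mcp:
  assumes \<phi>: "tracial_state A u \<phi>" and p: "p \<in> mcp A"
  shows "\<phi> p = of_real (ssize A p * Re (\<phi> (minproj_under A p)))"
proof -
  note e = minproj_under[OF p]
  have "\<phi> p = \<phi> (minproj_under A p) / mtrace (minproj_under A p) * mtrace p"
    using tracial_state_block[OF \<phi> p e mcpD(1)[OF p]] by (simp add: is_projD mcpD(2)[OF p])
  also have "\<dots> = of_real (ssize A p) * \<phi> (minproj_under A p)"
    using mtrace_ssize[OF p e] minprojD(7)[OF e(1)] by simp
  finally show ?thesis using tracial_state_minproj(1)[OF \<phi> e(1)] by simp
qed

lemma tracial_state_weights:
  assumes \<phi>: "tracial_state A u \<phi>"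
  shows "(\<Sum>p\<in>mcp A. ssize A p * Re (\<phi> (minproj_under A p))) = 1"
proof -
  have "1 = \<phi> (\<Sum>p\<in>mcp A. p)" by (simp add: mcp_sum tracial_stateD(8)[OF \<phi>])
  also have "\<dots> = (\<Sum>p\<in>mcp A. \<phi> p)" by (intro tracial_state_sum[OF \<phi>] mcpD)
  also have "\<dots> = of_real (\<Sum>p\<in>mcp A. ssize A p * Re (\<phi> (minproj_under A p)))"
    using tracial_state_mcp[OF \<phi>] by simp
  finally have "complex_of_real (\<Sum>p\<in>mcp A. ssize A p * Re (\<phi> (minproj_under A p))) = 1" by simp
  then show ?thesis by (simp only: of_real_eq_1_iff)
qed

lemma wtrace_minproj:
  assumes p: "p \<in> mcp A"
  shows "wtrace s (minproj_under A p) = of_real (s p)"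
proof -
  let ?e = "minproj_under A p"
  note e = minproj_under[OF p]
  have "?e ** q = (if q = p then ?e else 0)" if "q \<in> mcp A" for q
    using e(2) mcp_orth[OF p that] by (metis matrix_mul_assoc matrix_mult_zero(2))
  then have "wtrace s ?e = (\<Sum>q\<in>mcp A. if q = p then of_real (s p) / mtrace ?e * mtrace ?e else 0)"
    unfolding wtrace_def using minprojD(1)[OF e(1)] by (auto intro!: sum.cong)
  then show ?thesis using p mcp_finite minprojD(7)[OF e(1)] by simp
qed

lemma wtrace_adj_mult:
  assumes x: "x \<in> A"
  shows "wtrace s (adj x ** x)
    = of_real (\<Sum>p\<in>mcp A. s p / Re (mtrace (minproj_under A p)) * (norm (x ** p))\<^sup>2)"
proof -
  have "of_real (s p) / mtrace (minproj_under A p) * mtrace (adj x ** x ** p)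
     = complex_of_real (s p / Re (mtrace (minproj_under A p)) * (norm (x ** p))\<^sup>2)"
    if p: "p \<in> mcp A" for p
  proof -
    have "adj (x ** p) ** (x ** p) = p ** (adj x ** x) ** p"
      by (simp add: adj_mult mcpD[OF p] is_projD matrix_mul_assoc)
    also have "\<dots> = adj x ** x ** (p ** p)"
      unfolding mcp_comm[OF p mult_mem[OF adj_mem[OF x] x]] by (simp add: matrix_mul_assoc)
    also have "\<dots> = adj x ** x ** p" by (simp add: mcpD[OF p] is_projD)
    finally have "mtrace (adj x ** x ** p) = of_real ((norm (x ** p))\<^sup>2)"
      by (metis mtrace_adj_mult_self)
    then show ?thesis
      by (subst minproj_mtrace_real[OF minproj_under(1)[OF p]]) simp
  qed
  then show ?thesis using x by (simp add: wtrace_def mult_mem adj_mem)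
qed

lemma wtrace_state:
  assumes s: "\<And>p. p \<in> mcp A \<Longrightarrow> 0 < s p" and norm: "(\<Sum>p\<in>mcp A. ssize A p * s p) = 1"
  shows "tracial_state A u (wtrace s)"
proof -
  have add: "wtrace s (x + y) = wtrace s x + wtrace s y" if "x \<in> A" "y \<in> A" for x y
    using that by (simp add: wtrace_def add_mem matrix_add_rdistrib mtrace_add distrib_left sum.distrib)
  have comm: "wtrace s (x ** y) = wtrace s (y ** x)" if "x \<in> A" "y \<in> A" for x y
  proof -
    have "mtrace (x ** y ** p) = mtrace (y ** x ** p)" if p: "p \<in> mcp A" for p
    proof -
      have "mtrace (x ** y ** p) = mtrace (x ** (p ** y))"
        using mcp_comm[OF p \<open>y \<in> A\<close>] by (simp add: matrix_mul_assoc)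
      also have "\<dots> = mtrace (p ** (y ** x))"
        by (subst mtrace_commute) (simp add: matrix_mul_assoc)
      also have "\<dots> = mtrace (y ** x ** p)" by (rule mtrace_commute)
      finally show ?thesis .
    qed
    then show ?thesis using that by (simp add: wtrace_def mult_mem)
  qed
  have hom: "wtrace s (smult c x) = c * wtrace s x" if "x \<in> A" for c x
    using that by (simp add: wtrace_def smult_mem sum_distrib_left mult_ac)
  have pos: "0 \<le> s p / Re (mtrace (minproj_under A p)) * (norm (x ** p))\<^sup>2"
    if "p \<in> mcp A" for p x
    using s[OF that] minprojD(6)[OF minproj_under(1)[OF that]] by simp
  have faithful: "x = 0" if x: "x \<in> A" and 0: "wtrace s (adj x ** x) = 0" for x
  proof -
    have "(\<Sum>p\<in>mcp A. s p / Re (mtrace (minproj_under A p)) * (norm (x ** p))\<^sup>2) = 0"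
      using 0 unfolding wtrace_adj_mult[OF x] by (simp only: of_real_eq_0_iff)
    then have "\<forall>p\<in>mcp A. s p / Re (mtrace (minproj_under A p)) * (norm (x ** p))\<^sup>2 = 0"
      using mcp_finite pos by (subst (asm) sum_nonneg_eq_0_iff) auto
    then have "x ** p = 0" if "p \<in> mcp A" for p
      using that s[OF that] minprojD(6)[OF minproj_under(1)[OF that]] by auto
    then show ?thesis using mcp_decomp[OF x] by simp
  qed
  have *: "mtrace p / mtrace (minproj_under A p) = of_real (ssize A p)" if "p \<in> mcp A" for p
    using mtrace_ssize[OF that minproj_under[OF that]] minprojD(7)[OF minproj_under(1)[OF that]]
    by simp
  have "of_real (s p) / mtrace (minproj_under A p) * mtrace (u ** p) = of_real (ssize A p * s p)"
    if "p \<in> mcp A" for p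
  proof -
    have "of_real (s p) / mtrace (minproj_under A p) * mtrace (u ** p)
        = of_real (s p) * (mtrace p / mtrace (minproj_under A p))"
      using that by (simp add: unit_left mcpD(1))
    then show ?thesis using * that by simp
  qed
  then have "wtrace s u = of_real (\<Sum>p\<in>mcp A. ssize A p * s p)"
    by (simp add: wtrace_def unit_mem)
  then have one: "wtrace s u = 1" using norm by simp
  show ?thesis
    unfolding tracial_state_def
    using add comm hom faithful one pos
    by (auto simp: wtrace_adj_mult intro!: sum_nonneg) (simp_all add: wtrace_def)
qed

lemma wtrace_adj:
  assumes x: "x \<in> A"
  shows "wtrace s (adj x) = cnj (wtrace s x)"
proof -
  have "mtrace (adj x ** p) = cnj (mtrace (x ** p))" if p: "p \<in> mcp A" for p
  proof -
    have "adj (x ** p) = adj x ** p"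
      using mcp_comm[OF p adj_mem[OF x]] by (simp add: adj_mult mcpD[OF p] is_projD)
    then show ?thesis by (metis mtrace_adj)
  qed
  moreover have "cnj (mtrace (minproj_under A p)) = mtrace (minproj_under A p)" if p: "p \<in> mcp A" for p
    by (metis minproj_mtrace_real[OF minproj_under(1)[OF p]] complex_cnj_complex_of_real)
  ultimately show ?thesis
    unfolding wtrace_def using x by (simp add: adj_mem cong: sum.cong)
qed

text \<open>Hermiticity is not among the clauses of \<open>tracial_state\<close>; it is read off the
  explicit formula.\<close>

lemma tracial_state_adj: "tracial_state A u \<phi> \<Longrightarrow> x \<in> A \<Longrightarrow> \<phi> (adj x) = cnj (\<phi> x)"
  using wtrace_adj tracial_state_eq_wtrace by metis

lemma sum_mcp_mult:
  assumes "S \<subseteq> mcp A" "q \<in> mcp A"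
  shows "(\<Sum>p\<in>S. p) ** q = (if q \<in> S then q else 0)"
proof -
  have "(\<Sum>p\<in>S. p) ** q = (\<Sum>p\<in>S. if p = q then q else 0)"
    unfolding matrix_mult_sum_left using assms
    by (intro sum.cong) (auto simp: mcp_orth mcpD is_projD subset_iff)
  then show ?thesis using finite_subset[OF assms(1) mcp_finite] by simp
qed

end

section \<open>Inclusions and their Bratteli matrix\<close>

text \<open>A general common unit \<open>u\<close>, and connectedness phrased with multiples of
  \<open>u\<close>: the corner inclusions, whose unit is \<open>p ** q\<close>, then satisfy the
  same assumptions.\<close>

locale inclusion = N: matalg N u + M: matalg M u
  for N M :: "('n::finite) cmat set" and u +
  assumes sub: "N \<subseteq> M" and u_nonzero: "u \<noteq> 0"
    and connected: "\<And>z. z \<in> center N \<Longrightarrow> z \<in> center M \<Longrightarrow> \<exists>c. z = smult c u"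
begin

abbreviation e :: "'n cmat \<Rightarrow> 'n cmat" where "e p \<equiv> minproj_under M p"
abbreviation f :: "'n cmat \<Rightarrow> 'n cmat" where "f q \<equiv> minproj_under N q"

lemmas e = M.minproj_under and f = N.minproj_under

lemma NM: "x \<in> N \<Longrightarrow> x \<in> M"
  using sub by auto

lemma fD:
  assumes "q \<in> mcp N"
  shows "f q \<in> N" "f q \<in> M" "is_proj (f q)" "f q \<noteq> 0" "f q ** f q = f q" "adj (f q) = f q"
    "0 < Re (mtrace (f q))" "mtrace (f q) \<noteq> 0" "f q ** q = f q" "q ** f q = f q"
  using N.minprojD[OF f(1)[OF assms]] f(2)[OF assms] NM N.mcp_comm[OF assms] by auto

lemma f_mcp: "p \<in> mcp M \<Longrightarrow> q \<in> mcp N \<Longrightarrow> p ** f q = f q ** p"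
  by (rule M.mcp_comm) (auto intro: fD)

lemma fp_proj: "p \<in> mcp M \<Longrightarrow> q \<in> mcp N \<Longrightarrow> is_proj (f q ** p)"
  by (intro is_proj_mult fD M.mcpD f_mcp)

lemma Lam_nonneg: "p \<in> mcp M \<Longrightarrow> q \<in> mcp N \<Longrightarrow> 0 \<le> Lam N M p q"
  using is_proj_norm[OF fp_proj] M.minprojD(6)[OF e(1)] by (simp add: Lam_def less_imp_le)

lemma mtrace_Lam:
  assumes "p \<in> mcp M" "q \<in> mcp N"
  shows "mtrace (f q ** p) = of_real (Lam N M p q) * mtrace (e p)"
  using M.minprojD(6)[OF e(1)[OF assms(1)]] is_proj_mtrace_real[OF fp_proj[OF assms]]
    M.minproj_mtrace_real[OF e(1)[OF assms(1)]]
  unfolding Lam_def by (metis nonzero_mult_div_cancel_right of_real_divide of_real_eq_0_iff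
      less_irrefl nonzero_eq_divide_eq)

text \<open>A zero entry means \<open>f q ** p = 0\<close>; as \<open>p\<close> is central in
  \<open>M\<close>, the matrix units of \<open>N q\<close> spread this to
  \<open>q ** p = 0\<close>.\<close>

lemma Lam_zero:
  assumes p: "p \<in> mcp M" and q: "q \<in> mcp N" and "Lam N M p q = 0"
  shows "q ** p = 0"
proof -
  have "mtrace (f q ** p) = 0" using mtrace_Lam[OF p q] assms by simp
  then have fp: "f q ** p = 0" using is_proj_norm[OF fp_proj[OF p q]] by simp
  obtain G where G: "N.column_frame q (f q) G" by (rule N.column_frame_exists[OF q f[OF q]])
  note D = N.column_frameD[OF G]
  have "q ** p = (\<Sum>g\<in>G. g ** adj g ** p)" by (simp add: D(5)[symmetric] matrix_mult_sum_left)
  also have "\<dots> = 0"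
  proof (intro sum.neutral ballI)
    fix g assume g: "g \<in> G"
    have "g ** adj g ** p = (g ** f q) ** (p ** adj g)"
      using M.mcp_comm[OF p, of "adj g"] g D NM M.adj_mem by (simp add: matrix_mul_assoc)
    also have "\<dots> = g ** (f q ** p) ** adj g" by (simp add: matrix_mul_assoc)
    finally show "g ** adj g ** p = 0" by (simp add: fp)
  qed
  finally show ?thesis .
qed

lemma mcp_nonempty: "mcp M \<noteq> {}" "mcp N \<noteq> {}"
  using M.mcp_sum N.mcp_sum u_nonzero by auto

text \<open>If no edge leaves \<open>S\<close> and \<open>T\<close>, then the projections in
  \<open>S\<close> and those in \<open>T\<close> have the same sum: both equal the double sum of
  \<open>q ** p\<close> over \<open>S\<close> and \<open>T\<close>. This element lies in both
  centres, so it is a multiple of \<open>u\<close>, and comparison with one \<open>q0\<close> in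
  \<open>S\<close> shows that it is \<open>u\<close>.\<close>

lemma bratteli_irreducible:
  assumes S: "S \<subseteq> mcp N" "S \<noteq> {}" and T: "T \<subseteq> mcp M"
    and 1: "\<And>p q. p \<in> T \<Longrightarrow> q \<in> mcp N - S \<Longrightarrow> Lam N M p q = 0"
    and 2: "\<And>p q. p \<in> mcp M - T \<Longrightarrow> q \<in> S \<Longrightarrow> Lam N M p q = 0"
  shows "S = mcp N \<and> T = mcp M"
proof -
  let ?z = "\<Sum>q\<in>S. q" and ?w = "\<Sum>p\<in>T. p"
  have zN: "?z \<in> center N"
    by (rule matalg.sum_mem[OF N.center_alg]) (use S N.mcpD(4) in auto)
  have wM: "?w \<in> center M"
    by (rule matalg.sum_mem[OF M.center_alg]) (use T M.mcpD(4) in auto)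
  have "?z = (\<Sum>q\<in>S. \<Sum>p\<in>mcp M. q ** p)"
    by (intro sum.cong refl M.mcp_decomp NM N.mcpD(1)) (use S in auto)
  also have "\<dots> = (\<Sum>q\<in>S. \<Sum>p\<in>T. q ** p)"
    using T S 2 Lam_zero by (intro sum.cong refl sum.mono_neutral_right M.mcp_finite) auto
  also have "\<dots> = (\<Sum>p\<in>T. \<Sum>q\<in>S. q ** p)" by (rule sum.swap)
  also have "\<dots> = (\<Sum>p\<in>T. \<Sum>q\<in>mcp N. q ** p)"
    using T S 1 Lam_zero by (intro sum.cong refl sum.mono_neutral_left N.mcp_finite) auto
  also have "\<dots> = ?w"
  proof (intro sum.cong refl)
    fix p assume "p \<in> T"
    then have "p \<in> M" using T M.mcpD by auto
    then show "(\<Sum>q\<in>mcp N. q ** p) = p"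
      by (simp add: matrix_mult_sum_left[symmetric] N.mcp_sum M.unit_left)
  qed
  finally have zw: "?z = ?w" .
  obtain c where c: "?z = smult c u" using connected zN wM zw by metis
  obtain q0 where q0: "q0 \<in> S" using S by auto
  then have q0N: "q0 \<in> mcp N" using S by auto
  have "q0 = smult c u ** q0" using N.sum_mcp_mult[OF S(1) q0N] q0 c by simp
  then have "smult 1 q0 = smult c q0" using N.unit_left N.mcpD(1)[OF q0N] by simp
  then have "c = 1" using smult_cancel N.mcpD(3)[OF q0N] by metis
  then have zu: "?z = u" using c by simp
  have "q \<in> S" if q: "q \<in> mcp N" for q
  proof (rule ccontr)
    assume "q \<notin> S"
    then have "u ** q = 0" using N.sum_mcp_mult[OF S(1) q] zu by simp
    then show False using N.unit_left N.mcpD[OF q] by simp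
  qed
  moreover have "p \<in> T" if p: "p \<in> mcp M" for p
  proof (rule ccontr)
    assume "p \<notin> T"
    then have "u ** p = 0" using M.sum_mcp_mult[OF T p] zu zw by simp
    then show False using M.unit_left M.mcpD[OF p] by simp
  qed
  ultimately show ?thesis using S T by auto
qed

sublocale bratteli: bipartite "mcp M" "mcp N" "Lam N M"
  by unfold_locales
     (use N.mcp_finite M.mcp_finite mcp_nonempty Lam_nonneg bratteli_irreducible in blast)+

definition d :: real where "d = dnorm N M"

lemma d_sq_pos: "0 < d\<^sup>2"
  using bratteli.rnorm_sq_pos by (simp add: d_def dnorm_def)

end

section \<open>Conditional expectations and their index\<close>

context inclusion
begin

lemma cond_expD:
  assumes "cond_exp M N E"
  shows "x \<notin> M \<Longrightarrow> E x = 0" "x \<in> M \<Longrightarrow> E x \<in> N" "b \<in> N \<Longrightarrow> E b = b"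
    "x \<in> M \<Longrightarrow> y \<in> M \<Longrightarrow> E (x + y) = E x + E y"
    "x \<in> M \<Longrightarrow> E (smult c x) = smult c (E x)"
    "x \<in> M \<Longrightarrow> b \<in> N \<Longrightarrow> b' \<in> N \<Longrightarrow> E (b ** x ** b') = b ** E x ** b'"
    "x \<in> M \<Longrightarrow> psd (E (adj x ** x))" "x \<in> M \<Longrightarrow> E (adj x ** x) = 0 \<Longrightarrow> x = 0"
  using assms unfolding cond_exp_def by blast+

lemma cond_exp_left:
  assumes "cond_exp M N E" "x \<in> M" "b \<in> N"
  shows "E (b ** x) = b ** E x"
  using cond_expD(6)[OF assms N.unit_mem] cond_expD(2)[OF assms(1,2)] assms
  by (simp add: M.unit_right N.unit_right M.mult_mem N.mult_mem NM)

lemma cond_exp_right: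
  assumes "cond_exp M N E" "x \<in> M" "b \<in> N"
  shows "E (x ** b) = E x ** b"
  using cond_expD(6)[OF assms(1,2) N.unit_mem assms(3)] cond_expD(2)[OF assms(1,2)] assms
  by (simp add: M.unit_left N.unit_left M.mult_mem N.mult_mem NM)

lemma cond_exp_zero: "cond_exp M N E \<Longrightarrow> E 0 = 0"
  by (rule cond_expD(3)[OF _ N.zero_mem])

lemma cond_exp_sum:
  assumes "cond_exp M N E" "\<And>i. i \<in> I \<Longrightarrow> g i \<in> M"
  shows "E (\<Sum>i\<in>I. g i) = (\<Sum>i\<in>I. E (g i))"
  using assms(2)
  by (induction I rule: infinite_finite_induct)
     (auto simp: cond_exp_zero[OF assms(1)] cond_expD(4)[OF assms(1)] M.sum_mem)

lemma psd_selfadj: "psd X \<Longrightarrow> adj X = X"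
  by (auto simp: psd_def adj_mult)

text \<open>A self-adjoint \<open>h\<close> is \<open>((h + 1)\<^sup>* (h + 1) - h\<^sup>* h - 1) / 2\<close>, a combination of positive elements.\<close>
lemma cond_exp_selfadj:
  assumes E: "cond_exp M N E" and h: "h \<in> M" "adj h = h"
  shows "adj (E h) = E h"
proof -
  note ED = cond_expD[OF E] and uu = is_projD[OF M.unit_proj]
  have sa: "adj (E (adj y ** y)) = E (adj y ** y)" if "y \<in> M" for y
    using ED(7)[OF that] by (rule psd_selfadj)
  have hh: "adj h ** h \<in> M" "h + u \<in> M"
    using h by (auto intro: M.mult_mem M.add_mem M.unit_mem)
  have "adj (h + u) ** (h + u) = adj h ** h + (smult 2 h + u)"
    using h by (simp add: adj_add uu matrix_add_ldistrib matrix_add_rdistrib M.unit_left M.unit_right)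
      (simp add: smult_def vec_eq_iff)
  then have "E (adj (h + u) ** (h + u)) = E (adj h ** h) + (smult 2 (E h) + u)"
    using h hh(1) ED(3)[OF N.unit_mem] by (simp add: ED(4) ED(5) M.add_mem M.smult_mem M.unit_mem)
  then have *: "smult 2 (E h) = E (adj (h + u) ** (h + u)) - E (adj h ** h) - u" by simp
  have "adj (smult 2 (E h)) = smult 2 (E h)"
    unfolding * adj_diff sa[OF hh(2)] sa[OF h(1)] uu(2) ..
  then have "smult (1/2) (smult 2 (adj (E h))) = smult (1/2) (smult 2 (E h))" by (simp add: adj_smult)
  then show ?thesis by simp
qed

lemma cond_exp_adj:
  assumes E: "cond_exp M N E" and x: "x \<in> M"
  shows "E (adj x) = adj (E x)"
proof -
  obtain h k where hk: "h \<in> M" "adj h = h" "k \<in> M" "adj k = k" "x = smult (1/2) h - smult (\<i>/2) k"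
    by (rule M.selfadj_decomp[OF x])
  have lin: "E (smult c h + smult c' k) = smult c (E h) + smult c' (E k)" for c c'
    using hk by (simp add: cond_expD(4,5)[OF E] M.smult_mem)
  have x': "x = smult (1/2) h + smult (-\<i>/2) k"
    by (simp add: hk(5) smult_def vec_eq_iff)
  show ?thesis
    unfolding x' adj_add adj_smult lin hk(2,4) cond_exp_selfadj[OF E hk(1,2)] cond_exp_selfadj[OF E hk(3,4)] ..
qed

section \<open>Forms, frames and quasi-bases of an expectation\<close>

definition cols :: "'n cmat \<Rightarrow> 'n cmat set" where
  "cols q = {x \<in> M. x ** f q = x}"

definition eform :: "('n cmat \<Rightarrow> 'n cmat) \<Rightarrow> 'n cmat \<Rightarrow> 'n cmat \<Rightarrow> 'n cmat \<Rightarrow> complex" where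
  "eform E q x y = rscalar (f q) (E (adj x ** y))"

lemma cond_exp_compress:
  assumes E: "cond_exp M N E" and q: "q \<in> mcp N"
    and x: "x \<in> M" "f q ** x = x" "x ** f q = x"
  shows "E x = smult (rscalar (f q) (E x)) (f q)"
  using cond_expD(2)[OF E x(1)] cond_exp_left[OF E x(1) fD(1)[OF q]]
    cond_exp_right[OF E x(1) fD(1)[OF q]] x
  by (intro N.minproj_compress[OF f(1)[OF q]]) auto

lemma cols_adj: "x \<in> cols q \<Longrightarrow> q \<in> mcp N \<Longrightarrow> f q ** adj x = adj x"
  unfolding cols_def by (metis (mono_tags, lifting) adj_mult fD(6) mem_Collect_eq)

lemma eform_eq:
  assumes E: "cond_exp M N E" and q: "q \<in> mcp N" and x: "x \<in> cols q" and y: "y \<in> cols q"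
  shows "E (adj x ** y) = smult (eform E q x y) (f q)"
  unfolding eform_def using x y cols_adj[OF x q]
  by (intro cond_exp_compress[OF E q])
     (auto simp: cols_def M.mult_mem M.adj_mem matrix_mul_assoc, simp add: matrix_mul_assoc[symmetric])

text \<open>Definiteness combines positivity and faithfulness of \<open>E\<close>:
  \<open>E (adj x ** x) = adj Y ** Y\<close> with \<open>Y \<noteq> 0\<close>, and the trace of this
  is the square of \<open>norm Y\<close>. The matrix \<open>Y\<close> may lie outside
  \<open>N\<close>.\<close>

lemma cform_eform:
  assumes E: "cond_exp M N E" and q: "q \<in> mcp N"
  shows "cform (cols q) (eform E q)"
proof
  show "0 \<in> cols q" by (simp add: cols_def M.zero_mem)
  fix x y z c
  assume x: "x \<in> cols q"
  then have xM: "x \<in> M" "adj x \<in> M" by (auto simp: cols_def M.adj_mem)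
  show "smult c x \<in> cols q" using x by (simp add: cols_def M.smult_mem)
  { assume "x \<noteq> 0"
    then have "E (adj x ** x) \<noteq> 0" using cond_expD(8)[OF E xM(1)] by blast
    moreover obtain Y where Y: "E (adj x ** x) = adj Y ** Y"
      using cond_expD(7)[OF E xM(1)] by (auto simp: psd_def)
    ultimately have "Y \<noteq> 0" by auto
    have "eform E q x x = of_real ((norm Y)\<^sup>2 / Re (mtrace (f q)))"
      unfolding eform_def rscalar_def Y
      by (subst N.minproj_mtrace_real[OF f(1)[OF q]]) (simp add: mtrace_adj_mult_self)
    then show "0 < Re (eform E q x x)"
      using \<open>Y \<noteq> 0\<close> fD(7)[OF q] by simp }
  assume y: "y \<in> cols q"
  then have yM: "y \<in> M" "adj y \<in> M" by (auto simp: cols_def M.adj_mem)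
  show "x + y \<in> cols q" using x y by (simp add: cols_def M.add_mem matrix_add_rdistrib)
  show "eform E q x (smult c y) = c * eform E q x y"
    using xM yM by (simp add: eform_def rscalar_def cond_expD(5)[OF E] M.mult_mem)
  have "E (adj y ** x) = adj (E (adj x ** y))"
    using cond_exp_adj[OF E M.mult_mem[OF xM(2) yM(1)]] by (simp add: adj_mult)
  then have "mtrace (E (adj y ** x)) = cnj (mtrace (E (adj x ** y)))" by (simp add: mtrace_adj)
  moreover have "cnj (mtrace (f q)) = mtrace (f q)"
    by (metis N.minproj_mtrace_real[OF f(1)[OF q]] complex_cnj_complex_of_real)
  ultimately show "eform E q y x = cnj (eform E q x y)"
    by (simp add: eform_def rscalar_def)
  assume z: "z \<in> cols q"
  then have "z \<in> M" by (simp add: cols_def)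
  then show "eform E q x (y + z) = eform E q x y + eform E q x z"
    using xM yM
    by (simp add: eform_def rscalar_def cond_expD(4)[OF E] M.mult_mem matrix_add_ldistrib
        mtrace_add add_divide_distrib)
qed

text \<open>An indexed family in place of a list, with one of the two expansions of
  \<open>quasi_basis\<close>; the other one follows by adjoints in
  \<open>qbasis_right\<close>.\<close>

definition qbasis :: "('n cmat \<Rightarrow> 'n cmat) \<Rightarrow> 'i set \<Rightarrow> ('i \<Rightarrow> 'n cmat) \<Rightarrow> bool" where
  "qbasis E I v \<longleftrightarrow> finite I \<and> v ` I \<subseteq> M \<and> (\<forall>x\<in>M. x = (\<Sum>i\<in>I. v i ** E (adj (v i) ** x)))"

lemma qbasisD:
  assumes "qbasis E I v"
  shows "finite I" "i \<in> I \<Longrightarrow> v i \<in> M" "x \<in> M \<Longrightarrow> (\<Sum>i\<in>I. v i ** E (adj (v i) ** x)) = x"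
  using assms by (auto simp: qbasis_def)

lemma qbasis_right:
  assumes E: "cond_exp M N E" and v: "qbasis E I v" and x: "x \<in> M"
  shows "(\<Sum>i\<in>I. E (x ** v i) ** adj (v i)) = x"
proof -
  note D = qbasisD[OF v]
  have "adj x = (\<Sum>i\<in>I. v i ** E (adj (v i) ** adj x))" using D(3)[OF M.adj_mem[OF x]] by simp
  also have "\<dots> = (\<Sum>i\<in>I. v i ** adj (E (x ** v i)))"
    using cond_exp_adj[OF E] x D(2) by (intro sum.cong refl) (metis adj_mult M.mult_mem)
  finally have "adj (adj x) = (\<Sum>i\<in>I. adj (v i ** adj (E (x ** v i))))" by (simp only: adj_sum)
  then show ?thesis by (simp add: adj_mult)
qed

text \<open>Expand each \<open>v i\<close> in the family \<open>w\<close>, then sum over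
  \<open>i\<close> first, which collapses by the right-hand expansion. Thus the choice made by
  \<open>SOME\<close> in \<open>Ind\<close> has no influence.\<close>

lemma qbasis_index_unique:
  assumes E: "cond_exp M N E" and v: "qbasis E I v" and w: "qbasis E J w"
  shows "(\<Sum>i\<in>I. v i ** adj (v i)) = (\<Sum>j\<in>J. w j ** adj (w j))"
proof -
  note D = qbasisD[OF v] and D' = qbasisD[OF w]
  have "(\<Sum>i\<in>I. v i ** adj (v i)) = (\<Sum>i\<in>I. (\<Sum>j\<in>J. w j ** E (adj (w j) ** v i)) ** adj (v i))"
    by (intro sum.cong refl) (simp add: D D')
  also have "\<dots> = (\<Sum>j\<in>J. w j ** (\<Sum>i\<in>I. E (adj (w j) ** v i) ** adj (v i)))"
    by (simp add: matrix_mult_sum_left matrix_mult_sum_right matrix_mul_assoc) (rule sum.swap)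
  also have "\<dots> = (\<Sum>j\<in>J. w j ** adj (w j))"
    by (intro sum.cong refl) (simp add: qbasis_right[OF E v] D' M.adj_mem)
  finally show ?thesis .
qed

text \<open>The same exchange of sums, applied to the expansion of \<open>x ** v i\<close> in the
  family \<open>v\<close>.\<close>

lemma qbasis_index_central:
  assumes E: "cond_exp M N E" and v: "qbasis E I v"
  shows "(\<Sum>i\<in>I. v i ** adj (v i)) \<in> center M"
proof -
  note D = qbasisD[OF v]
  have "(\<Sum>i\<in>I. v i ** adj (v i)) ** x = x ** (\<Sum>i\<in>I. v i ** adj (v i))" if x: "x \<in> M" for x
  proof -
    have "x ** (\<Sum>i\<in>I. v i ** adj (v i)) = (\<Sum>i\<in>I. (x ** v i) ** adj (v i))"
      by (simp add: matrix_mult_sum_right matrix_mul_assoc)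
    also have "\<dots> = (\<Sum>i\<in>I. (\<Sum>j\<in>I. v j ** E (adj (v j) ** (x ** v i))) ** adj (v i))"
      by (intro sum.cong refl) (simp only: D(3)[OF M.mult_mem[OF x D(2)]])
    also have "\<dots> = (\<Sum>j\<in>I. v j ** (\<Sum>i\<in>I. E ((adj (v j) ** x) ** v i) ** adj (v i)))"
      by (simp add: matrix_mult_sum_left matrix_mult_sum_right matrix_mul_assoc) (rule sum.swap)
    also have "\<dots> = (\<Sum>j\<in>I. v j ** (adj (v j) ** x))"
      using x by (intro sum.cong refl) (simp add: qbasis_right[OF E v] D M.adj_mem M.mult_mem)
    finally show ?thesis by (simp add: matrix_mult_sum_left matrix_mul_assoc)
  qed
  then show ?thesis
    using D by (auto simp: center_def intro!: M.sum_mem M.mult_mem M.adj_mem)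
qed

lemma quasi_basis_qbasis: "quasi_basis M E us \<Longrightarrow> qbasis E {..<length us} ((!) us)"
  by (auto simp: quasi_basis_def qbasis_def sum_list_sum_nth atLeast0LessThan)

lemma Ind_eq:
  assumes E: "cond_exp M N E" and v: "qbasis E I v"
  shows "Ind M E = (\<Sum>i\<in>I. v i ** adj (v i))"
proof -
  note D = qbasisD[OF v]
  obtain xs where xs: "set xs = I" "distinct xs" using finite_distinct_list D(1) by blast
  have conv: "sum_list (map g (map v xs)) = (\<Sum>i\<in>I. g (v i))" for g :: "'n cmat \<Rightarrow> 'n cmat"
    using xs by (simp add: sum_list_distinct_conv_sum_set o_def)
  have "quasi_basis M E (map v xs)"
    unfolding quasi_basis_def conv using D xs qbasis_right[OF E v] by auto
  then have "\<exists>z us. quasi_basis M E us \<and> z = sum_list (map (\<lambda>u. u ** adj u) us)" by blast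
  then have "\<exists>us. quasi_basis M E us \<and> Ind M E = sum_list (map (\<lambda>u. u ** adj u) us)"
    unfolding Ind_def by (rule someI_ex)
  then obtain us where us: "quasi_basis M E us" "Ind M E = sum_list (map (\<lambda>u. u ** adj u) us)" by blast
  have "Ind M E = (\<Sum>i<length us. us ! i ** adj (us ! i))"
    by (simp add: us(2) sum_list_sum_nth atLeast0LessThan)
  also have "\<dots> = (\<Sum>i\<in>I. v i ** adj (v i))"
    by (rule qbasis_index_unique[OF E quasi_basis_qbasis[OF us(1)] v])
  finally show ?thesis .
qed

definition eframes :: "('n cmat \<Rightarrow> 'n cmat) \<Rightarrow> ('n cmat \<Rightarrow> 'n cmat set) \<Rightarrow> bool" where
  "eframes E U \<longleftrightarrow> (\<forall>q\<in>mcp N. finite (U q) \<and> U q \<subseteq> cols q \<and>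
     (\<forall>x\<in>cols q. x = (\<Sum>w\<in>U q. smult (eform E q w x) w)))"

lemma eframes_exist:
  assumes E: "cond_exp M N E"
  obtains U where "eframes E U"
proof -
  have "\<exists>V. finite V \<and> V \<subseteq> cols q \<and> (\<forall>x\<in>cols q. x = (\<Sum>w\<in>V. smult (eform E q w x) w))"
    if q: "q \<in> mcp N" for q
  proof -
    interpret cform "cols q" "eform E q" by (rule cform_eform[OF E q])
    obtain V where "orthonormal V" "\<And>x. x \<in> cols q \<Longrightarrow> x = (\<Sum>w\<in>V. smult (eform E q w x) w)"
      using frame_exists by blast
    then show ?thesis by (intro exI[of _ V]) (auto simp: orthonormal_def)
  qed
  then have "\<exists>U. \<forall>q\<in>mcp N. finite (U q) \<and> U q \<subseteq> cols q \<and>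
     (\<forall>x\<in>cols q. x = (\<Sum>w\<in>U q. smult (eform E q w x) w))" by (intro bchoice ballI)
  then show thesis using that by (auto simp: eframes_def)
qed

lemma eframesD:
  assumes "eframes E U" "q \<in> mcp N"
  shows "finite (U q)" "w \<in> U q \<Longrightarrow> w \<in> cols q"
    "x \<in> cols q \<Longrightarrow> (\<Sum>w\<in>U q. smult (eform E q w x) w) = x"
  using assms by (auto simp: eframes_def)

text \<open>The frames live on \<open>M f\<close> for a single minimal projection \<open>f\<close>
  under each \<open>q\<close>. The matrix units \<open>g\<close> of \<open>N q\<close> reach the
  rest: expand \<open>x ** g\<close>, pull \<open>g\<close> out of \<open>E\<close> by the bimodule
  property, and sum \<open>g ** adj g\<close> to \<open>q\<close>.\<close>

lemma eframes_qbasis: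
  assumes E: "cond_exp M N E" and U: "eframes E U"
  shows "qbasis E (Sigma (mcp N) U) snd"
proof -
  have exp: "x ** q = (\<Sum>w\<in>U q. w ** E (adj w ** x))" if x: "x \<in> M" and q: "q \<in> mcp N" for x q
  proof -
    note D = eframesD[OF U q]
    obtain G where G: "N.column_frame q (f q) G" by (rule N.column_frame_exists[OF q f[OF q]])
    note GD = N.column_frameD[OF G]
    have wM: "w \<in> M" "w ** f q = w" if "w \<in> U q" for w using D(2)[OF that] by (auto simp: cols_def)
    have "x ** q = (\<Sum>g\<in>G. x ** g ** adj g)"
      by (simp add: GD(5)[symmetric] matrix_mult_sum_right matrix_mul_assoc)
    also have "\<dots> = (\<Sum>g\<in>G. (\<Sum>w\<in>U q. w ** E (adj w ** x) ** g) ** adj g)"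
    proof (intro sum.cong refl arg_cong2[of _ _ _ _ "(**)"])
      fix g assume g: "g \<in> G"
      have gM: "g \<in> M" using GD(2)[OF g] NM by simp
      have xg: "x ** g \<in> cols q"
        using x gM GD(3)[OF g] by (simp add: cols_def M.mult_mem matrix_mul_assoc[symmetric])
      have "x ** g = (\<Sum>w\<in>U q. smult (eform E q w (x ** g)) w)" using D(3)[OF xg] by simp
      also have "\<dots> = (\<Sum>w\<in>U q. w ** E (adj w ** (x ** g)))"
        by (intro sum.cong refl) (simp add: eform_eq[OF E q D(2) xg] wM)
      also have "\<dots> = (\<Sum>w\<in>U q. w ** E (adj w ** x) ** g)"
        using cond_exp_right[OF E _ GD(2)[OF g]] x wM
        by (intro sum.cong refl) (simp add: matrix_mul_assoc M.mult_mem M.adj_mem)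
      finally show "x ** g = (\<Sum>w\<in>U q. w ** E (adj w ** x) ** g)" .
    qed
    also have "\<dots> = (\<Sum>w\<in>U q. w ** E (adj w ** x) ** (\<Sum>g\<in>G. g ** adj g))"
      by (simp add: matrix_mult_sum_left matrix_mult_sum_right matrix_mul_assoc) (rule sum.swap)
    also have "\<dots> = (\<Sum>w\<in>U q. w ** E (adj w ** x))"
    proof (intro sum.cong refl)
      fix w assume w: "w \<in> U q"
      have "E (adj w ** x) \<in> N"
        using cond_expD(2)[OF E] wM[OF w] x by (simp add: M.mult_mem M.adj_mem)
      then have "w ** E (adj w ** x) ** q = w ** q ** E (adj w ** x)"
        using N.mcp_comm[OF q, of "E (adj w ** x)"] by (simp add: matrix_mul_assoc[symmetric])
      also have "w ** q = w" by (metis wM(2)[OF w] fD(9)[OF q] matrix_mul_assoc)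
      finally show "w ** E (adj w ** x) ** (\<Sum>g\<in>G. g ** adj g) = w ** E (adj w ** x)"
        by (simp add: GD(5))
    qed
    finally show ?thesis .
  qed
  have "x = (\<Sum>i\<in>Sigma (mcp N) U. snd i ** E (adj (snd i) ** x))" if x: "x \<in> M" for x
  proof -
    have "x = (\<Sum>q\<in>mcp N. x ** q)"
      using x by (simp add: matrix_mult_sum_right[symmetric] N.mcp_sum M.unit_right)
    also have "\<dots> = (\<Sum>q\<in>mcp N. \<Sum>w\<in>U q. w ** E (adj w ** x))"
      by (intro sum.cong refl exp x)
    also have "\<dots> = (\<Sum>i\<in>Sigma (mcp N) U. snd i ** E (adj (snd i) ** x))"
      by (subst sum.Sigma) (auto simp: N.mcp_finite eframesD[OF U] case_prod_beta)
    finally show ?thesis .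
  qed
  then show ?thesis
    using eframesD[OF U] N.mcp_finite by (auto simp: qbasis_def cols_def)
qed

lemma Ind_eframes:
  assumes E: "cond_exp M N E" and U: "eframes E U"
  shows "Ind M E = (\<Sum>q\<in>mcp N. \<Sum>w\<in>U q. w ** adj w)" "Ind M E \<in> center M"
proof -
  note eq = Ind_eq[OF E eframes_qbasis[OF E U]]
  show "Ind M E = (\<Sum>q\<in>mcp N. \<Sum>w\<in>U q. w ** adj w)"
    unfolding eq by (subst sum.Sigma) (auto simp: N.mcp_finite eframesD[OF U] case_prod_beta)
  show "Ind M E \<in> center M"
    unfolding eq by (rule qbasis_index_central[OF E eframes_qbasis[OF E U]])
qed

end

section \<open>Trace-preserving expectations and the minimal index\<close>

lemma norm_vector_scalar_mult: "norm (c *s (v :: complex^'n)) = cmod c * norm v"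
  by (simp add: norm_vec_def norm_mult L2_set_right_distrib)

lemma smult_mult_vec: "smult c A *v v = c *s (A *v v)"
  by (simp add: smult_def matrix_vector_mult_def vec_eq_iff sum_distrib_left mult.assoc)

lemma inner_adj: "inner (A *v x) y = inner x (adj A *v (y :: complex^'n::finite))"
proof -
  have i: "inner v w = Re (\<Sum>i\<in>UNIV. cnj (v $ i) * w $ i)" for v w :: "complex^'n"
    by (simp add: inner_vec_def inner_complex_def)
  have "(\<Sum>i\<in>UNIV. cnj ((A *v x) $ i) * y $ i) = (\<Sum>i\<in>UNIV. cnj (x $ i) * (adj A *v y) $ i)"
    unfolding matrix_vector_mult_def adj_def
    by (simp add: sum_distrib_left sum_distrib_right mult_ac) (rule sum.swap)
  then show ?thesis by (simp only: i)
qed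

lemma bounded_linear_mult_vec: "bounded_linear (\<lambda>v::complex^'n::finite. A *v v)"
proof (intro linear_conv_bounded_linear[THEN iffD1] linearI)
  fix r and v :: "complex^'n"
  show "A *v r *\<^sub>R v = r *\<^sub>R (A *v v)"
    by (simp add: vec_eq_iff matrix_vector_mult_def scaleR_sum_right)
qed (rule matrix_vector_right_distrib)

lemma norm_mult_vec_le: "norm (A *v v) \<le> mnorm A * norm (v :: complex^'n::finite)"
  unfolding mnorm_def by (rule onorm[OF bounded_linear_mult_vec])

lemma mnorm_ge_scalar:
  assumes "z ** p = smult c p" "p \<noteq> 0"
  shows "cmod c \<le> mnorm z"
proof -
  obtain v where v: "p *v v \<noteq> 0"
    using assms(2) by (metis matrix_eq matrix_vector_mult_0)
  have "z *v (p *v v) = c *s (p *v v)"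
    by (simp add: matrix_vector_mul_assoc assms(1) smult_mult_vec)
  then have "cmod c * norm (p *v v) \<le> mnorm z * norm (p *v v)"
    using norm_mult_vec_le[of z "p *v v"] by (simp add: norm_vector_scalar_mult)
  then show ?thesis using v by simp
qed

lemma mnorm_smult_proj:
  assumes "is_proj p" "p \<noteq> 0"
  shows "mnorm (smult c p) = cmod c"
proof (rule antisym)
  have contr: "norm (p *v v) \<le> norm v" for v
  proof -
    have "(norm (p *v v))\<^sup>2 = inner v (p *v v)"
      by (simp add: power2_norm_eq_inner inner_adj is_projD[OF assms(1)] matrix_vector_mul_assoc)
    also have "\<dots> \<le> norm v * norm (p *v v)" by (rule norm_cauchy_schwarz)
    finally show ?thesis by (cases "p *v v = 0") (simp_all add: power2_eq_square)
  qed
  show "mnorm (smult c p) \<le> cmod c"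
    unfolding mnorm_def
    by (intro onorm_le)
       (simp add: smult_mult_vec norm_vector_scalar_mult mult_left_mono contr)
  show "cmod c \<le> mnorm (smult c p)"
    using assms by (intro mnorm_ge_scalar[of _ p]) (simp_all add: is_projD)
qed

lemma cform_subset:
  assumes "cform W a" "W' \<subseteq> W" "0 \<in> W'" "\<And>x y. x \<in> W' \<Longrightarrow> y \<in> W' \<Longrightarrow> x + y \<in> W'"
    "\<And>x c. x \<in> W' \<Longrightarrow> smult c x \<in> W'"
  shows "cform W' a"
proof -
  interpret cform W a by fact
  show ?thesis
    using assms(2-5) by unfold_locales (auto simp: subset_iff a_add a_smult a_pos intro: a_cnj)
qed

locale traced_inclusion = inclusion N M u for N M :: "('n::finite) cmat set" and u +
  fixes \<tau> :: "'n cmat \<Rightarrow> complex"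
  assumes tau: "tracial_state M u \<tau>"
begin

lemmas tauD = M.tracial_stateD[OF tau]
lemmas tau_sum = M.tracial_state_sum[OF tau]

lemma tau_diff: "x \<in> M \<Longrightarrow> y \<in> M \<Longrightarrow> \<tau> (x - y) = \<tau> x - \<tau> y"
  using tauD(2)[of "x - y" y] M.diff_mem by (simp add: algebra_simps)

lemma tau_zero: "\<tau> 0 = 0"
  using tauD(4)[OF M.zero_mem, of 0] by simp

definition s :: "'n cmat \<Rightarrow> real" where "s p = Re (\<tau> (e p))"
definition t :: "'n cmat \<Rightarrow> real" where "t q = Re (\<tau> (f q))"

lemma tau_e: "p \<in> mcp M \<Longrightarrow> \<tau> (e p) = of_real (s p)" and s_pos: "p \<in> mcp M \<Longrightarrow> 0 < s p"
  unfolding s_def using M.tracial_state_minproj[OF tau e(1)] by blast+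

lemma tau_restrict: "tracial_state N u (\<lambda>x. if x \<in> N then \<tau> x else 0)"
  unfolding tracial_state_def
proof (intro conjI allI ballI impI)
  fix x y assume x: "x \<in> N" and y: "y \<in> N"
  show "(if x + y \<in> N then \<tau> (x + y) else 0) = (if x \<in> N then \<tau> x else 0) + (if y \<in> N then \<tau> y else 0)"
    using x y tauD(2)[OF NM NM] by (simp add: N.add_mem)
  show "(if x ** y \<in> N then \<tau> (x ** y) else 0) = (if y ** x \<in> N then \<tau> (y ** x) else 0)"
    using tauD(3)[OF NM[OF x] NM[OF y]] x y by (simp add: N.mult_mem)
next
  fix c x assume x: "x \<in> N"
  show "(if smult c x \<in> N then \<tau> (smult c x) else 0) = c * (if x \<in> N then \<tau> x else 0)"
    using x tauD(4)[OF NM[OF x]] by (simp add: N.smult_mem)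
next
  fix x assume x: "x \<in> N"
  have xx: "adj x ** x \<in> N" using x by (intro N.mult_mem N.adj_mem)
  show "(if adj x ** x \<in> N then \<tau> (adj x ** x) else 0) \<in> \<real>"
    "0 \<le> Re (if adj x ** x \<in> N then \<tau> (adj x ** x) else 0)"
    using tauD(5,6)[OF NM[OF x]] xx by simp_all
  assume "(if adj x ** x \<in> N then \<tau> (adj x ** x) else 0) = 0"
  then show "x = 0" using tauD(7)[OF NM[OF x]] xx by simp
qed (simp_all add: N.unit_mem tauD(8))

lemma
  assumes q: "q \<in> mcp N"
  shows tau_f: "\<tau> (f q) = of_real (t q)" and t_pos: "0 < t q"
  using N.tracial_state_minproj[OF tau_restrict f(1)[OF q], unfolded if_P[OF fD(1)[OF q]]]
  unfolding t_def by blast+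

lemma tau_mcp: "q \<in> mcp N \<Longrightarrow> \<tau> q = of_real (ssize N q * t q)"
  using N.tracial_state_mcp[OF tau_restrict, of q] N.mcpD(1)[of q] fD(1)[of q]
  by (simp add: t_def)

lemma tau_mcp': "p \<in> mcp M \<Longrightarrow> \<tau> p = of_real (ssize M p * s p)"
  using M.tracial_state_mcp[OF tau] by (simp add: s_def)

lemma tau_fp:
  assumes p: "p \<in> mcp M" and q: "q \<in> mcp N"
  shows "\<tau> (f q ** p) = of_real (Lam N M p q * s p)"
  using M.tracial_state_block[OF tau p e[OF p] fD(2)[OF q]] mtrace_Lam[OF p q]
    M.minprojD(7)[OF e(1)[OF p]] by (simp add: tau_e[OF p])

lemma t_eq:
  assumes q: "q \<in> mcp N"
  shows "t q = (\<Sum>p\<in>mcp M. Lam N M p q * s p)"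
proof -
  have "of_real (t q) = \<tau> (\<Sum>p\<in>mcp M. f q ** p)"
    using M.mcp_decomp[OF fD(2)[OF q]] tau_f[OF q] by simp
  also have "\<dots> = (\<Sum>p\<in>mcp M. \<tau> (f q ** p))"
    using q by (intro tau_sum M.mult_mem M.mcpD fD)
  also have "\<dots> = of_real (\<Sum>p\<in>mcp M. Lam N M p q * s p)" using tau_fp q by simp
  finally show ?thesis by (simp only: of_real_eq_iff)
qed

lemma trace_determines:
  assumes y: "y \<in> N" "y' \<in> N" and eq: "\<And>n. n \<in> N \<Longrightarrow> \<tau> (n ** y) = \<tau> (n ** y')"
  shows "y = y'"
proof -
  have z: "y - y' \<in> N" using y by (rule N.diff_mem)
  then have a: "adj (y - y') \<in> N" by (rule N.adj_mem)
  have "\<tau> (adj (y - y') ** (y - y')) = \<tau> (adj (y - y') ** y) - \<tau> (adj (y - y') ** y')"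
    unfolding matrix_diff_ldistrib using a y by (intro tau_diff NM N.mult_mem)
  also have "\<dots> = 0" using eq[OF a] by simp
  finally show ?thesis using tauD(7)[OF NM[OF z]] by simp
qed

lemma trace_preserving_unique:
  assumes E: "cond_exp M N E" "\<And>x. x \<in> M \<Longrightarrow> \<tau> (E x) = \<tau> x"
    and E': "cond_exp M N E'" "\<And>x. x \<in> M \<Longrightarrow> \<tau> (E' x) = \<tau> x"
  shows "E = E'"
proof
  fix x
  show "E x = E' x"
  proof (cases "x \<in> M")
    case True
    have "\<tau> (n ** E x) = \<tau> (n ** E' x)" if "n \<in> N" for n
      using E(2)[of "n ** x"] E'(2)[of "n ** x"] cond_exp_left[OF E(1) True that]
        cond_exp_left[OF E'(1) True that] M.mult_mem[OF NM[OF that] True] by simp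
    then show ?thesis using cond_expD(2)[OF E(1) True] cond_expD(2)[OF E'(1) True]
      by (intro trace_determines)
  qed (simp add: cond_expD(1)[OF E(1)] cond_expD(1)[OF E'(1)])
qed

lemma cform_tau: "cform M (\<lambda>x y. \<tau> (adj x ** y))"
proof
  fix x y
  assume x: "x \<in> M"
  { assume "x \<noteq> 0"
    then have "\<tau> (adj x ** x) \<noteq> 0" using tauD(7)[OF x] by blast
    moreover have "\<tau> (adj x ** x) = of_real (Re (\<tau> (adj x ** x)))" using tauD(5)[OF x] by simp
    ultimately have "Re (\<tau> (adj x ** x)) \<noteq> 0" by (metis of_real_0)
    then show "0 < Re (\<tau> (adj x ** x))" using tauD(6)[OF x] by simp }
  assume y: "y \<in> M"
  have "\<tau> (adj (adj x ** y)) = cnj (\<tau> (adj x ** y))"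
    using x y by (intro M.tracial_state_adj[OF tau] M.mult_mem M.adj_mem)
  then show "\<tau> (adj y ** x) = cnj (\<tau> (adj x ** y))" by (simp add: adj_mult)
qed (simp_all add: M.zero_mem M.add_mem M.smult_mem M.mult_mem M.adj_mem tauD(2,4) matrix_add_ldistrib)

text \<open>The expectation is the orthogonal projection \<open>g\<close> of \<open>M\<close> onto
  \<open>N\<close> for the form \<open>\<tau> (adj x ** y)\<close>. The pairing identity
  \<open>char\<close> with \<open>trace_determines\<close> yields the adjoint and bimodule
  properties.\<close>

lemma trace_preserving_exists:
  obtains E where "cond_exp M N E" "\<And>x. x \<in> M \<Longrightarrow> \<tau> (E x) = \<tau> x"
proof -
  interpret cform N "\<lambda>x y. \<tau> (adj x ** y)"
    by (rule cform_subset[OF cform_tau sub]) (auto simp: N.zero_mem N.add_mem N.smult_mem)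
  obtain B where B: "orthonormal B" and exp: "\<And>x. x \<in> N \<Longrightarrow> x = (\<Sum>b\<in>B. smult (\<tau> (adj b ** x)) b)"
    using frame_exists by blast
  have BN: "b \<in> N" "b \<in> M" "adj b \<in> M" if "b \<in> B" for b
    using B that NM M.adj_mem by (auto simp: orthonormal_def)
  define g where "g x = (\<Sum>b\<in>B. smult (\<tau> (adj b ** x)) b)" for x
  have gN: "g x \<in> N" for x unfolding g_def using BN by (intro N.sum_mem N.smult_mem)
  have gM: "g x \<in> M" for x using gN NM by blast
  have char: "\<tau> (n ** g x) = \<tau> (n ** x)" if n: "n \<in> N" and x: "x \<in> M" for n x
  proof -
    have nM: "n \<in> M" using n NM by blast
    have c: "cnj (\<tau> (adj b ** adj n)) = \<tau> (n ** b)" if "b \<in> B" for b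
      using M.tracial_state_adj[OF tau, of "n ** b"] BN[OF that] nM by (simp add: adj_mult M.mult_mem)
    \<comment> \<open>Expanding \<open>adj n\<close> instead of \<open>n\<close> yields
      \<open>n\<close> in terms of the \<open>adj b\<close>, with coefficients
      \<open>\<tau> (n ** b)\<close>, which is how the frame occurs in \<open>g\<close>.\<close>
    have "adj n = (\<Sum>b\<in>B. smult (\<tau> (adj b ** adj n)) b)" by (rule exp[OF N.adj_mem[OF n]])
    then have "adj (adj n) = (\<Sum>b\<in>B. smult (cnj (\<tau> (adj b ** adj n))) (adj b))"
      by (metis (no_types, lifting) adj_smult adj_sum sum.cong)
    then have "n = (\<Sum>b\<in>B. smult (\<tau> (n ** b)) (adj b))" by (simp add: c)
    then have "\<tau> (n ** x) = \<tau> ((\<Sum>b\<in>B. smult (\<tau> (n ** b)) (adj b)) ** x)" by (rule arg_cong)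
    also have "\<dots> = (\<Sum>b\<in>B. \<tau> (n ** b) * \<tau> (adj b ** x))"
      using BN x by (simp add: matrix_mult_sum_left tau_sum tauD(4) M.mult_mem M.smult_mem)
    also have "\<dots> = \<tau> (n ** g x)"
      using BN nM by (simp add: g_def matrix_mult_sum_right tau_sum tauD(4) M.mult_mem M.smult_mem mult.commute)
    finally show ?thesis by simp
  qed
  have g_adj: "g (adj x) = adj (g x)" if x: "x \<in> M" for x
  proof (rule trace_determines[OF gN N.adj_mem[OF gN]])
    fix n assume n: "n \<in> N"
    have nM: "n \<in> M" "adj n \<in> M" using n NM N.adj_mem by auto
    have "\<tau> (n ** adj (g x)) = cnj (\<tau> (g x ** adj n))"
      using M.tracial_state_adj[OF tau, of "g x ** adj n"] nM gM by (simp add: adj_mult M.mult_mem)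
    also have "\<tau> (g x ** adj n) = \<tau> (adj n ** g x)" by (intro tauD(3) gM nM)
    also have "\<dots> = \<tau> (adj n ** x)" by (intro char N.adj_mem n x)
    also have "cnj \<dots> = \<tau> (adj x ** n)"
      using M.tracial_state_adj[OF tau, of "adj n ** x"] nM x by (simp add: adj_mult M.mult_mem)
    also have "\<dots> = \<tau> (n ** adj x)" by (intro tauD(3) M.adj_mem nM x)
    finally show "\<tau> (n ** g (adj x)) = \<tau> (n ** adj (g x))"
      using char[OF n M.adj_mem[OF x]] by simp
  qed
  have g_bimod: "g (b ** x ** b') = b ** g x ** b'" if b: "b \<in> N" "b' \<in> N" and x: "x \<in> M" for b b' x
  proof (rule trace_determines[OF gN])
    show "b ** g x ** b' \<in> N" by (intro N.mult_mem gN b)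
    fix n assume n: "n \<in> N"
    have mem: "n \<in> M" "b \<in> M" "b' \<in> M" using n b NM by auto
    have "\<tau> (n ** (b ** g x ** b')) = \<tau> ((n ** b ** g x) ** b')" by (simp add: matrix_mul_assoc)
    also have "\<dots> = \<tau> (b' ** (n ** b ** g x))" by (intro tauD(3) M.mult_mem mem gM)
    also have "\<dots> = \<tau> ((b' ** n ** b) ** g x)" by (simp add: matrix_mul_assoc)
    also have "\<dots> = \<tau> ((b' ** n ** b) ** x)" by (intro char N.mult_mem b n x)
    also have "\<dots> = \<tau> (b' ** (n ** b ** x))" by (simp add: matrix_mul_assoc)
    also have "\<dots> = \<tau> ((n ** b ** x) ** b')" by (intro tauD(3) M.mult_mem mem x)
    also have "\<dots> = \<tau> (n ** g (b ** x ** b'))"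
      using char[OF n, of "b ** x ** b'"] mem x by (simp add: matrix_mul_assoc M.mult_mem)
    finally show "\<tau> (n ** g (b ** x ** b')) = \<tau> (n ** (b ** g x ** b'))" by simp
  qed
  have g_pos: "psd (g (adj x ** x))" if x: "x \<in> M" for x
  proof -
    let ?X = "g (adj x ** x)"
    have xx: "adj x ** x \<in> M" using x by (intro M.mult_mem M.adj_mem)
    have "\<exists>y\<in>N. adj y = y \<and> ?X = y ** y \<and> u ** y = y \<and> y ** u = y"
    proof (rule N.positive_sqrt[OF N.unit_mem N.unit_proj gN])
      show "adj ?X = ?X" using g_adj[OF xx] by (simp add: adj_mult)
      show "u ** ?X = ?X" "?X ** u = ?X" using gN by (simp_all add: N.unit_left N.unit_right)
      \<comment> \<open>The trace tests the sign of an eigenvalue: \<open>l * \<tau> r\<close>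
        equals \<open>\<tau> (adj (x ** r) ** (x ** r))\<close>, and \<open>\<tau> r\<close> is
        positive.\<close>
      fix r l assume r: "r \<in> N" "is_proj r" "r \<noteq> 0" and l: "?X ** r = smult (of_real l) r"
      have rM: "r \<in> M" using r NM by blast
      have "of_real l * \<tau> r = \<tau> (?X ** r)" by (simp add: l tauD(4)[OF rM])
      also have "\<dots> = \<tau> (r ** ?X)" by (intro tauD(3) gM rM)
      also have "\<dots> = \<tau> (r ** (adj x ** x))" by (rule char[OF r(1) xx])
      also have "\<dots> = \<tau> ((r ** adj x ** x) ** r)"
      proof -
        have "\<tau> ((r ** adj x ** x) ** r) = \<tau> (r ** (r ** adj x ** x))"
          by (intro tauD(3) M.mult_mem M.adj_mem rM x)
        then show ?thesis by (simp add: matrix_mul_assoc is_projD[OF r(2)])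
      qed
      also have "\<dots> = \<tau> (adj (x ** r) ** (x ** r))"
        by (simp add: adj_mult is_projD[OF r(2)] matrix_mul_assoc)
      finally have 1: "of_real l * \<tau> r = \<tau> (adj (x ** r) ** (x ** r))" .
      have rr: "\<tau> r = \<tau> (adj r ** r)" by (simp add: is_projD[OF r(2)])
      have pos: "0 < Re (\<tau> (adj r ** r))" using cform.a_pos[OF cform_tau rM r(3)] .
      have "Re (of_real l * \<tau> r) = l * Re (\<tau> r)" by simp
      then have "0 \<le> l * Re (\<tau> r)"
        using 1 tauD(6)[OF M.mult_mem[OF x rM]] by simp
      then show "0 \<le> l" using pos rr by (simp add: zero_le_mult_iff)
    qed
    then show ?thesis by (metis psd_def)
  qed
  have g_faithful: "x = 0" if x: "x \<in> M" and 0: "g (adj x ** x) = 0" for x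
  proof -
    have xx: "adj x ** x \<in> M" using x by (intro M.mult_mem M.adj_mem)
    have "\<tau> (adj x ** x) = \<tau> (u ** g (adj x ** x))"
      using char[OF N.unit_mem xx] xx by (simp add: M.unit_left)
    then show ?thesis using tauD(7)[OF x] 0 by (simp add: tau_zero)
  qed
  define E where "E x = (if x \<in> M then g x else 0)" for x
  have "cond_exp M N E"
    unfolding cond_exp_def
  proof (intro conjI allI ballI impI)
    fix x y assume x: "x \<in> M" and y: "y \<in> M"
    show "E (x + y) = E x + E y"
      using BN x y by (simp add: E_def g_def M.add_mem matrix_add_ldistrib tauD(2) M.mult_mem
          smult_add_left sum.distrib)
  next
    fix c x assume x: "x \<in> M"
    show "E (smult c x) = smult c (E x)"
      using BN x by (simp add: E_def g_def M.smult_mem tauD(4) M.mult_mem smult_sum)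
  next
    fix x b b' assume "x \<in> M" "b \<in> N" "b' \<in> N"
    then show "E (b ** x ** b') = b ** E x ** b'"
      using g_bimod by (simp add: E_def M.mult_mem NM)
  next
    fix b assume "b \<in> N"
    then show "E b = b" using exp[of b] NM by (simp add: E_def g_def)
  qed (use gN g_pos g_faithful in \<open>simp_all add: E_def M.mult_mem M.adj_mem\<close>)
  moreover have "\<tau> (E x) = \<tau> x" if "x \<in> M" for x
    using char[OF N.unit_mem that] gM that by (simp add: E_def M.unit_left)
  ultimately show thesis by (rule that)
qed

end

lemma sum_const_smult: "(\<Sum>i\<in>I. X) = smult (of_nat (card I)) X"
  by (induction I rule: infinite_finite_induct) (simp_all add: smult_add_left del: sum_constant)

section \<open>Frames of the blocks \<open>p M f\<close>\<close>

context traced_inclusion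
begin

text \<open>The division by \<open>t q\<close>, the value of \<open>\<tau>\<close> on
  \<open>f q\<close>, makes this agree with \<open>eform E q\<close> on \<open>cols q\<close>
  whenever \<open>E\<close> preserves \<open>\<tau>\<close>.\<close>

definition tform :: "'n cmat \<Rightarrow> 'n cmat \<Rightarrow> 'n cmat \<Rightarrow> complex" where
  "tform q x y = \<tau> (adj x ** y) / of_real (t q)"

definition pcols :: "'n cmat \<Rightarrow> 'n cmat \<Rightarrow> 'n cmat set" where
  "pcols p q = {x \<in> cols q. p ** x = x}"

lemma pcolsD:
  assumes "x \<in> pcols p q"
  shows "x \<in> M" "x \<in> cols q" "x ** f q = x" "p ** x = x"
  using assms by (auto simp: pcols_def cols_def)

lemma pcols_subspace:
  "0 \<in> pcols p q" "x \<in> pcols p q \<Longrightarrow> y \<in> pcols p q \<Longrightarrow> x + y \<in> pcols p q"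
  "x \<in> pcols p q \<Longrightarrow> smult c x \<in> pcols p q"
  by (auto simp: pcols_def cols_def M.zero_mem M.add_mem M.smult_mem matrix_add_ldistrib matrix_add_rdistrib)

lemma cform_eform_pcols:
  assumes "cond_exp M N E" "q \<in> mcp N"
  shows "cform (pcols p q) (eform E q)"
  by (rule cform_subset[OF cform_eform[OF assms]]) (auto simp: pcols_subspace, auto simp: pcols_def)

lemma cform_tform:
  assumes q: "q \<in> mcp N"
  shows "cform (pcols p q) (tform q)"
proof -
  interpret cform "pcols p q" "\<lambda>x y. \<tau> (adj x ** y)"
    by (rule cform_subset[OF cform_tau]) (auto simp: pcols_subspace intro: pcolsD)
  show ?thesis
    using t_pos[OF q]
    by unfold_locales
       (auto simp: tform_def pcols_subspace a_add a_smult a_pos add_divide_distrib a_cnj[symmetric] Re_divide_of_real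
         tauD(4) M.mult_mem M.adj_mem pcolsD(1)[of _ p q])
qed

lemma eform_trace_preserving:
  assumes E: "cond_exp M N E" and q: "q \<in> mcp N" and x: "x \<in> cols q" and y: "y \<in> cols q"
  shows "\<tau> (E (adj x ** y)) = of_real (t q) * eform E q x y"
  unfolding eform_eq[OF E q x y] by (simp add: tauD(4)[OF fD(2)[OF q]] tau_f[OF q])

text \<open>Pairing \<open>v ** adj w ** f q\<close> with \<open>x\<close> gives
  \<open>s p / t q\<close> times a matrix coefficient of \<open>x\<close>; the square of the
  normalising factor must be the reciprocal.\<close>

definition kap :: "'n cmat \<Rightarrow> 'n cmat \<Rightarrow> real" where
  "kap p q = sqrt (t q / s p)"

text \<open>All matrix units of \<open>M p\<close> cut by \<open>f q\<close>. The family is in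
  general redundant, but it avoids diagonalising \<open>f q ** p\<close> and its sums can be
  computed.\<close>

definition cframe :: "'n cmat \<Rightarrow> 'n cmat \<Rightarrow> 'n cmat \<times> 'n cmat \<Rightarrow> 'n cmat" where
  "cframe p q = (\<lambda>(v, w). smult (of_real (kap p q)) (v ** adj w ** f q))"

lemma kap_sq: "p \<in> mcp M \<Longrightarrow> q \<in> mcp N \<Longrightarrow> kap p q * kap p q = t q / s p"
  using s_pos[of p] t_pos[of q] by (simp add: kap_def)

context
  fixes p q F
  assumes p: "p \<in> mcp M" and q: "q \<in> mcp N" and F: "M.column_frame p (e p) F"
begin

lemmas FD = M.column_frameD[OF F]

lemma F_left: "w \<in> F \<Longrightarrow> p ** w = w"
proof -
  assume w: "w \<in> F"
  have "w ** e p = w" by (rule FD(3)[OF w])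
  moreover have "p ** w = w ** p" by (rule M.mcp_comm[OF p FD(2)[OF w]])
  ultimately show ?thesis using e(2)[OF p] by (metis matrix_mul_assoc)
qed

lemma cframe_mem: "vw \<in> F \<times> F \<Longrightarrow> cframe p q vw \<in> pcols p q"
proof -
  assume "vw \<in> F \<times> F"
  then obtain v w where vw: "vw = (v, w)" "v \<in> F" "w \<in> F" by auto
  have "p ** (v ** adj w ** f q) = v ** adj w ** f q"
    using F_left[OF vw(2)] by (simp add: matrix_mul_assoc)
  moreover have "v ** adj w ** f q ** f q = v ** adj w ** f q"
    by (simp add: matrix_mul_assoc[symmetric] fD(5)[OF q])
  ultimately show ?thesis
    using FD(2) vw fD(2)[OF q]
    by (simp add: cframe_def pcols_def cols_def M.smult_mem M.mult_mem M.adj_mem)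
qed

lemma cframe_expand:
  assumes x: "x \<in> pcols p q"
  shows "(\<Sum>vw\<in>F \<times> F. smult (tform q (cframe p q vw) x) (cframe p q vw)) = x"
proof -
  note xD = pcolsD[OF x]
  let ?c = "\<lambda>v w. rscalar (e p) (adj v ** x ** w)"
  have coef: "smult (tform q (cframe p q (v, w)) x) (cframe p q (v, w)) = smult (?c v w) (v ** adj w) ** f q"
    if vw: "v \<in> F" "w \<in> F" for v w
  proof -
    have vwM: "v \<in> M" "w \<in> M" "adj v \<in> M" "adj w \<in> M" using FD(2) vw M.adj_mem by auto
    have ev: "e p ** adj v = adj v"
      using FD(3)[OF vw(1)] M.minprojD(5)[OF e(1)[OF p]] by (metis adj_mult)
    have sc: "adj v ** x ** w = smult (?c v w) (e p)"
      using ev FD(3)[OF vw(2)] vwM xD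
      by (intro M.minproj_compress[OF e(1)[OF p]] M.mult_mem)
         (auto simp: matrix_mul_assoc, simp add: matrix_mul_assoc[symmetric])
    have "\<tau> (adj (v ** adj w ** f q) ** x) = \<tau> (f q ** (w ** adj v ** x))"
      by (simp add: adj_mult fD(6)[OF q] matrix_mul_assoc)
    also have "\<dots> = \<tau> ((w ** adj v ** x) ** f q)"
      by (intro tauD(3) M.mult_mem vwM xD fD(2)[OF q])
    also have "\<dots> = \<tau> (w ** (adj v ** x))"
      using xD by (simp add: matrix_mul_assoc[symmetric])
    also have "\<dots> = \<tau> ((adj v ** x) ** w)"
      by (intro tauD(3) M.mult_mem vwM xD)
    also have "\<dots> = \<tau> (smult (?c v w) (e p))" by (rule arg_cong[OF sc])
    also have "\<dots> = ?c v w * of_real (s p)"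
      by (simp only: tauD(4)[OF M.minprojD(1)[OF e(1)[OF p]]] tau_e[OF p])
    finally have tr: "\<tau> (adj (v ** adj w ** f q) ** x) = ?c v w * of_real (s p)" .
    have mem: "adj (v ** adj w ** f q) ** x \<in> M"
      by (intro M.mult_mem M.adj_mem vwM xD fD(2)[OF q])
    have tf: "tform q (cframe p q (v, w)) x = of_real (kap p q * s p / t q) * ?c v w"
      by (simp add: tform_def cframe_def adj_smult tauD(4)[OF mem] tr)
    have "kap p q * s p / t q * kap p q = 1"
      using kap_sq[OF p q] s_pos[OF p] t_pos[OF q] by (simp add: field_simps)
    then have one: "complex_of_real (kap p q * s p / t q) * of_real (kap p q) = 1"
      by (simp only: of_real_mult[symmetric] of_real_1)
    have "tform q (cframe p q (v, w)) x * of_real (kap p q)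
        = ?c v w * (of_real (kap p q * s p / t q) * of_real (kap p q))"
      unfolding tf by (simp only: mult_ac)
    then have "tform q (cframe p q (v, w)) x * of_real (kap p q) = ?c v w"
      unfolding one by simp
    then show ?thesis by (simp add: cframe_def)
  qed
  have "(\<Sum>vw\<in>F \<times> F. smult (tform q (cframe p q vw) x) (cframe p q vw))
      = (\<Sum>v\<in>F. \<Sum>w\<in>F. smult (tform q (cframe p q (v, w)) x) (cframe p q (v, w)))"
    by (simp add: sum.cartesian_product)
  also have "\<dots> = (\<Sum>v\<in>F. \<Sum>w\<in>F. smult (?c v w) (v ** adj w) ** f q)"
    by (intro sum.cong refl coef)
  also have "\<dots> = (\<Sum>v\<in>F. \<Sum>w\<in>F. smult (?c v w) (v ** adj w)) ** f q"
    by (simp only: matrix_mult_sum_left)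
  also have "\<dots> = x ** p ** f q"
    by (simp only: M.column_frame_expand[OF F p e(1)[OF p] xD(1)])
  also have "\<dots> = x"
    using M.mcp_comm[OF p xD(1)] xD by simp
  finally show ?thesis .
qed

text \<open>The point of the explicit frame: the sum is a multiple of the single element
  \<open>f q ** p\<close>, so both \<open>\<tau>\<close> and any \<open>E\<close> can be evaluated
  on it.\<close>

lemma cframe_sum:
  "(\<Sum>vw\<in>F \<times> F. adj (cframe p q vw) ** cframe p q vw)
     = smult (of_real (t q / s p * ssize M p)) (f q ** p)"
proof -
  have "adj (cframe p q (v, w)) ** cframe p q (v, w)
      = smult (of_real (t q / s p)) (f q ** (w ** adj w) ** f q)" if vw: "v \<in> F" "w \<in> F" for v w
  proof -
    have "adj (v ** adj w ** f q) ** (v ** adj w ** f q) = f q ** (w ** (adj v ** v) ** adj w) ** f q"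
      by (simp add: adj_mult fD(6)[OF q] matrix_mul_assoc)
    also have "adj v ** v = e p" using FD(4)[OF vw(1,1)] by simp
    also have "w ** e p = w" by (rule FD(3)[OF vw(2)])
    finally show ?thesis
      by (simp add: cframe_def adj_smult kap_sq[OF p q] flip: of_real_mult)
  qed
  note blk = this
  have "(\<Sum>vw\<in>F \<times> F. adj (cframe p q vw) ** cframe p q vw)
      = (\<Sum>v\<in>F. \<Sum>w\<in>F. adj (cframe p q (v, w)) ** cframe p q (v, w))"
    by (simp add: sum.cartesian_product)
  also have "\<dots> = (\<Sum>v\<in>F. \<Sum>w\<in>F. smult (of_real (t q / s p)) (f q ** (w ** adj w) ** f q))"
    by (intro sum.cong refl blk)
  also have "\<dots> = smult (of_nat (card F) * of_real (t q / s p)) (\<Sum>w\<in>F. f q ** (w ** adj w) ** f q)"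
    by (simp only: smult_sum[symmetric] sum_const_smult smult_smult mult.commute)
  also have "(\<Sum>w\<in>F. f q ** (w ** adj w) ** f q) = f q ** p ** f q"
    by (simp only: matrix_mult_sum_left[symmetric] matrix_mult_sum_right[symmetric] FD(5))
  also have "\<dots> = f q ** p"
    using f_mcp[OF p q] fD(5)[OF q] by (metis matrix_mul_assoc)
  finally show ?thesis
    by (simp add: M.ssize_card[OF F p e(1)[OF p]] mult.commute)
qed

text \<open>A frame sum in the frame's own form, hence the complex dimension of the block
  \<open>p M f\<close>.\<close>

lemma cframe_tform_sum:
  "(\<Sum>vw\<in>F \<times> F. Re (tform q (cframe p q vw) (cframe p q vw))) = ssize M p * Lam N M p q"
proof -
  have mem: "cframe p q vw \<in> M" if "vw \<in> F \<times> F" for vw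
    using cframe_mem[OF that] by (rule pcolsD)
  have fpM: "f q ** p \<in> M" by (intro M.mult_mem fD(2)[OF q] M.mcpD(1)[OF p])
  have "(\<Sum>vw\<in>F \<times> F. \<tau> (adj (cframe p q vw) ** cframe p q vw))
      = \<tau> (\<Sum>vw\<in>F \<times> F. adj (cframe p q vw) ** cframe p q vw)"
    by (intro tau_sum[symmetric] M.mult_mem M.adj_mem mem)
  also have "\<dots> = of_real (t q / s p * ssize M p * (Lam N M p q * s p))"
    unfolding cframe_sum by (simp add: tauD(4)[OF fpM] tau_fp[OF p q])
  finally have "(\<Sum>vw\<in>F \<times> F. tform q (cframe p q vw) (cframe p q vw))
      = of_real (t q / s p * ssize M p * (Lam N M p q * s p)) / of_real (t q)"
    by (simp only: tform_def sum_divide_distrib[symmetric])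
  also have "\<dots> = of_real (ssize M p * Lam N M p q)"
    using s_pos[OF p] t_pos[OF q] by simp
  finally have "Re (\<Sum>vw\<in>F \<times> F. tform q (cframe p q vw) (cframe p q vw)) = ssize M p * Lam N M p q"
    by (simp only: Re_complex_of_real)
  then show ?thesis by simp
qed

lemma cframe_eform_sum:
  assumes E: "cond_exp M N E"
  shows "(\<Sum>vw\<in>F \<times> F. Re (eform E q (cframe p q vw) (cframe p q vw)))
    = t q / s p * ssize M p * Re (rscalar (f q) (E (f q ** p)))"
proof -
  have mem: "cframe p q vw \<in> M" if "vw \<in> F \<times> F" for vw
    using cframe_mem[OF that] by (rule pcolsD)
  have fpM: "f q ** p \<in> M" by (intro M.mult_mem fD(2)[OF q] M.mcpD(1)[OF p])
  have "(\<Sum>vw\<in>F \<times> F. eform E q (cframe p q vw) (cframe p q vw))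
      = rscalar (f q) (\<Sum>vw\<in>F \<times> F. E (adj (cframe p q vw) ** cframe p q vw))"
    by (simp add: eform_def rscalar_def mtrace_sum sum_divide_distrib)
  also have "(\<Sum>vw\<in>F \<times> F. E (adj (cframe p q vw) ** cframe p q vw))
      = E (\<Sum>vw\<in>F \<times> F. adj (cframe p q vw) ** cframe p q vw)"
    by (intro cond_exp_sum[OF E, symmetric] M.mult_mem M.adj_mem mem)
  also have "\<dots> = smult (of_real (t q / s p * ssize M p)) (E (f q ** p))"
    unfolding cframe_sum by (rule cond_expD(5)[OF E fpM])
  finally have "(\<Sum>vw\<in>F \<times> F. eform E q (cframe p q vw) (cframe p q vw))
      = of_real (t q / s p * ssize M p) * rscalar (f q) (E (f q ** p))"
    by (simp add: rscalar_def)
  then have "Re (\<Sum>vw\<in>F \<times> F. eform E q (cframe p q vw) (cframe p q vw))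
      = t q / s p * ssize M p * Re (rscalar (f q) (E (f q ** p)))" by simp
  then show ?thesis by simp
qed

end

text \<open>For \<open>x\<close> in the block, \<open>p ** w\<close> and \<open>w\<close> have the
  same coefficient, because \<open>p\<close> can be moved onto \<open>x\<close>. The cut family is
  still a frame although orthonormality may be lost.\<close>

lemma eframes_pcols:
  assumes U: "eframes E U" and p: "p \<in> mcp M" and q: "q \<in> mcp N"
  shows "w \<in> U q \<Longrightarrow> p ** w \<in> pcols p q"
    "x \<in> pcols p q \<Longrightarrow> (\<Sum>w\<in>U q. smult (eform E q (p ** w) x) (p ** w)) = x"
proof -
  note D = eframesD[OF U q] and pD = M.mcpD[OF p]
  show "p ** w \<in> pcols p q" if "w \<in> U q"
  proof -
    have "w \<in> M" "w ** f q = w" using D(2)[OF that] by (auto simp: cols_def)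
    moreover have "p ** w ** f q = p ** (w ** f q)" "p ** (p ** w) = (p ** p) ** w"
      by (simp_all add: matrix_mul_assoc)
    ultimately show ?thesis
      using pD by (simp add: pcols_def cols_def M.mult_mem is_projD)
  qed
  assume x: "x \<in> pcols p q"
  note xD = pcolsD[OF x]
  have "eform E q (p ** w) x = eform E q w x" for w
  proof -
    have "adj (p ** w) ** x = adj w ** (p ** x)"
      using pD by (simp add: adj_mult is_projD matrix_mul_assoc)
    then show ?thesis using xD by (simp add: eform_def)
  qed
  then have "(\<Sum>w\<in>U q. smult (eform E q (p ** w) x) (p ** w)) = p ** (\<Sum>w\<in>U q. smult (eform E q w x) w)"
    by (simp add: matrix_mult_sum_right)
  then show "(\<Sum>w\<in>U q. smult (eform E q (p ** w) x) (p ** w)) = x"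
    using D(3)[OF xD(2)] xD(4) by simp
qed

text \<open>The trace turns \<open>w ** adj w ** p\<close> into
  \<open>adj (p ** w) ** (p ** w)\<close>, so the index on the block of \<open>p\<close> becomes a
  sum of the \<open>E\<close>-frame measured in the form of \<open>\<tau>\<close>.\<close>

lemma tau_Ind_block:
  assumes E: "cond_exp M N E" and U: "eframes E U" and p: "p \<in> mcp M"
  shows "\<tau> (Ind M E ** p) = (\<Sum>q\<in>mcp N. of_real (t q) * (\<Sum>w\<in>U q. tform q (p ** w) (p ** w)))"
proof -
  note pD = M.mcpD[OF p]
  have w: "w \<in> M" "adj w \<in> M" if "w \<in> U q" "q \<in> mcp N" for w q
    using eframesD(2)[OF U that(2,1)] M.adj_mem by (auto simp: cols_def)
  have "\<tau> (Ind M E ** p) = \<tau> (\<Sum>q\<in>mcp N. \<Sum>w\<in>U q. w ** adj w ** p)"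
    by (simp add: Ind_eframes(1)[OF E U] matrix_mult_sum_left)
  also have "\<dots> = (\<Sum>q\<in>mcp N. \<Sum>w\<in>U q. \<tau> (w ** adj w ** p))"
    using w pD by (subst tau_sum) (auto intro!: M.sum_mem M.mult_mem sum.cong tau_sum)
  also have "\<dots> = (\<Sum>q\<in>mcp N. \<Sum>w\<in>U q. \<tau> (adj (p ** w) ** (p ** w)))"
  proof (intro sum.cong refl)
    fix q w assume "q \<in> mcp N" "w \<in> U q"
    then have wM: "w \<in> M" "adj w \<in> M" using w by auto
    have "\<tau> (w ** adj w ** p) = \<tau> (w ** (adj w ** p))" by (simp add: matrix_mul_assoc)
    also have "\<dots> = \<tau> ((adj w ** p) ** w)" by (intro tauD(3) M.mult_mem wM pD)
    also have "(adj w ** p) ** w = adj (p ** w) ** (p ** w)"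
    proof -
      have "adj (p ** w) ** (p ** w) = adj w ** (p ** p) ** w"
        using pD by (simp add: adj_mult is_projD(2) matrix_mul_assoc)
      then show ?thesis using pD by (simp add: is_projD(1))
    qed
    finally show "\<tau> (w ** adj w ** p) = \<tau> (adj (p ** w) ** (p ** w))" .
  qed
  also have "\<dots> = (\<Sum>q\<in>mcp N. of_real (t q) * (\<Sum>w\<in>U q. tform q (p ** w) (p ** w)))"
  proof (intro sum.cong refl)
    fix q assume q: "q \<in> mcp N"
    show "(\<Sum>w\<in>U q. \<tau> (adj (p ** w) ** (p ** w))) = of_real (t q) * (\<Sum>w\<in>U q. tform q (p ** w) (p ** w))"
      using t_pos[OF q] by (simp add: tform_def sum_divide_distrib[symmetric])
  qed
  finally show ?thesis .
qed

text \<open>Here \<open>E (f q ** p)\<close> is a multiple of \<open>f q\<close> for each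
  \<open>p\<close>, and the multiples add up to that of \<open>E (f q) = f q\<close>.\<close>

lemma cond_exp_weights:
  assumes E: "cond_exp M N E" and q: "q \<in> mcp N"
  shows "(\<Sum>p\<in>mcp M. Re (rscalar (f q) (E (f q ** p)))) = 1"
proof -
  have "(\<Sum>p\<in>mcp M. rscalar (f q) (E (f q ** p))) = rscalar (f q) (E (\<Sum>p\<in>mcp M. f q ** p))"
    using q by (subst cond_exp_sum[OF E])
      (simp_all add: M.mult_mem[OF fD(2)[OF q] M.mcpD(1)] rscalar_def mtrace_sum sum_divide_distrib)
  also have "\<dots> = 1"
    using M.mcp_decomp[OF fD(2)[OF q]] cond_expD(3)[OF E fD(1)[OF q]] fD(8)[OF q]
    by (simp add: rscalar_def)
  finally have "Re (\<Sum>p\<in>mcp M. rscalar (f q) (E (f q ** p))) = 1" by simp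
  then show ?thesis by simp
qed

text \<open>For \<open>y\<close> in the corner of \<open>f q\<close>, \<open>y ** p\<close> equals
  \<open>adj (p ** f q) ** (p ** y)\<close>, a product to which the forms apply; this settles the
  corners. Matrix units \<open>g\<close> of \<open>N q\<close> move \<open>x\<close> into a corner
  as \<open>adj g ** x ** g\<close>, and \<open>E\<close> commutes with this.\<close>

lemma trace_preserving_if_forms_eq:
  assumes E: "cond_exp M N E"
    and eq: "\<And>p q x y. p \<in> mcp M \<Longrightarrow> q \<in> mcp N \<Longrightarrow> x \<in> pcols p q \<Longrightarrow> y \<in> pcols p q
      \<Longrightarrow> eform E q x y = tform q x y"
    and x: "x \<in> M"
  shows "\<tau> (E x) = \<tau> x"
proof -
  have corner: "\<tau> (E y) = \<tau> y" if q: "q \<in> mcp N" and y: "y \<in> M" "f q ** y = y" "y ** f q = y" for q y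
  proof -
    have "\<tau> (E (y ** p)) = \<tau> (y ** p)" if p: "p \<in> mcp M" for p
    proof -
      note pD = M.mcpD[OF p]
      have pf: "p ** f q \<in> pcols p q"
        using fD[OF q] pD by (simp add: pcols_def cols_def M.mult_mem matrix_mul_assoc is_projD)
          (simp add: matrix_mul_assoc[symmetric] fD[OF q])
      have py: "p ** y \<in> pcols p q"
        using y pD by (simp add: pcols_def cols_def M.mult_mem matrix_mul_assoc is_projD)
          (simp add: matrix_mul_assoc[symmetric])
      have "adj (p ** f q) ** (p ** y) = f q ** ((p ** p) ** y)"
        using pD fD(6)[OF q] by (simp add: adj_mult is_projD(2) matrix_mul_assoc)
      also have "\<dots> = f q ** (y ** p)"
        using pD M.mcp_comm[OF p y(1)] by (simp add: is_projD(1))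
      also have "\<dots> = y ** p" using y by (simp add: matrix_mul_assoc)
      finally have *: "adj (p ** f q) ** (p ** y) = y ** p" .
      have "\<tau> (E (y ** p)) = of_real (t q) * eform E q (p ** f q) (p ** y)"
        using eform_trace_preserving[OF E q pcolsD(2)[OF pf] pcolsD(2)[OF py]] * by simp
      also have "\<dots> = \<tau> (y ** p)"
        unfolding eq[OF p q pf py] tform_def * using t_pos[OF q] by simp
      finally show ?thesis .
    qed
    then have "(\<Sum>p\<in>mcp M. \<tau> (E (y ** p))) = (\<Sum>p\<in>mcp M. \<tau> (y ** p))" by simp
    moreover have "(\<Sum>p\<in>mcp M. \<tau> (E (y ** p))) = \<tau> (E (\<Sum>p\<in>mcp M. y ** p))"
    proof -
      have yp: "y ** p \<in> M" "E (y ** p) \<in> M" if "p \<in> mcp M" for p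
        using M.mult_mem[OF y(1) M.mcpD(1)[OF that]] cond_expD(2)[OF E] NM by auto
      have "\<tau> (E (\<Sum>p\<in>mcp M. y ** p)) = \<tau> (\<Sum>p\<in>mcp M. E (y ** p))"
        by (rule arg_cong[OF cond_exp_sum[OF E yp(1)]])
      also have "\<dots> = (\<Sum>p\<in>mcp M. \<tau> (E (y ** p)))" by (rule tau_sum[OF yp(2)])
      finally show ?thesis by simp
    qed
    moreover have "(\<Sum>p\<in>mcp M. \<tau> (y ** p)) = \<tau> (\<Sum>p\<in>mcp M. y ** p)"
      by (intro tau_sum[symmetric] M.mult_mem[OF y(1) M.mcpD(1)])
    ultimately show ?thesis using M.mcp_decomp[OF y(1)] by simp
  qed
  have "\<tau> (E x ** q) = \<tau> (x ** q)" if q: "q \<in> mcp N" for q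
  proof -
    obtain G where G: "N.column_frame q (f q) G" by (rule N.column_frame_exists[OF q f[OF q]])
    note GD = N.column_frameD[OF G]
    have exp: "\<tau> (z ** q) = (\<Sum>g\<in>G. \<tau> (adj g ** z ** g))" if z: "z \<in> M" for z
    proof -
      have gM: "g \<in> M" "adj g \<in> M" if "g \<in> G" for g using GD(2)[OF that] NM M.adj_mem by auto
      have "\<tau> (z ** q) = \<tau> (\<Sum>g\<in>G. z ** g ** adj g)"
        by (simp add: GD(5)[symmetric] matrix_mult_sum_right matrix_mul_assoc)
      also have "\<dots> = (\<Sum>g\<in>G. \<tau> ((z ** g) ** adj g))"
        using z gM by (intro tau_sum M.mult_mem)
      also have "\<dots> = (\<Sum>g\<in>G. \<tau> (adj g ** (z ** g)))"
        using z gM by (intro sum.cong refl tauD(3) M.mult_mem)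
      finally show ?thesis by (simp add: matrix_mul_assoc)
    qed
    have "\<tau> (adj g ** E x ** g) = \<tau> (adj g ** x ** g)" if g: "g \<in> G" for g
    proof -
      have gN: "g \<in> N" "adj g \<in> N" using GD(2)[OF g] N.adj_mem by auto
      have fg: "f q ** adj g = adj g" using GD(3)[OF g] fD(6)[OF q] by (metis adj_mult)
      have "\<tau> (E (adj g ** x ** g)) = \<tau> (adj g ** x ** g)"
        using gN NM x fg GD(3)[OF g]
        by (intro corner[OF q] M.mult_mem) (auto simp: matrix_mul_assoc, simp add: matrix_mul_assoc[symmetric])
      then show ?thesis using cond_expD(6)[OF E x gN(2,1)] by simp
    qed
    then show ?thesis using exp[OF x] exp[OF NM[OF cond_expD(2)[OF E x]]] by simp
  qed
  then have "(\<Sum>q\<in>mcp N. \<tau> (E x ** q)) = (\<Sum>q\<in>mcp N. \<tau> (x ** q))" by simp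
  moreover have "(\<Sum>q\<in>mcp N. \<tau> (z ** q)) = \<tau> z" if z: "z \<in> M" for z
  proof -
    have "(\<Sum>q\<in>mcp N. \<tau> (z ** q)) = \<tau> (\<Sum>q\<in>mcp N. z ** q)"
      by (intro tau_sum[symmetric] M.mult_mem[OF z NM[OF N.mcpD(1)]])
    then show ?thesis using z by (simp add: matrix_mult_sum_right[symmetric] N.mcp_sum M.unit_right)
  qed
  ultimately show ?thesis using x NM cond_expD(2)[OF E x] by simp
qed

end

section \<open>The minimal index with respect to the Markov trace\<close>

locale markov_inclusion = traced_inclusion +
  assumes markov: "\<And>p. p \<in> mcp M \<Longrightarrow> (\<Sum>q\<in>mcp N. Lam N M p q * t q) = d\<^sup>2 * s p"
begin

lemma sum_t_sq: "(\<Sum>q\<in>mcp N. (t q)\<^sup>2) = d\<^sup>2 * (\<Sum>p\<in>mcp M. (s p)\<^sup>2)"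
proof -
  have "(\<Sum>q\<in>mcp N. (t q)\<^sup>2) = (\<Sum>q\<in>mcp N. \<Sum>p\<in>mcp M. t q * (Lam N M p q * s p))"
    by (intro sum.cong refl) (simp add: power2_eq_square sum_distrib_left[symmetric] flip: t_eq)
  also have "\<dots> = (\<Sum>p\<in>mcp M. s p * (\<Sum>q\<in>mcp N. Lam N M p q * t q))"
    by (subst sum.swap) (simp add: sum_distrib_left mult_ac)
  also have "\<dots> = (\<Sum>p\<in>mcp M. d\<^sup>2 * (s p)\<^sup>2)"
    by (intro sum.cong refl) (simp add: markov power2_eq_square)
  finally show ?thesis by (simp add: sum_distrib_left)
qed

text \<open>When \<open>E\<close> preserves \<open>\<tau>\<close> the two forms coincide, so the
  \<open>E\<close>-frame and the explicit frame have the same sum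
  \<open>ssize M p * Lam N M p q\<close>. Weighted by \<open>t q\<close>, the Markov equation turns
  it into \<open>d\<^sup>2\<close> times \<open>\<tau> p\<close>, which identifies the scalar of the
  central element \<open>Ind M E\<close> on the block.\<close>

lemma Ind_trace_preserving:
  assumes E: "cond_exp M N E" and pres: "\<And>x. x \<in> M \<Longrightarrow> \<tau> (E x) = \<tau> x"
  shows "Ind M E = smult (of_real (d\<^sup>2)) u"
proof -
  obtain U where U: "eframes E U" by (rule eframes_exist[OF E])
  have z: "Ind M E \<in> center M" by (rule Ind_eframes(2)[OF E U])
  have form: "eform E q x y = tform q x y"
    if q: "q \<in> mcp N" and x: "x \<in> cols q" and y: "y \<in> cols q" for q x y
  proof -
    have "adj x ** y \<in> M" using x y by (auto simp: cols_def intro!: M.mult_mem M.adj_mem)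
    then show ?thesis
      using eform_trace_preserving[OF E q x y] pres t_pos[OF q] by (simp add: tform_def)
  qed
  have block: "Ind M E ** p = smult (of_real (d\<^sup>2)) p" if p: "p \<in> mcp M" for p
  proof -
    obtain F where F: "M.column_frame p (e p) F" by (rule M.column_frame_exists[OF p e[OF p]])
    have fr: "(\<Sum>w\<in>U q. Re (tform q (p ** w) (p ** w))) = ssize M p * Lam N M p q"
      if q: "q \<in> mcp N" for q
    proof -
      have "(\<Sum>w\<in>U q. Re (tform q (p ** w) (p ** w)))
        = (\<Sum>vw\<in>F \<times> F. Re (tform q (cframe p q vw) (cframe p q vw)))"
      proof (rule frame_sum_unique[OF cform_tform[OF q]])
        fix x assume x: "x \<in> pcols p q"
        have "x = (\<Sum>w\<in>U q. smult (eform E q (p ** w) x) (p ** w))"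
          using eframes_pcols(2)[OF U p q x] by simp
        also have "\<dots> = (\<Sum>w\<in>U q. smult (tform q (p ** w) x) (p ** w))"
          using form[OF q pcolsD(2)[OF eframes_pcols(1)[OF U p q]] pcolsD(2)[OF x]] by simp
        finally show "x = (\<Sum>w\<in>U q. smult (tform q (p ** w) x) (p ** w))" .
        show "x = (\<Sum>vw\<in>F \<times> F. smult (tform q (cframe p q vw) x) (cframe p q vw))"
          using cframe_expand[OF p q F x] by simp
      qed (use eframesD(1)[OF U q] M.column_frameD(1)[OF F] eframes_pcols(1)[OF U p q]
            cframe_mem[OF p q F] in auto)
      then show ?thesis using cframe_tform_sum[OF p q F] by simp
    qed
    obtain c where c: "Ind M E ** p = smult c p" using M.center_scalar[OF z p] by blast
    have "Re (\<tau> (Ind M E ** p)) = (\<Sum>q\<in>mcp N. t q * (\<Sum>w\<in>U q. Re (tform q (p ** w) (p ** w))))"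
      unfolding tau_Ind_block[OF E U p] by simp
    also have "\<dots> = ssize M p * (\<Sum>q\<in>mcp N. Lam N M p q * t q)"
      by (simp add: fr sum_distrib_left mult_ac)
    also have "\<dots> = d\<^sup>2 * (ssize M p * s p)" by (simp add: markov[OF p])
    finally have re: "Re (\<tau> (Ind M E ** p)) = d\<^sup>2 * (ssize M p * s p)" .
    have "Im (tform q (p ** w) (p ** w)) = 0" if "q \<in> mcp N" "w \<in> U q" for q w
      using cform.a_self_real[OF cform_tform[OF that(1)] eframes_pcols(1)[OF U p that]]
      by (metis Im_complex_of_real)
    then have "Im (\<tau> (Ind M E ** p)) = 0" unfolding tau_Ind_block[OF E U p] by simp
    then have "\<tau> (Ind M E ** p) = of_real (d\<^sup>2) * of_real (ssize M p * s p)"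
      using re by (simp add: complex_eq_iff)
    moreover have "\<tau> (Ind M E ** p) = c * of_real (ssize M p * s p)"
      unfolding c by (simp add: tauD(4)[OF M.mcpD(1)[OF p]] tau_mcp'[OF p])
    moreover have "complex_of_real (ssize M p * s p) \<noteq> 0"
      using M.ssize_pos[OF p] s_pos[OF p] by (simp only: of_real_eq_0_iff) simp
    ultimately have "c = of_real (d\<^sup>2)" by (metis mult_right_cancel)
    then show ?thesis using c by simp
  qed
  have "Ind M E = (\<Sum>p\<in>mcp M. smult (of_real (d\<^sup>2)) p)" by (rule M.center_decomp[OF z block])
  then show ?thesis by (simp add: smult_sum[symmetric] M.mcp_sum)
qed

text \<open>Summing the two-frame inequality over all blocks with weights \<open>s p * t q / ssize M p\<close>
  makes its right-hand side telescope to \<open>0\<close> as soon as the index is at most \<open>d\<^sup>2\<close>.\<close>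
lemma trace_preserving_if_index_le:
  assumes E: "cond_exp M N E" and le: "mnorm (Ind M E) \<le> d\<^sup>2" and x: "x \<in> M"
  shows "\<tau> (E x) = \<tau> x"
proof (rule trace_preserving_if_forms_eq[OF E _ x])
  obtain U where U: "eframes E U" by (rule eframes_exist[OF E])
  have z: "Ind M E \<in> center M" by (rule Ind_eframes(2)[OF E U])
  have "\<exists>F. \<forall>p\<in>mcp M. M.column_frame p (e p) (F p)"
    by (intro bchoice ballI) (use M.column_frame_exists e in metis)
  then obtain F where F: "\<And>p. p \<in> mcp M \<Longrightarrow> M.column_frame p (e p) (F p)" by blast
  \<comment> \<open>\<open>A\<close> measures the \<open>E\<close>-frame by \<open>\<tau>\<close>
    and is controlled by the index; \<open>B\<close> measures the \<open>\<tau>\<close>-frame by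
    \<open>E\<close> and depends on \<open>E (f q ** p)\<close> alone; \<open>C\<close> is a block
    dimension.\<close>
  define A B C where
    "A p q = (\<Sum>w\<in>U q. Re (tform q (p ** w) (p ** w)))" and
    "B p q = (\<Sum>vw\<in>F p \<times> F p. Re (eform E q (cframe p q vw) (cframe p q vw)))" and
    "C p q = (\<Sum>vw\<in>F p \<times> F p. Re (tform q (cframe p q vw) (cframe p q vw)))" for p q
  have frames: "2 * C p q \<le> A p q + B p q"
      "2 * C p q = A p q + B p q \<Longrightarrow> x \<in> pcols p q \<Longrightarrow> y \<in> pcols p q \<Longrightarrow> eform E q x y = tform q x y"
    if p: "p \<in> mcp M" and q: "q \<in> mcp N" for p q x y
  proof -
    have 1: "finite (U q)" "finite (F p \<times> F p)"
      using eframesD(1)[OF U q] M.column_frameD(1)[OF F[OF p]] by auto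
    have 2: "x = (\<Sum>w\<in>U q. smult (eform E q (p ** w) x) (p ** w))"
      "x = (\<Sum>vw\<in>F p \<times> F p. smult (tform q (cframe p q vw) x) (cframe p q vw))"
      if "x \<in> pcols p q" for x
      using eframes_pcols(2)[OF U p q that] cframe_expand[OF p q F[OF p] that] by simp_all
    note tf = two_frames[OF cform_eform_pcols[OF E q] cform_tform[OF q] 1
        eframes_pcols(1)[OF U p q] cframe_mem[OF p q F[OF p]] 2]
    show "2 * C p q \<le> A p q + B p q" unfolding A_def B_def C_def by (rule tf(1))
    show "eform E q x y = tform q x y" if "2 * C p q = A p q + B p q" "x \<in> pcols p q" "y \<in> pcols p q"
      by (rule tf(2)) (use that in \<open>simp_all add: A_def B_def C_def\<close>)
  qed
  have C: "C p q = ssize M p * Lam N M p q" if "p \<in> mcp M" "q \<in> mcp N" for p q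
    unfolding C_def by (rule cframe_tform_sum[OF that F[OF that(1)]])
  let ?eps = "\<lambda>p q. Re (rscalar (f q) (E (f q ** p)))"
  have B: "B p q = t q / s p * ssize M p * ?eps p q" if "p \<in> mcp M" "q \<in> mcp N" for p q
    unfolding B_def by (rule cframe_eform_sum[OF that F[OF that(1)] E])
  have A: "(\<Sum>q\<in>mcp N. t q * A p q) \<le> d\<^sup>2 * (ssize M p * s p)" if p: "p \<in> mcp M" for p
  proof -
    obtain c where c: "Ind M E ** p = smult c p" using M.center_scalar[OF z p] by blast
    have "(\<Sum>q\<in>mcp N. t q * A p q) = Re (\<tau> (Ind M E ** p))"
      unfolding tau_Ind_block[OF E U p] A_def by simp
    also have "\<dots> = Re c * (ssize M p * s p)"
      unfolding c by (simp add: tauD(4)[OF M.mcpD(1)[OF p]] tau_mcp'[OF p] flip: of_real_mult)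
    also have "Re c \<le> d\<^sup>2"
      using mnorm_ge_scalar[OF c M.mcpD(3)[OF p]] le complex_Re_le_cmod[of c] by linarith
    then have "Re c * (ssize M p * s p) \<le> d\<^sup>2 * (ssize M p * s p)"
      using M.ssize_pos[OF p] s_pos[OF p] by (intro mult_right_mono) auto
    finally show ?thesis .
  qed
  \<comment> \<open>The weight removes \<open>ssize M p / s p\<close> from \<open>B\<close> and
    leaves \<open>(t q)\<^sup>2 * ?eps p q\<close>, whose sum over \<open>p\<close> is free of
    \<open>E\<close>.\<close>
  define D where "D p q = s p / ssize M p * t q * (A p q + B p q - 2 * C p q)" for p q
  have D_nonneg: "0 \<le> D p q" if "p \<in> mcp M" "q \<in> mcp N" for p q
    unfolding D_def using frames(1)[OF that] s_pos[OF that(1)] M.ssize_pos[OF that(1)] t_pos[OF that(2)]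
    by (intro mult_nonneg_nonneg) auto
  have "(\<Sum>p\<in>mcp M. \<Sum>q\<in>mcp N. D p q)
      = (\<Sum>p\<in>mcp M. s p / ssize M p * (\<Sum>q\<in>mcp N. t q * A p q))
        + (\<Sum>p\<in>mcp M. \<Sum>q\<in>mcp N. (t q)\<^sup>2 * ?eps p q)
        - 2 * (\<Sum>p\<in>mcp M. s p * (\<Sum>q\<in>mcp N. Lam N M p q * t q))"
  proof -
    have "D p q = s p / ssize M p * (t q * A p q) + (t q)\<^sup>2 * ?eps p q - 2 * (s p * (Lam N M p q * t q))"
      if "p \<in> mcp M" "q \<in> mcp N" for p q
      unfolding D_def B[OF that] C[OF that]
      using s_pos[OF that(1)] M.ssize_pos[OF that(1)] by (simp add: field_simps power2_eq_square)
    then have "(\<Sum>p\<in>mcp M. \<Sum>q\<in>mcp N. D p q) = (\<Sum>p\<in>mcp M. \<Sum>q\<in>mcp N.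
        s p / ssize M p * (t q * A p q) + (t q)\<^sup>2 * ?eps p q - 2 * (s p * (Lam N M p q * t q)))"
      by (intro sum.cong refl)
    then show ?thesis by (simp only: sum.distrib sum_subtractf sum_distrib_left)
  qed
  also have "(\<Sum>p\<in>mcp M. \<Sum>q\<in>mcp N. (t q)\<^sup>2 * ?eps p q) = (\<Sum>q\<in>mcp N. (t q)\<^sup>2)"
    by (subst sum.swap) (simp only: sum_distrib_left[symmetric] cond_exp_weights[OF E] mult_1_right cong: sum.cong)
  also have "(\<Sum>p\<in>mcp M. s p * (\<Sum>q\<in>mcp N. Lam N M p q * t q)) = (\<Sum>q\<in>mcp N. (t q)\<^sup>2)"
  proof -
    have "(\<Sum>p\<in>mcp M. s p * (\<Sum>q\<in>mcp N. Lam N M p q * t q)) = (\<Sum>p\<in>mcp M. s p * (d\<^sup>2 * s p))"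
      by (intro sum.cong refl) (simp add: markov)
    then show ?thesis unfolding sum_t_sq by (simp add: sum_distrib_left power2_eq_square mult_ac)
  qed
  also have "(\<Sum>p\<in>mcp M. s p / ssize M p * (\<Sum>q\<in>mcp N. t q * A p q))
      \<le> (\<Sum>p\<in>mcp M. s p / ssize M p * (d\<^sup>2 * (ssize M p * s p)))"
    by (intro sum_mono mult_left_mono A) (auto intro!: divide_nonneg_pos less_imp_le[OF s_pos] M.ssize_pos)
  also have "\<dots> = (\<Sum>q\<in>mcp N. (t q)\<^sup>2)"
    unfolding sum_t_sq sum_distrib_left
  proof (intro sum.cong refl)
    fix p assume "p \<in> mcp M"
    then show "s p / ssize M p * (d\<^sup>2 * (ssize M p * s p)) = d\<^sup>2 * (s p)\<^sup>2"
      using M.ssize_pos[of p] by (simp add: power2_eq_square)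
  qed
  finally have "(\<Sum>p\<in>mcp M. \<Sum>q\<in>mcp N. D p q) \<le> 0" by simp
  moreover have "0 \<le> (\<Sum>p\<in>mcp M. \<Sum>q\<in>mcp N. D p q)"
    by (intro sum_nonneg D_nonneg)
  ultimately have "(\<Sum>p\<in>mcp M. \<Sum>q\<in>mcp N. D p q) = 0" by simp
  then have D0: "D p q = 0" if "p \<in> mcp M" "q \<in> mcp N" for p q
    using that D_nonneg by (simp add: sum_nonneg_eq_0_iff sum_nonneg N.mcp_finite M.mcp_finite)
  fix p q x y assume pq: "p \<in> mcp M" "q \<in> mcp N" and xy: "x \<in> pcols p q" "y \<in> pcols p q"
  have "2 * C p q = A p q + B p q"
    using D0[OF pq] s_pos[OF pq(1)] M.ssize_pos[OF pq(1)] t_pos[OF pq(2)] by (simp add: D_def)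
  then show "eform E q x y = tform q x y" using frames(2)[OF pq] xy by blast
qed

lemma mnorm_Ind_trace_preserving:
  assumes "cond_exp M N E" "\<And>x. x \<in> M \<Longrightarrow> \<tau> (E x) = \<tau> x"
  shows "mnorm (Ind M E) = d\<^sup>2"
proof -
  have "Ind M E = smult (of_real (d\<^sup>2)) u" using assms by (rule Ind_trace_preserving)
  then show ?thesis by (simp only: mnorm_smult_proj[OF M.unit_proj u_nonzero]) (simp add: norm_power)
qed

lemma minimal_expectation:
  obtains E where "cond_exp M N E" "\<forall>x\<in>M. \<tau> (E x) = \<tau> x" "mnorm (Ind M E) = d\<^sup>2"
    "\<forall>E'. cond_exp M N E' \<and> (\<forall>x\<in>M. \<tau> (E' x) = \<tau> x) \<longrightarrow> E' = E"
    "\<forall>E'. cond_exp M N E' \<and> mnorm (Ind M E') \<le> d\<^sup>2 \<longrightarrow> E' = E"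
proof -
  obtain E where E: "cond_exp M N E" "\<And>x. x \<in> M \<Longrightarrow> \<tau> (E x) = \<tau> x"
    using trace_preserving_exists by blast
  have 1: "E' = E" if "cond_exp M N E'" "\<And>x. x \<in> M \<Longrightarrow> \<tau> (E' x) = \<tau> x" for E'
    by (rule trace_preserving_unique[OF that E])
  have 2: "E' = E" if "cond_exp M N E'" "mnorm (Ind M E') \<le> d\<^sup>2" for E'
    using that by (intro 1 trace_preserving_if_index_le)
  show thesis
    using that[of E] E mnorm_Ind_trace_preserving[of E] 1 2 by blast
qed

lemma min_index_eq: "min_index M N = d\<^sup>2"
proof -
  obtain E where E: "cond_exp M N E" "mnorm (Ind M E) = d\<^sup>2"
    "\<forall>E'. cond_exp M N E' \<and> mnorm (Ind M E') \<le> d\<^sup>2 \<longrightarrow> E' = E"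
    using minimal_expectation by metis
  show ?thesis
    unfolding min_index_def
  proof (rule cInf_eq_minimum)
    show "d\<^sup>2 \<in> {mnorm (Ind M E) |E. cond_exp M N E}" using E by force
    fix y assume "y \<in> {mnorm (Ind M E) |E. cond_exp M N E}"
    then obtain E' where "y = mnorm (Ind M E')" "cond_exp M N E'" by blast
    \<comment> \<open>An index below \<open>d\<^sup>2\<close> would force \<open>E' = E\<close>,
      whose index is \<open>d\<^sup>2\<close>.\<close>
    then show "d\<^sup>2 \<le> y" using E by (metis linear order_refl)
  qed
qed

text \<open>Phrased with the \<open>THE\<close> term itself, so that the same two facts serve for
  \<open>Etau\<close> and for the expectation inside \<open>jones_index\<close>.\<close>

lemma
  shows minimal_eq_trace_preserving:
    "E0 M N = (THE E. cond_exp M N E \<and> (\<forall>x\<in>M. \<tau> (E x) = \<tau> x))"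
  and mnorm_Ind_the:
    "mnorm (Ind M (THE E. cond_exp M N E \<and> (\<forall>x\<in>M. \<tau> (E x) = \<tau> x))) = d\<^sup>2"
proof -
  obtain E where E: "cond_exp M N E" "\<forall>x\<in>M. \<tau> (E x) = \<tau> x" "mnorm (Ind M E) = d\<^sup>2"
    "\<forall>E'. cond_exp M N E' \<and> (\<forall>x\<in>M. \<tau> (E' x) = \<tau> x) \<longrightarrow> E' = E"
    "\<forall>E'. cond_exp M N E' \<and> mnorm (Ind M E') \<le> d\<^sup>2 \<longrightarrow> E' = E"
    by (rule minimal_expectation)
  have 1: "(THE E. cond_exp M N E \<and> (\<forall>x\<in>M. \<tau> (E x) = \<tau> x)) = E"
    by (rule the_equality) (use E in blast)+
  have min: "mnorm (Ind M E) \<le> mnorm (Ind M E')" if "cond_exp M N E'" for E'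
    using E(3,5) that by (metis linear order_refl)
  have 2: "E0 M N = E"
    unfolding E0_def
  proof (rule the_equality)
    fix E' assume E': "cond_exp M N E' \<and> (\<forall>E. cond_exp M N E \<longrightarrow> mnorm (Ind M E') \<le> mnorm (Ind M E))"
    then have "mnorm (Ind M E') \<le> d\<^sup>2" using E(1,3) by metis
    then show "E' = E" using E(5) E' by blast
  qed (use E(1) min in blast)
  show "E0 M N = (THE E. cond_exp M N E \<and> (\<forall>x\<in>M. \<tau> (E x) = \<tau> x))"
    "mnorm (Ind M (THE E. cond_exp M N E \<and> (\<forall>x\<in>M. \<tau> (E x) = \<tau> x))) = d\<^sup>2"
    unfolding 1 2 by (simp_all add: E)
qed

end

section \<open>The Markov trace\<close>

context bipartite
begin

lemma ap_scale: "(\<And>q. q \<in> Q \<Longrightarrow> x q = c * y q) \<Longrightarrow> ap x p = c * ap y p"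
  by (simp add: ap_def sum_distrib_left mult_ac)

lemma tr_scale: "(\<And>p. p \<in> P \<Longrightarrow> x p = c * y p) \<Longrightarrow> tr x q = c * tr y q"
  by (simp add: tr_def sum_distrib_left mult_ac)

lemma ap_tr_eq: "ap (tr y) p = (\<Sum>p'\<in>P. (\<Sum>q\<in>Q. L p q * L p' q) * y p')"
  unfolding ap_def tr_def
  by (simp add: sum_distrib_left sum_distrib_right mult_ac) (rule sum.swap)

lemma tr_ap_eq: "tr (ap x) q = (\<Sum>q'\<in>Q. (\<Sum>p\<in>P. L p q * L p q') * x q')"
  unfolding ap_def tr_def
  by (simp add: sum_distrib_left sum_distrib_right mult_ac) (rule sum.swap)

end

context inclusion
begin

text \<open>The condition under \<open>THE\<close> in \<open>markov_trace\<close>, with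
  \<open>u\<close> in place of \<open>mat 1\<close>, so that it also makes sense for
  corners.\<close>

definition is_markov :: "('n cmat \<Rightarrow> complex) \<Rightarrow> bool" where
  "is_markov \<tau> \<longleftrightarrow> tracial_state M u \<tau> \<and>
     (\<forall>p\<in>mcp M. (\<Sum>p'\<in>mcp M. (\<Sum>q\<in>mcp N. Lam N M p q * Lam N M p' q) *
          Re (\<tau> (e p'))) = (dnorm N M)\<^sup>2 * Re (\<tau> (e p)))"

lemma is_markov_iff: "is_markov \<tau> \<longleftrightarrow> tracial_state M u \<tau> \<and>
    (\<forall>p\<in>mcp M. bratteli.ap (bratteli.tr (\<lambda>p. Re (\<tau> (e p)))) p = d\<^sup>2 * Re (\<tau> (e p)))"
  by (simp add: is_markov_def bratteli.ap_tr_eq d_def)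

lemma is_markov_inclusion:
  assumes "is_markov \<tau>"
  shows "markov_inclusion N M u \<tau>"
proof -
  interpret traced_inclusion N M u \<tau>
    by unfold_locales (use assms in \<open>simp add: is_markov_iff\<close>)
  show ?thesis
  proof
    fix p assume "p \<in> mcp M"
    moreover have "(\<Sum>q\<in>mcp N. Lam N M p q * t q) = bratteli.ap (bratteli.tr (\<lambda>p. Re (\<tau> (e p)))) p"
      by (simp add: bratteli.ap_def bratteli.tr_def t_eq s_def)
    ultimately show "(\<Sum>q\<in>mcp N. Lam N M p q * t q) = d\<^sup>2 * s p"
      using assms by (simp add: is_markov_iff s_def)
  qed
qed

text \<open>The trace vector is the image under \<open>\<Lambda>\<close> of a Perron vector
  \<open>v\<close> of \<open>\<Lambda>\<^sup>t \<Lambda>\<close>, divided by \<open>n\<close>, which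
  makes the trace of \<open>u\<close> equal to \<open>1\<close>.\<close>

lemma is_markov_exists: obtains \<tau> where "is_markov \<tau>"
proof -
  obtain v where v: "\<And>q. q \<in> mcp N \<Longrightarrow> 0 < v q" "\<And>p. p \<in> mcp M \<Longrightarrow> 0 < bratteli.ap v p"
    "\<And>q. q \<in> mcp N \<Longrightarrow> bratteli.tr (bratteli.ap v) q = (rnorm (mcp M) (mcp N) (Lam N M))\<^sup>2 * v q"
    using bratteli.perron_vector by blast
  define n where "n = (\<Sum>p\<in>mcp M. ssize M p * bratteli.ap v p)"
  have n: "0 < n"
    unfolding n_def by (intro sum_pos mult_pos_pos M.ssize_pos v M.mcp_finite mcp_nonempty)
  define y where "y p = (1 / n) * bratteli.ap v p" for p
  have y: "0 < y p" if "p \<in> mcp M" for p using v(2)[OF that] n by (simp add: y_def)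
  have "(\<Sum>p\<in>mcp M. ssize M p * y p) = (1 / n) * n"
    unfolding n_def y_def sum_distrib_left by (simp add: mult_ac)
  then have tr: "tracial_state M u (M.wtrace y)"
    using n by (intro M.wtrace_state y) simp_all
  have "bratteli.tr y q = (1 / n * d\<^sup>2) * v q" if "q \<in> mcp N" for q
    using bratteli.tr_scale[of y "1 / n" "bratteli.ap v" q] v(3)[OF that]
    by (simp add: y_def d_def dnorm_def)
  then have "bratteli.ap (bratteli.tr y) p = d\<^sup>2 * y p" for p
    using bratteli.ap_scale[of "bratteli.tr y" "1 / n * d\<^sup>2" v p] by (simp add: y_def)
  moreover have "bratteli.tr (\<lambda>p. Re (M.wtrace y (e p))) = bratteli.tr y"
    by (simp add: bratteli.tr_def M.wtrace_minproj fun_eq_iff)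
  ultimately have "is_markov (M.wtrace y)"
    using tr by (simp add: is_markov_iff M.wtrace_minproj)
  then show thesis by (rule that)
qed

text \<open>The restrictions to \<open>N\<close> have trace vectors that are positive eigenvectors
  of \<open>\<Lambda>\<^sup>t \<Lambda>\<close>, hence proportional. The Markov equation carries the
  factor \<open>c\<close> over to the vectors on \<open>M\<close>, and the value on \<open>u\<close>
  gives \<open>c = 1\<close>.\<close>

lemma is_markov_unique:
  assumes "is_markov \<tau>" "is_markov \<tau>'"
  shows "\<tau> = \<tau>'"
proof -
  interpret T: markov_inclusion N M u \<tau> by (rule is_markov_inclusion[OF assms(1)])
  interpret T': markov_inclusion N M u \<tau>' by (rule is_markov_inclusion[OF assms(2)])
  have eig: "bratteli.tr (bratteli.ap T.t) q = d\<^sup>2 * T.t q"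
    "bratteli.tr (bratteli.ap T'.t) q = d\<^sup>2 * T'.t q" if "q \<in> mcp N" for q
  proof -
    have "bratteli.ap T.t p = d\<^sup>2 * T.s p" "bratteli.ap T'.t p = d\<^sup>2 * T'.s p" if "p \<in> mcp M" for p
      using T.markov[OF that] T'.markov[OF that] by (simp_all add: bratteli.ap_def)
    then show "bratteli.tr (bratteli.ap T.t) q = d\<^sup>2 * T.t q"
      "bratteli.tr (bratteli.ap T'.t) q = d\<^sup>2 * T'.t q"
      using bratteli.tr_scale[of "bratteli.ap T.t" "d\<^sup>2" T.s q]
        bratteli.tr_scale[of "bratteli.ap T'.t" "d\<^sup>2" T'.s q] T.t_eq[OF that] T'.t_eq[OF that]
      by (simp_all add: bratteli.tr_def)
  qed
  obtain c where c: "0 < c" "\<And>q. q \<in> mcp N \<Longrightarrow> T'.t q = c * T.t q"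
    using bratteli.eigenvector_unique[OF T.t_pos eig(1) T'.t_pos eig(2)] by blast
  have cs: "T'.s p = c * T.s p" if p: "p \<in> mcp M" for p
  proof -
    have "d\<^sup>2 * T'.s p = c * (d\<^sup>2 * T.s p)"
      unfolding T.markov[OF p, symmetric] T'.markov[OF p, symmetric]
      by (simp add: c sum_distrib_left mult_ac)
    then show ?thesis using d_sq_pos by (simp add: mult.left_commute[of c])
  qed
  have "(\<Sum>p\<in>mcp M. ssize M p * T'.s p) = c * (\<Sum>p\<in>mcp M. ssize M p * T.s p)"
    by (simp add: cs sum_distrib_left mult_ac)
  then have "c = 1"
    using M.tracial_state_weights[OF T.tau] M.tracial_state_weights[OF T'.tau]
    by (simp add: T.s_def T'.s_def)
  then have "M.wtrace T.s = M.wtrace T'.s"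
    using cs by (simp add: M.wtrace_def fun_eq_iff)
  then show ?thesis
    using M.tracial_state_eq_wtrace[OF T.tau] M.tracial_state_eq_wtrace[OF T'.tau]
    by (simp add: T.s_def[abs_def] T'.s_def[abs_def])
qed

end

section \<open>Reduced inclusions\<close>

context matalg
begin

text \<open>A central element that is a scalar on \<open>e\<close> is the same scalar on every
  \<open>v i = v i ** e\<close>, hence on their combination \<open>u\<close>.\<close>

lemma center_trivial:
  assumes z: "z \<in> center A" and ez: "e ** z = smult c e"
    and v: "\<And>i. i \<in> I \<Longrightarrow> v i \<in> A" "\<And>i. i \<in> I \<Longrightarrow> v i ** e = v i" and u: "(\<Sum>i\<in>I. v i ** b i) = u"
  shows "z = smult c u"
proof -
  have zA: "z \<in> A" and zc: "z ** x = x ** z" if "x \<in> A" for x using z that by (auto simp: center_def)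
  have zv: "z ** v i = smult c (v i)" if i: "i \<in> I" for i
  proof -
    have "z ** v i = (v i ** e) ** z" using zc[OF v(1)[OF i]] v(2)[OF i] by simp
    also have "\<dots> = v i ** (e ** z)" by (simp add: matrix_mul_assoc)
    finally show ?thesis by (simp add: ez v(2)[OF i])
  qed
  have "z = z ** (\<Sum>i\<in>I. v i ** b i)" using zA[OF unit_mem] by (simp add: u unit_right)
  also have "\<dots> = (\<Sum>i\<in>I. smult c (v i ** b i))"
    unfolding matrix_mult_sum_right by (intro sum.cong refl) (simp add: matrix_mul_assoc zv)
  finally show ?thesis by (simp add: smult_sum[symmetric] u)
qed

lemma factor_mcp:
  assumes "u \<noteq> 0" and "\<And>z. z \<in> center A \<Longrightarrow> \<exists>c. z = smult c u"
  shows "mcp A = {u}"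
proof -
  have "p = u" if p: "p \<in> mcp A" for p
  proof -
    note pD = mcpD[OF p]
    obtain c where c: "p = smult c u" using assms(2)[OF pD(4)] by blast
    have "p ** p = smult c p" by (subst (1) c) (simp add: unit_left pD(1))
    then have "smult c p = smult 1 p" using pD(2) by (simp add: is_projD)
    then have "c = 1" using smult_cancel pD(3) by blast
    then show ?thesis using c by simp
  qed
  moreover have "mcp A \<noteq> {}" using mcp_sum assms(1) by auto
  ultimately show ?thesis by auto
qed

text \<open>Both traces are \<open>mtrace p\<close> divided by \<open>ssize A p\<close>. So the
  choice made by \<open>SOME\<close> in \<open>minproj_under\<close> does not affect
  \<open>Lam\<close>.\<close>

lemma minproj_mtrace_unique:
  assumes p: "p \<in> mcp A" and e: "minproj A e" "e ** p = e" and e': "minproj A e'" "e' ** p = e'"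
  shows "mtrace e = mtrace e'"
proof -
  have "of_real (ssize A p) * mtrace e = of_real (ssize A p) * mtrace e'"
    using mtrace_ssize[OF p e] mtrace_ssize[OF p e'] by (rule trans[OF sym])
  then show ?thesis using ssize_pos[OF p] by auto
qed

end

section \<open>The inclusion of factors cut out by \<open>p ** q\<close>\<close>

context inclusion
begin

context
  fixes p q w
  assumes p: "p \<in> mcp M" and q: "q \<in> mcp N" and pq: "p ** q \<noteq> 0" and w_def: "w = p ** q"
begin

lemmas pD = M.mcpD[OF p] and qD = N.mcpD[OF q]

lemma qM: "q \<in> M"
  using qD(1) NM by blast

lemma w_proj: "is_proj w" "w \<in> M" "w \<noteq> 0" "w ** w = w" "adj w = w"
proof -
  show pr: "is_proj w" unfolding w_def
    using M.mcp_comm[OF p qM] pD qD by (intro is_proj_mult) auto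
  show "w \<in> M" "w \<noteq> 0" using pq qM pD by (simp_all add: w_def M.mult_mem)
  show "w ** w = w" "adj w = w" using pr by (simp_all add: is_projD)
qed

lemma w_q: "w ** q = w" "q ** w = w" and w_p: "w ** p = w" "p ** w = w"
proof -
  have c: "p ** q = q ** p" by (rule M.mcp_comm[OF p qM])
  have pp: "p ** p = p" "q ** q = q" using pD(2) qD(2) by (simp_all add: is_projD)
  show "w ** q = w" unfolding w_def by (simp add: matrix_mul_assoc[symmetric] pp)
  show "q ** w = w" unfolding w_def c by (simp add: matrix_mul_assoc pp)
  show "w ** p = w" unfolding w_def c by (simp add: matrix_mul_assoc[symmetric] pp)
  show "p ** w = w" unfolding w_def by (simp add: matrix_mul_assoc pp)
qed

text \<open>Makes cutting by \<open>w\<close> multiplicative and compatible with adjoints on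
  \<open>N\<close>; the structure of \<open>B\<close> rests on this.\<close>

lemma w_comm: "x \<in> N \<Longrightarrow> w ** x = x ** w"
  using M.mcp_comm[OF p NM] N.mcp_comm[OF q] unfolding w_def by (metis matrix_mul_assoc)

abbreviation A where "A \<equiv> corner w M"
abbreviation B where "B \<equiv> cut N w"

lemma A_iff: "x \<in> A \<longleftrightarrow> x \<in> M \<and> w ** x = x \<and> x ** w = x"
proof
  assume "x \<in> A"
  then obtain y where y: "x = w ** y ** w" "y \<in> M" by (auto simp: corner_def)
  have "w ** (w ** y ** w) = w ** w ** y ** w" "w ** y ** w ** w = w ** y ** (w ** w)"
    by (simp_all add: matrix_mul_assoc)
  then show "x \<in> M \<and> w ** x = x \<and> x ** w = x"
    using y w_proj by (simp add: M.mult_mem)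
next
  assume "x \<in> M \<and> w ** x = x \<and> x ** w = x"
  then show "x \<in> A" unfolding corner_def by (intro CollectI exI[of _ x]) simp
qed

lemma B_mem: "x \<in> N \<Longrightarrow> x ** w \<in> B"
  by (auto simp: cut_def)

lemma matalg_A: "matalg A w"
proof
  show "star_alg A w"
    unfolding star_alg_def A_iff
  proof (intro conjI ballI allI; (elim conjE)?)
    fix x y assume *: "x \<in> A" "y \<in> A"
    then show "w ** (x ** y) = x ** y" "x ** y ** w = x ** y"
      unfolding A_iff by (simp_all add: matrix_mul_assoc, simp add: matrix_mul_assoc[symmetric])
  next
    fix x assume "x \<in> A"
    then have x: "x \<in> M" "w ** x = x" "x ** w = x" by (simp_all add: A_iff)
    show "w ** adj x = adj x" "adj x ** w = adj x"
      using arg_cong[OF x(3), of adj] arg_cong[OF x(2), of adj] w_proj(5) by (simp_all add: adj_mult)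
  qed (auto simp: A_iff M.zero_mem M.add_mem M.mult_mem M.smult_mem M.adj_mem w_proj
        matrix_add_ldistrib matrix_add_rdistrib)
qed

lemma B_sub_A: "B \<subseteq> A"
proof
  fix z assume "z \<in> B"
  then obtain y where y: "z = y ** w" "y \<in> N" by (auto simp: cut_def)
  have "w ** (y ** w) = y ** (w ** w)" using w_comm[OF y(2)] by (simp add: matrix_mul_assoc)
  moreover have "y ** w ** w = y ** (w ** w)" by (simp add: matrix_mul_assoc)
  ultimately show "z \<in> A" using y w_proj NM by (simp add: A_iff M.mult_mem)
qed

lemma matalg_B: "matalg B w"
proof
  have zero: "0 \<in> B" using B_mem[OF N.zero_mem] by simp
  have unit: "w \<in> B" using B_mem[OF N.unit_mem] w_proj by (simp add: M.unit_left)
  have add: "x + y \<in> B" if "x \<in> B" "y \<in> B" for x y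
    using that B_mem N.add_mem unfolding cut_def by (auto simp flip: matrix_add_rdistrib)
  have mult: "x ** y \<in> B" if B: "x \<in> B" "y \<in> B" for x y
  proof -
    obtain x' y' where xy: "x = x' ** w" "y = y' ** w" "x' \<in> N" "y' \<in> N"
      using B unfolding cut_def by blast
    have "x ** y = x' ** (w ** y') ** w" by (simp add: xy matrix_mul_assoc)
    also have "\<dots> = (x' ** y') ** (w ** w)"
      unfolding w_comm[OF xy(4)] by (simp add: matrix_mul_assoc)
    also have "\<dots> = (x' ** y') ** w" by (simp add: w_proj)
    finally show ?thesis using B_mem[OF N.mult_mem[OF xy(3,4)]] by simp
  qed
  have smult: "smult c x \<in> B" if "x \<in> B" for c x
    using that B_mem N.smult_mem unfolding cut_def by (auto simp flip: smult_mult_left)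
  have adjm: "adj x \<in> B" if B: "x \<in> B" for x
  proof -
    obtain x' where x': "x = x' ** w" "x' \<in> N" using B unfolding cut_def by blast
    then have "adj x = adj x' ** w"
      using w_comm[OF N.adj_mem[OF x'(2)]] w_proj by (simp add: adj_mult)
    then show ?thesis using B_mem[OF N.adj_mem[OF x'(2)]] by simp
  qed
  show "star_alg B w"
    unfolding star_alg_def
  proof (intro conjI ballI allI zero unit add mult smult adjm)
    fix x assume "x \<in> B"
    then have "x \<in> A" using B_sub_A by blast
    then show "w ** x = x" "x ** w = x" by (simp_all add: A_iff)
  qed
qed

text \<open>The minimal projection \<open>e0\<close> is chosen below \<open>w\<close>, so that the
  matrix units of \<open>M p\<close> with initial projection \<open>e0\<close> remain usable in the
  corner after left multiplication by \<open>w\<close>.\<close>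

lemma center_A:
  assumes z: "z \<in> center A"
  shows "\<exists>c. z = smult c w"
proof -
  have zA: "z \<in> M" "w ** z = z" "z ** w = z" using z by (auto simp: center_def A_iff)
  have zc: "z ** x = x ** z" if "x \<in> A" for x using z that by (simp add: center_def)
  obtain e0 where e0: "minproj M e0" "e0 ** w = e0"
    using M.minproj_exists[OF w_proj(2,1,3)] by blast
  note eD = M.minprojD[OF e0(1)]
  have e0p: "e0 ** p = e0" using e0(2) w_p by (metis matrix_mul_assoc)
  have we0: "w ** e0 = e0" using is_proj_absorb[OF eD(2) w_proj(1)] e0(2) by simp
  have e0A: "e0 \<in> A" using eD we0 e0 by (simp add: A_iff)
  obtain c where c: "e0 ** z ** e0 = smult c e0" using M.minproj_scalar[OF e0(1) zA(1)] by blast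
  have "e0 ** z ** e0 = e0 ** (e0 ** z)" using zc[OF e0A] by (simp add: matrix_mul_assoc[symmetric])
  then have ez: "e0 ** z = smult c e0" using c eD(4) by (simp add: matrix_mul_assoc)
  obtain F where F: "M.column_frame p e0 F" by (rule M.column_frame_exists[OF p e0(1) e0p])
  note FD = M.column_frameD[OF F]
  have "z = smult c w"
  proof (rule matalg.center_trivial[OF matalg_A z ez])
    fix v assume v: "v \<in> F"
    show we: "w ** v ** e0 = w ** v" using FD(3)[OF v] by (metis matrix_mul_assoc)
    have "w ** v ** w = w ** v" using we e0(2) by (metis matrix_mul_assoc)
    moreover have "w ** (w ** v) = w ** v" using w_proj(4) by (simp add: matrix_mul_assoc)
    ultimately show "w ** v \<in> A" using FD(2)[OF v] w_proj(2) by (simp add: A_iff M.mult_mem)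
  next
    have "(\<Sum>v\<in>F. w ** v ** (adj v ** w)) = w ** p ** w"
      by (simp add: FD(5)[symmetric] matrix_mult_sum_left matrix_mult_sum_right matrix_mul_assoc)
    then show "(\<Sum>v\<in>F. w ** v ** (adj v ** w)) = w" by (simp add: w_p w_proj)
  qed
  then show ?thesis by blast
qed

lemma fw: "f q ** w = f q ** p"
  unfolding w_def using fD[OF q] f_mcp[OF p q] by (metis matrix_mul_assoc)

text \<open>The cut by \<open>w\<close> carries \<open>f q\<close> and the matrix units
  \<open>g\<close> of \<open>N q\<close> to \<open>f q ** w\<close> and \<open>g ** w\<close>, which
  show as in \<open>N q\<close> that a central element is a scalar.\<close>

lemma center_B:
  assumes z: "z \<in> center B"
  shows "\<exists>c. z = smult c w"
proof -
  have zB: "z \<in> B" and zc: "\<And>x. x \<in> B \<Longrightarrow> z ** x = x ** z" using z by (auto simp: center_def)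
  have zw: "z ** w = z" "w ** z = z" using zB B_sub_A A_iff by blast+
  obtain y where y: "z = y ** w" "y \<in> N" using zB by (auto simp: cut_def)
  have fN: "f q \<in> N" by (rule fD(1)[OF q])
  obtain c where c: "f q ** y ** f q = smult c (f q)" using N.minproj_scalar[OF f(1)[OF q] y(2)] by blast
  have ff: "f q ** w ** (f q ** w) = f q ** w"
  proof -
    have "f q ** w ** (f q ** w) = f q ** (w ** f q) ** w" by (simp add: matrix_mul_assoc)
    also have "\<dots> = (f q ** f q) ** (w ** w)" unfolding w_comm[OF fN] by (simp add: matrix_mul_assoc)
    finally show ?thesis by (simp add: fD(5)[OF q] w_proj)
  qed
  have "z ** (f q ** w) = (f q ** w) ** z ** (f q ** w)"
    using zc[OF B_mem[OF fN]] ff by (metis matrix_mul_assoc)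
  also have "\<dots> = f q ** (w ** z) ** (f q ** w)" by (simp add: matrix_mul_assoc)
  also have "\<dots> = f q ** y ** (w ** f q) ** w" by (simp add: zw) (simp add: y matrix_mul_assoc)
  also have "\<dots> = (f q ** y ** f q) ** (w ** w)"
    unfolding w_comm[OF fN] by (simp add: matrix_mul_assoc)
  finally have zf: "z ** (f q ** w) = smult c (f q ** w)" by (simp add: c w_proj)
  obtain G where G: "N.column_frame q (f q) G" by (rule N.column_frame_exists[OF q f[OF q]])
  note GD = N.column_frameD[OF G]
  have "z = smult c w"
  proof (rule matalg.center_trivial[OF matalg_B z])
    show "(f q ** w) ** z = smult c (f q ** w)" using zf zc[OF B_mem[OF fN]] by simp
    fix g assume g: "g \<in> G"
    show "g ** w \<in> B" by (rule B_mem[OF GD(2)[OF g]])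
    have "g ** w ** (f q ** w) = g ** (w ** f q) ** w" by (simp add: matrix_mul_assoc)
    also have "\<dots> = (g ** f q) ** (w ** w)" unfolding w_comm[OF fN] by (simp add: matrix_mul_assoc)
    finally show "g ** w ** (f q ** w) = g ** w" by (simp add: GD(3)[OF g] w_proj)
  next
    have "(\<Sum>g\<in>G. g ** w ** adj g) = (\<Sum>g\<in>G. g ** adj g ** w)"
      using w_comm[OF N.adj_mem[OF GD(2)]]
      by (intro sum.cong refl) (simp add: matrix_mul_assoc[symmetric])
    then show "(\<Sum>g\<in>G. g ** w ** adj g) = w"
      by (simp add: matrix_mult_sum_left[symmetric] GD(5) w_q)
  qed
  then show ?thesis by blast
qed

lemma reduced_inclusion: "inclusion B A w"
  using matalg_A matalg_B B_sub_A w_proj(3) center_A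
  by (intro inclusion.intro inclusion_axioms.intro)

lemma reduced_mcp: "mcp A = {w}" "mcp B = {w}"
  using matalg.factor_mcp[OF matalg_A w_proj(3)] matalg.factor_mcp[OF matalg_B w_proj(3)]
    center_A center_B by blast+

text \<open>A minimal projection of \<open>M\<close> below \<open>w\<close> stays minimal in the
  corner, and \<open>f q ** w\<close>, which equals \<open>f q ** p\<close>, is minimal in
  \<open>B\<close>. So numerator and denominator of the multiplicity are unchanged.\<close>

lemma reduced_Lam: "Lam B A w w = Lam N M p q"
proof -
  interpret A: matalg A w by (rule matalg_A)
  interpret B: matalg B w by (rule matalg_B)
  have wA: "w \<in> mcp A" and wB: "w \<in> mcp B" by (simp_all add: reduced_mcp)
  obtain e0 where e0: "minproj M e0" "e0 ** w = e0"
    using M.minproj_exists[OF w_proj(2,1,3)] by blast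
  note eD = M.minprojD[OF e0(1)]
  have e0p: "e0 ** p = e0" using e0(2) w_p by (metis matrix_mul_assoc)
  have "w ** e0 = e0" using is_proj_absorb[OF eD(2) w_proj(1)] e0(2) by simp
  then have "minproj A e0"
    using eD e0 M.minproj_scalar[OF e0(1)] by (intro A.minprojI) (auto simp: A_iff)
  then have 1: "mtrace (minproj_under A w) = mtrace (e p)"
    using A.minproj_mtrace_unique[OF wA A.minproj_under[OF wA] _ e0(2)]
      M.minproj_mtrace_unique[OF p e0(1) e0p e[OF p]] by simp
  have fwn: "f q ** w \<noteq> 0"
  proof
    assume "f q ** w = 0"
    then have "Lam N M p q = 0" by (simp add: Lam_def fw[symmetric])
    then show False using Lam_zero[OF p q] M.mcp_comm[OF p qM] pq by simp
  qed
  have "minproj B (f q ** w)"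
  proof (rule B.minprojI[OF B_mem[OF fD(1)[OF q]] _ fwn])
    show "is_proj (f q ** w)" unfolding fw by (rule fp_proj[OF p q])
    fix x assume "x \<in> B"
    then obtain y where y: "x = y ** w" "y \<in> N" by (auto simp: cut_def)
    obtain c where c: "f q ** y ** f q = smult c (f q)"
      using N.minproj_scalar[OF f(1)[OF q] y(2)] by blast
    have "f q ** w ** x ** (f q ** w) = f q ** (w ** y) ** w ** (f q ** w)"
      by (simp add: y matrix_mul_assoc)
    also have "\<dots> = f q ** y ** (w ** w) ** (f q ** w)"
      unfolding w_comm[OF y(2)] by (simp add: matrix_mul_assoc)
    also have "\<dots> = f q ** y ** (w ** f q) ** w" by (simp add: w_proj(4) matrix_mul_assoc)
    also have "\<dots> = (f q ** y ** f q) ** (w ** w)"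
      unfolding w_comm[OF fD(1)[OF q]] by (simp add: matrix_mul_assoc)
    finally show "\<exists>c. f q ** w ** x ** (f q ** w) = smult c (f q ** w)"
      by (auto simp: c w_proj)
  qed
  moreover have "f q ** w ** w = f q ** w" by (simp add: matrix_mul_assoc[symmetric] w_proj)
  ultimately have 2: "mtrace (minproj_under B w) = mtrace (f q ** p)"
    using B.minproj_mtrace_unique[OF wB B.minproj_under[OF wB]] fw by simp
  show ?thesis
    unfolding Lam_def B.minproj_under(2)[OF wB] 1 2 ..
qed

text \<open>The Bratteli matrix has the single entry \<open>Lam N M p q\<close>, with the constant
  vector \<open>1\<close> as Perron vector, so \<open>I.d\<close> squared is the square of that
  entry. The Markov equation then holds for every tracial state, which makes the tracial state
  unique and equal to the Markov trace; the Jones index is thus the minimal index.\<close>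

lemma reduced_indices:
  "min_index A B = (Lam N M p q)\<^sup>2" "jones_index A B w = (Lam N M p q)\<^sup>2"
proof -
  interpret I: inclusion B A w by (rule reduced_inclusion)
  obtain \<phi> where \<phi>: "I.is_markov \<phi>" by (rule I.is_markov_exists)
  interpret T: markov_inclusion B A w \<phi> by (rule I.is_markov_inclusion[OF \<phi>])
  have d: "I.d\<^sup>2 = (Lam N M p q)\<^sup>2"
    unfolding I.d_def dnorm_def
    by (rule I.bratteli.eigenvalue_rnorm(1)[of "\<lambda>_. 1"])
       (simp_all add: I.bratteli.tr_def I.bratteli.ap_def,
        simp_all add: reduced_mcp reduced_Lam power2_eq_square)
  show "min_index A B = (Lam N M p q)\<^sup>2" using T.min_index_eq d by simp
  have "I.is_markov \<psi>" if "tracial_state A w \<psi>" for \<psi>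
    using that d unfolding I.is_markov_iff I.bratteli.tr_def I.bratteli.ap_def
    unfolding reduced_mcp by (simp add: reduced_Lam power2_eq_square)
  then have "(THE \<phi>. tracial_state A w \<phi>) = \<phi>"
    using T.tau I.is_markov_unique[OF _ \<phi>] by (intro the_equality) auto
  then show "jones_index A B w = (Lam N M p q)\<^sup>2"
    using T.mnorm_Ind_the d by (simp add: jones_index_def)
qed

end

section \<open>The matrices of the inclusion and the sizes of the summands\<close>

lemma Dmat_JonesMat:
  assumes p: "p \<in> mcp M" and q: "q \<in> mcp N"
  shows "Dmat N M p q = Lam N M p q \<and> JonesMat N M p q = Lam N M p q"
proof (cases "p ** q = 0")
  case True
  have "f q ** p = f q ** (p ** q)"
    using fD(9,10)[OF q] M.mcp_comm[OF p NM[OF N.mcpD(1)[OF q]]] by (metis matrix_mul_assoc)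
  then have "Lam N M p q = 0" using True by (simp add: Lam_def)
  then show ?thesis using True by (simp add: Dmat_def JonesMat_def)
next
  case False
  then show ?thesis
    using reduced_indices[OF p q False refl] Lam_nonneg[OF p q] by (simp add: Dmat_def JonesMat_def)
qed

text \<open>The relation \<open>\<Lambda> k = h\<close>, by comparing traces: each of the
  \<open>ssize N q\<close> diagonal matrix units of \<open>N q\<close> contributes
  \<open>mtrace (f q ** p)\<close> to \<open>mtrace (q ** p)\<close>.\<close>

lemma Lam_ssize:
  assumes p: "p \<in> mcp M"
  shows "ssize M p = (\<Sum>q\<in>mcp N. Lam N M p q * ssize N q)"
proof -
  have qp: "mtrace (q ** p) = of_real (Lam N M p q * ssize N q) * mtrace (e p)" if q: "q \<in> mcp N" for q
  proof -
    obtain G where G: "N.column_frame q (f q) G" by (rule N.column_frame_exists[OF q f[OF q]])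
    note GD = N.column_frameD[OF G]
    have "mtrace (q ** p) = (\<Sum>g\<in>G. mtrace (g ** (adj g ** p)))"
      by (simp add: GD(5)[symmetric] matrix_mult_sum_left mtrace_sum matrix_mul_assoc)
    also have "\<dots> = (\<Sum>g\<in>G. mtrace (f q ** p))"
    proof (intro sum.cong refl)
      fix g assume g: "g \<in> G"
      have "mtrace (g ** (adj g ** p)) = mtrace (adj g ** (p ** g))"
        by (subst mtrace_commute) (simp add: matrix_mul_assoc)
      also have "adj g ** (p ** g) = (adj g ** g) ** p"
        using M.mcp_comm[OF p NM[OF GD(2)[OF g]]] by (simp add: matrix_mul_assoc)
      finally show "mtrace (g ** (adj g ** p)) = mtrace (f q ** p)" using GD(4)[OF g g] by simp
    qed
    finally show ?thesis
      using mtrace_Lam[OF p q] N.ssize_card[OF G q f(1)[OF q]] by simp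
  qed
  have "of_real (ssize M p) * mtrace (e p) = mtrace p"
    using M.mtrace_ssize[OF p e[OF p]] by simp
  also have "\<dots> = mtrace (\<Sum>q\<in>mcp N. q ** p)"
    using M.mcpD(1)[OF p] by (simp add: matrix_mult_sum_left[symmetric] N.mcp_sum M.unit_left)
  also have "\<dots> = of_real (\<Sum>q\<in>mcp N. Lam N M p q * ssize N q) * mtrace (e p)"
    by (simp add: mtrace_sum qp sum_distrib_right)
  finally have "complex_of_real (ssize M p) = of_real (\<Sum>q\<in>mcp N. Lam N M p q * ssize N q)"
    using M.minprojD(7)[OF e(1)[OF p]] by simp
  then show ?thesis by (simp only: of_real_eq_iff)
qed

end

section \<open>The Perron--Frobenius state against the Markov trace on the centre of
  \<open>N\<close>\<close>

context markov_inclusion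
begin

lemma ap_t: "p \<in> mcp M \<Longrightarrow> bratteli.ap t p = d\<^sup>2 * s p"
  using markov by (simp add: bratteli.ap_def)

lemma tr_ap_t: "q \<in> mcp N \<Longrightarrow> bratteli.tr (bratteli.ap t) q = d\<^sup>2 * t q"
  using bratteli.tr_scale[of "bratteli.ap t" "d\<^sup>2" s q] ap_t t_eq[of q]
  by (simp add: bratteli.tr_def)

lemma sum_t_sq_pos: "0 < (\<Sum>q\<in>mcp N. (t q)\<^sup>2)"
  by (intro sum_pos zero_less_power t_pos N.mcp_finite mcp_nonempty)

text \<open>Since \<open>D\<close> equals \<open>\<Lambda>\<close>, the vector in the definition is
  a positive eigenvector of \<open>\<Lambda>\<^sup>t \<Lambda>\<close>, hence a multiple of
  \<open>t\<close>. The eigenvalue \<open>r\<close> there is left open, but positivity of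
  \<open>v\<close> forces it to be \<open>d\<^sup>2\<close>.\<close>

lemma nu_eq:
  assumes "q \<in> mcp N"
  shows "nu N M q = (t q)\<^sup>2 / (\<Sum>q\<in>mcp N. (t q)\<^sup>2)"
proof -
  let ?T = "\<Sum>q\<in>mcp N. (t q)\<^sup>2"
  let ?P = "\<lambda>v. (\<forall>q\<in>mcp N. v q > 0) \<and> (\<forall>q. q \<notin> mcp N \<longrightarrow> v q = 0) \<and>
     (\<Sum>q\<in>mcp N. (v q)^2) = 1 \<and>
     (\<exists>r. \<forall>q\<in>mcp N. (\<Sum>q'\<in>mcp N. (\<Sum>p\<in>mcp M. Dmat N M p q * Dmat N M p q') * v q') = r * v q)"
  have D: "(\<Sum>q'\<in>mcp N. (\<Sum>p\<in>mcp M. Dmat N M p q * Dmat N M p q') * v q') = bratteli.tr (bratteli.ap v) q"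
    if "q \<in> mcp N" for v q
    using that Dmat_JonesMat by (simp add: bratteli.tr_ap_eq)
  \<comment> \<open>Zero off \<open>mcp N\<close>, as \<open>nu\<close> demands; only then is the
    vector unique as a function.\<close>
  define v0 where "v0 q = (if q \<in> mcp N then t q / sqrt ?T else 0)" for q
  have ap0: "bratteli.ap v0 p = (1 / sqrt ?T) * bratteli.ap t p" for p
    by (rule bratteli.ap_scale) (simp add: v0_def)
  have "(\<Sum>q\<in>mcp N. (v0 q)\<^sup>2) = ?T / ?T"
    unfolding sum_divide_distrib using sum_t_sq_pos
    by (intro sum.cong refl) (simp add: v0_def power_divide)
  then have n0: "(\<Sum>q\<in>mcp N. (v0 q)\<^sup>2) = 1" using sum_t_sq_pos by simp
  have e0: "bratteli.tr (bratteli.ap v0) q = d\<^sup>2 * v0 q" if "q \<in> mcp N" for q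
    using bratteli.tr_scale[of "bratteli.ap v0" "1 / sqrt ?T" "bratteli.ap t" q] ap0 tr_ap_t[OF that] that
    by (simp add: v0_def)
  have P0: "?P v0"
  proof (intro conjI exI[of _ "d\<^sup>2"] ballI allI impI n0)
    show "0 < v0 q" if "q \<in> mcp N" for q using that sum_t_sq_pos t_pos by (simp add: v0_def)
    show "v0 q = 0" if "q \<notin> mcp N" for q using that by (simp add: v0_def)
    show "(\<Sum>q'\<in>mcp N. (\<Sum>p\<in>mcp M. Dmat N M p q * Dmat N M p q') * v0 q') = d\<^sup>2 * v0 q"
      if "q \<in> mcp N" for q
      unfolding D[OF that] by (rule e0[OF that])
  qed
  have uniq: "v = v0" if v: "?P v" for v
  proof -
    obtain r where "\<forall>q\<in>mcp N. (\<Sum>q'\<in>mcp N. (\<Sum>p\<in>mcp M. Dmat N M p q * Dmat N M p q') * v q') = r * v q"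
      using v by blast
    then have r: "\<And>q. q \<in> mcp N \<Longrightarrow> bratteli.tr (bratteli.ap v) q = r * v q"
      by (simp add: D)
    have vpos: "\<And>q. q \<in> mcp N \<Longrightarrow> 0 < v q" using v by blast
    obtain c where c: "0 < c" "\<And>q. q \<in> mcp N \<Longrightarrow> v q = c * t q"
      using bratteli.eigenvector_unique[OF t_pos tr_ap_t vpos r] by blast
    have "1 = c\<^sup>2 * ?T" using v c(2) by (simp add: power_mult_distrib sum_distrib_left)
    then have "c\<^sup>2 = 1 / ?T" using sum_t_sq_pos by (simp add: eq_divide_eq)
    then have "sqrt (c\<^sup>2) = 1 / sqrt ?T" by (simp add: real_sqrt_divide)
    then have "c = 1 / sqrt ?T" using c(1) by simp
    then show ?thesis using v c(2) by (auto simp: v0_def fun_eq_iff)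
  qed
  have "nu N M = (\<lambda>q. (v0 q)\<^sup>2)"
    unfolding nu_def
  proof (rule the_equality)
    show "\<exists>v. (\<forall>q\<in>mcp N. v q > 0) \<and> (\<forall>q. q \<notin> mcp N \<longrightarrow> v q = 0) \<and>
     (\<Sum>q\<in>mcp N. (v q)^2) = 1 \<and>
     (\<exists>r. \<forall>q\<in>mcp N. (\<Sum>q'\<in>mcp N. (\<Sum>p\<in>mcp M. Dmat N M p q * Dmat N M p q') * v q') = r * v q) \<and>
     (\<lambda>q. (v0 q)\<^sup>2) = (\<lambda>q. (v q)^2)"
      using P0 by (intro exI[of _ v0]) auto
  qed (use uniq in blast)
  then show ?thesis using assms sum_t_sq_pos by (simp add: v0_def power_divide)
qed

text \<open>Cancelling one factor \<open>t q > 0\<close> turns the equality of states into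
  \<open>t q = ?T * ssize N q\<close>. On the other side \<open>Lam_ssize\<close> replaces
  \<open>\<Lambda>\<^sup>t h\<close> by \<open>\<Lambda>\<^sup>t \<Lambda> k\<close>, so the
  condition says that \<open>k\<close> is a Perron vector.\<close>

lemma nu_eq_trace_iff:
  "(\<forall>q\<in>mcp N. complex_of_real (nu N M q) = \<tau> q) \<longleftrightarrow>
    (\<forall>q\<in>mcp N. (\<Sum>p\<in>mcp M. Lam N M p q * ssize M p) = (dnorm N M)\<^sup>2 * ssize N q)"
proof -
  let ?T = "\<Sum>q\<in>mcp N. (t q)\<^sup>2"
  have "complex_of_real (nu N M q) = \<tau> q \<longleftrightarrow> t q = ?T * ssize N q" if q: "q \<in> mcp N" for q
  proof -
    have "complex_of_real (nu N M q) = \<tau> q \<longleftrightarrow> (t q)\<^sup>2 / ?T = ssize N q * t q"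
      unfolding nu_eq[OF q] tau_mcp[OF q] by (simp only: of_real_eq_iff)
    also have "\<dots> \<longleftrightarrow> t q * t q = t q * (?T * ssize N q)"
      using sum_t_sq_pos by (simp add: divide_eq_eq power2_eq_square mult_ac)
    also have "\<dots> \<longleftrightarrow> t q = ?T * ssize N q" using t_pos[OF q] by simp
    finally show ?thesis .
  qed
  then have 1: "(\<forall>q\<in>mcp N. complex_of_real (nu N M q) = \<tau> q) \<longleftrightarrow> (\<forall>q\<in>mcp N. t q = ?T * ssize N q)"
    by simp
  have 2: "(\<Sum>p\<in>mcp M. Lam N M p q * ssize M p) = bratteli.tr (bratteli.ap (ssize N)) q" for q
    unfolding bratteli.tr_def bratteli.ap_def by (intro sum.cong refl) (simp add: Lam_ssize)
  have "(\<forall>q\<in>mcp N. t q = ?T * ssize N q) \<longleftrightarrow>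
      (\<forall>q\<in>mcp N. bratteli.tr (bratteli.ap (ssize N)) q = d\<^sup>2 * ssize N q)"
  proof
    assume *: "\<forall>q\<in>mcp N. t q = ?T * ssize N q"
    have ap: "bratteli.ap t p = ?T * bratteli.ap (ssize N) p" for p
      by (rule bratteli.ap_scale) (use * in blast)
    show "\<forall>q\<in>mcp N. bratteli.tr (bratteli.ap (ssize N)) q = d\<^sup>2 * ssize N q"
    proof
      fix q assume q: "q \<in> mcp N"
      have "?T * bratteli.tr (bratteli.ap (ssize N)) q = d\<^sup>2 * t q"
        using bratteli.tr_scale[of "bratteli.ap t" ?T "bratteli.ap (ssize N)" q] ap tr_ap_t[OF q] by simp
      also have "t q = ?T * ssize N q" using * q by blast
      finally have "?T * bratteli.tr (bratteli.ap (ssize N)) q = ?T * (d\<^sup>2 * ssize N q)"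
        by (simp only: mult.left_commute)
      then show "bratteli.tr (bratteli.ap (ssize N)) q = d\<^sup>2 * ssize N q"
        using sum_t_sq_pos by simp
    qed
  next
    assume eig: "\<forall>q\<in>mcp N. bratteli.tr (bratteli.ap (ssize N)) q = d\<^sup>2 * ssize N q"
    obtain c where c: "0 < c" "\<And>q. q \<in> mcp N \<Longrightarrow> ssize N q = c * t q"
      using bratteli.eigenvector_unique[of t "d\<^sup>2" "ssize N" "d\<^sup>2"] t_pos tr_ap_t N.ssize_pos eig
      by blast
    \<comment> \<open>Proportionality alone is too weak; the normalisation of the trace identifies
      the factor as \<open>1 / ?T\<close>.\<close>
    have "(\<Sum>q\<in>mcp N. ssize N q * t q) = 1"
      using N.tracial_state_weights[OF tau_restrict] by (simp add: fD t_def)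
    then have "c * ?T = 1"
      using c(2) by (simp add: sum_distrib_left power2_eq_square mult_ac)
    then have "?T * (c * t q) = t q" for q by (simp add: mult.commute[of ?T] mult.assoc[symmetric])
    then show "\<forall>q\<in>mcp N. t q = ?T * ssize N q" by (simp add: c(2))
  qed
  with 1 show ?thesis unfolding 2 d_def by simp
qed

end

theorem mainTheorem8:
  fixes N M :: "('n::finite) cmat set"
  assumes "star_alg N (mat 1)" and "star_alg M (mat 1)" and "N \<subseteq> M"
    and "connected_incl N M"
  shows "(\<forall>p\<in>mcp M. \<forall>q\<in>mcp N. Dmat N M p q = Lam N M p q \<and> JonesMat N M p q = Lam N M p q)
    \<and> extremal N M
    \<and> (super_extremal N M \<longleftrightarrow>
         (\<forall>q\<in>mcp N. (\<Sum>p\<in>mcp M. Lam N M p q * ssize M p) = (dnorm N M)^2 * ssize N q))"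
proof -
  have mat: "mat c = smult c (mat 1 :: 'n cmat)" for c
    by (simp add: mat_def smult_def vec_eq_iff)
  interpret inclusion N M "mat 1 :: 'n cmat"
  proof
    show "mat 1 \<noteq> (0 :: 'n cmat)" by (simp add: mat_def vec_eq_iff)
    fix z assume "z \<in> center N" "z \<in> center M"
    then have "z \<in> range mat" using assms(4) by (auto simp: connected_incl_def)
    then show "\<exists>c. z = smult c (mat 1)" using mat by blast
  qed (use assms in auto)
  obtain \<tau> where \<tau>: "is_markov \<tau>" by (rule is_markov_exists)
  interpret T: markov_inclusion N M "mat 1" \<tau> by (rule is_markov_inclusion[OF \<tau>])
  have mt: "markov_trace N M = \<tau>"
    unfolding markov_trace_def is_markov_def[symmetric]
    using \<tau> is_markov_unique by (intro the_equality) auto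
  have ext: "extremal N M"
    unfolding extremal_def Etau_def mt by (rule T.minimal_eq_trace_preserving)
  show ?thesis
    using Dmat_JonesMat ext T.nu_eq_trace_iff unfolding super_extremal_def mt by blast
qed

end
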